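(* Let $q$ be a power of a prime $p$, let $\mathbb{F}_q$ be the finite field with $q$ elements, let $V$ be an $\mathbb{F}_q$-vector space of finite dimension $d$, and let $G \subseteq GL(V)$ be a subgroup. Let $R = \mathbb{F}_q[V] = \operatorname{Sym}(V^* )$, let $S = R^G$, and let $\mathbf{d}_{d,0} = \prod_{0 \neq v \in V^*} v \in S$. For $0 \leq j \leq d-1$ let $a_j \geq 1$ be the smallest positive integer such that $\mathbf{d}_{d,0}^{a_j} \in \operatorname{ann}_S H^j_{S_+}(S)$, and for $0 \leq i \leq d-1$ set $\mathfrak{q}_i = \prod_{j=0}^{i} \mathbf{d}_{d,0}^{a_j}$. Let $\mathbf{x} = x_1, \ldots, x_d$ be a homogeneous system of parameters of $S$. Then $$\mathfrak{q}_{d-1} \in \operatorname{ann}_S \frac{(x_1, \ldots, x_{t-1}) \colon x_t}{(x_1, \ldots, x_{t-1})} \quad \text{for } t = 1, \ldots, d.$$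
   Context: The group $G$ (which is finite) acts on $V^*$ by the dual action and on $R = \operatorname{Sym}(V^* )$ by the induced $\mathbb{F}_q$-algebra automorphisms. $R$ is graded with the elements of $V^*$ in degree $1$, and $S = R^G$ is a graded subring with $S_0 = \mathbb{F}_q$, Krull dimension $d$ and irrelevant maximal ideal $S_+ = \bigoplus_{n \geq 1} S_n$. $H^j_{S_+}(S)$ is the $j$-th local cohomology module of $S$ with respect to $S_+$. The element $\mathbf{d}_{d,0}$ (the top Dickson class) is invariant under $GL(V)$, so it lies in $S$. For each $0 \leq j \leq d-1$ some power of $\mathbf{d}_{d,0}$ annihilates $H^j_{S_+}(S)$, so the integers $a_j$ are well defined. For $t=1$ the ideal $(x_1,\ldots,x_{t-1})$ is the zero ideal. *)

theory Defs
  imports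
    Complex_Main
    "HOL-Algebra.QuotRing"
    "HOL-Algebra.Module"
    "HOL-Library.Poly_Mapping"
    "HOL-Library.FuncSet"
    "HOL-Computational_Algebra.Primes"
begin

section \<open>Ideals, quotient modules, annihilators\<close>

text \<open>
  HOL-Algebra's module records extend ring records; the fields \<open>mult\<close> and \<open>one\<close> of a module
  that is not an algebra carry no meaning and are left \<open>undefined\<close> below.
\<close>

definition self_module :: "('r, 'm) ring_scheme \<Rightarrow> ('r, 'r) module" where
  "self_module R = \<lparr>carrier = carrier R, monoid.mult = monoid.mult R, one = one R,
     zero = zero R, add = add R, smult = monoid.mult R\<rparr>"

definition quot_module :: "('r, 'm) module \<Rightarrow> 'm set \<Rightarrow> ('r, 'm set) module" where
  "quot_module M N = \<lparr>carrier = a_rcosets\<^bsub>M\<^esub> N, monoid.mult = undefined, one = undefined,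
     zero = N, add = set_add M,
     smult = (\<lambda>r C. \<Union>m\<in>C. N +>\<^bsub>M\<^esub> (r \<odot>\<^bsub>M\<^esub> m))\<rparr>"

definition ann :: "('r, 'n) ring_scheme \<Rightarrow> ('r, 'm) module \<Rightarrow> 'r set" where
  "ann R M = {r \<in> carrier R. \<forall>m \<in> carrier M. r \<odot>\<^bsub>M\<^esub> m = \<zero>\<^bsub>M\<^esub>}"

definition colon :: "('r, 'n) ring_scheme \<Rightarrow> 'r set \<Rightarrow> 'r \<Rightarrow> 'r set" where
  "colon R J x = {r \<in> carrier R. r \<otimes>\<^bsub>R\<^esub> x \<in> J}"

text \<open>The \<open>R\<close>-module \<open>(J : x) / J\<close>.\<close>

definition colon_quot :: "('r, 'n) ring_scheme \<Rightarrow> 'r set \<Rightarrow> 'r \<Rightarrow> ('r, 'r set) module" where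
  "colon_quot R J x = quot_module ((self_module R)\<lparr>carrier := colon R J x\<rparr>) J"

definition radical :: "('r, 'n) ring_scheme \<Rightarrow> 'r set \<Rightarrow> 'r set" where
  "radical R J = {r \<in> carrier R. \<exists>n::nat. r [^]\<^bsub>R\<^esub> n \<in> J}"

section \<open>Localisation of modules\<close>

definition frac_rel ::
  "('r, 'n) ring_scheme \<Rightarrow> ('r, 'm) module \<Rightarrow> 'r set \<Rightarrow> (('m \<times> 'r) \<times> ('m \<times> 'r)) set" where
  "frac_rel R M T = {((m, s), (m', s')). m \<in> carrier M \<and> m' \<in> carrier M \<and> s \<in> T \<and> s' \<in> T \<and>
     (\<exists>u \<in> T. u \<odot>\<^bsub>M\<^esub> (s' \<odot>\<^bsub>M\<^esub> m) = u \<odot>\<^bsub>M\<^esub> (s \<odot>\<^bsub>M\<^esub> m'))}"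

definition mfrac ::
  "('r, 'n) ring_scheme \<Rightarrow> ('r, 'm) module \<Rightarrow> 'r set \<Rightarrow> 'm \<Rightarrow> 'r \<Rightarrow> ('m \<times> 'r) set" where
  "mfrac R M T m s = frac_rel R M T `` {(m, s)}"

definition localization ::
  "('r, 'n) ring_scheme \<Rightarrow> ('r, 'm) module \<Rightarrow> 'r set \<Rightarrow> ('r, ('m \<times> 'r) set) module" where
  "localization R M T = \<lparr>carrier = (carrier M \<times> T) // frac_rel R M T,
     monoid.mult = undefined, one = undefined,
     zero = mfrac R M T \<zero>\<^bsub>M\<^esub> \<one>\<^bsub>R\<^esub>,
     add = (\<lambda>X Y. \<Union>(m, s)\<in>X. \<Union>(m', s')\<in>Y.
              mfrac R M T ((s' \<odot>\<^bsub>M\<^esub> m) \<oplus>\<^bsub>M\<^esub> (s \<odot>\<^bsub>M\<^esub> m')) (s \<otimes>\<^bsub>R\<^esub> s')),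
     smult = (\<lambda>r X. \<Union>(m, s)\<in>X. mfrac R M T (r \<odot>\<^bsub>M\<^esub> m) s)\<rparr>"

text \<open>The canonical map from the localisation at a subset of \<open>T\<close> to the localisation at \<open>T\<close>.\<close>

definition loc_map ::
  "('r, 'n) ring_scheme \<Rightarrow> ('r, 'm) module \<Rightarrow> 'r set \<Rightarrow> ('m \<times> 'r) set \<Rightarrow> ('m \<times> 'r) set" where
  "loc_map R M T X = (\<Union>(m, s)\<in>X. mfrac R M T m s)"

section \<open>Local cohomology\<close>

text \<open>
  Local cohomology is the cohomology of the extended Cech complex
  \<open>0 \<rightarrow> M \<rightarrow> \<Oplus>\<^sub>i M[1/f\<^sub>i] \<rightarrow> \<Oplus>\<^sub>i\<^sub><\<^sub>k M[1/(f\<^sub>i f\<^sub>k)] \<rightarrow> \<dots>\<close> on elements \<open>f\<^sub>0, \<dots>, f\<^sub>r\<^sub>-\<^sub>1\<close> that generate the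
  ideal up to radical.  The summand for an index set \<open>A\<close> is the localisation at the monomials
  in the \<open>f\<^sub>i\<close> with \<open>i \<in> A\<close>, which is the localisation at the powers of their product; with these
  denominator sets the restriction maps do not change the representing fractions.
\<close>

definition monomials :: "('r, 'n) ring_scheme \<Rightarrow> 'r list \<Rightarrow> nat set \<Rightarrow> 'r set" where
  "monomials R fs A = {\<Otimes>\<^bsub>R\<^esub>i\<in>A. (fs ! i) [^]\<^bsub>R\<^esub> (e i :: nat) | e. True}"

definition cech_index :: "'r list \<Rightarrow> nat \<Rightarrow> nat set set" where
  "cech_index fs j = {A. A \<subseteq> {..<length fs} \<and> card A = j}"

abbreviation cech_summand ::
  "('r, 'n) ring_scheme \<Rightarrow> ('r, 'm) module \<Rightarrow> 'r list \<Rightarrow> nat set \<Rightarrow> ('r, ('m \<times> 'r) set) module" where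
  "cech_summand R M fs A \<equiv> localization R M (monomials R fs A)"

definition cech_module ::
  "('r, 'n) ring_scheme \<Rightarrow> ('r, 'm) module \<Rightarrow> 'r list \<Rightarrow> nat
     \<Rightarrow> ('r, nat set \<Rightarrow> ('m \<times> 'r) set) module" where
  "cech_module R M fs j = \<lparr>carrier = (\<Pi>\<^sub>E A\<in>cech_index fs j. carrier (cech_summand R M fs A)),
     monoid.mult = undefined, one = undefined,
     zero = (\<lambda>A\<in>cech_index fs j. \<zero>\<^bsub>cech_summand R M fs A\<^esub>),
     add = (\<lambda>b c. \<lambda>A\<in>cech_index fs j. b A \<oplus>\<^bsub>cech_summand R M fs A\<^esub> c A),
     smult = (\<lambda>r c. \<lambda>A\<in>cech_index fs j. r \<odot>\<^bsub>cech_summand R M fs A\<^esub> c A)\<rparr>"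

definition cech_diff ::
  "('r, 'n) ring_scheme \<Rightarrow> ('r, 'm) module \<Rightarrow> 'r list \<Rightarrow> nat
     \<Rightarrow> (nat set \<Rightarrow> ('m \<times> 'r) set) \<Rightarrow> (nat set \<Rightarrow> ('m \<times> 'r) set)" where
  "cech_diff R M fs j c = (\<lambda>B\<in>cech_index fs (Suc j).
     \<Oplus>\<^bsub>cech_summand R M fs B\<^esub>i\<in>B.
       (let y = loc_map R M (monomials R fs B) (c (B - {i}))
        in if even (card {l\<in>B. l < i}) then y else \<ominus>\<^bsub>cech_summand R M fs B\<^esub> y))"

definition cech_cocycles ::
  "('r, 'n) ring_scheme \<Rightarrow> ('r, 'm) module \<Rightarrow> 'r list \<Rightarrow> nat \<Rightarrow> (nat set \<Rightarrow> ('m \<times> 'r) set) set" where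
  "cech_cocycles R M fs j = {c \<in> carrier (cech_module R M fs j).
     cech_diff R M fs j c = \<zero>\<^bsub>cech_module R M fs (Suc j)\<^esub>}"

definition cech_coboundaries ::
  "('r, 'n) ring_scheme \<Rightarrow> ('r, 'm) module \<Rightarrow> 'r list \<Rightarrow> nat \<Rightarrow> (nat set \<Rightarrow> ('m \<times> 'r) set) set" where
  "cech_coboundaries R M fs j = (case j of
       0 \<Rightarrow> {\<zero>\<^bsub>cech_module R M fs 0\<^esub>}
     | Suc i \<Rightarrow> cech_diff R M fs i ` carrier (cech_module R M fs i))"

definition cech_cohomology ::
  "('r, 'n) ring_scheme \<Rightarrow> ('r, 'm) module \<Rightarrow> 'r list \<Rightarrow> nat
     \<Rightarrow> ('r, (nat set \<Rightarrow> ('m \<times> 'r) set) set) module" where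
  "cech_cohomology R M fs j =
     quot_module ((cech_module R M fs j)\<lparr>carrier := cech_cocycles R M fs j\<rparr>)
       (cech_coboundaries R M fs j)"

text \<open>
  Over a Noetherian ring the cohomology does not depend, up to isomorphism, on the chosen
  sequence (nor on \<open>I\<close> beyond its radical).
\<close>

definition local_cohomology ::
  "('r, 'n) ring_scheme \<Rightarrow> 'r set \<Rightarrow> ('r, 'm) module \<Rightarrow> nat
     \<Rightarrow> ('r, (nat set \<Rightarrow> ('m \<times> 'r) set) set) module" where
  "local_cohomology R I M j = cech_cohomology R M
     (SOME fs. set fs \<subseteq> carrier R \<and> radical R (genideal R (set fs)) = radical R I) j"

section \<open>Symmetric algebras\<close>

text \<open>
  For a module \<open>W\<close> over the base ring \<open>'k\<close>, the symmetric algebra is the polynomial ring in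
  variables \<open>X\<^sub>w\<close>, \<open>w \<in> W\<close>, modulo the relations saying that \<open>w \<mapsto> X\<^sub>w\<close> is linear.
\<close>

type_synonym ('k, 'w) mpol = "('w \<Rightarrow>\<^sub>0 nat) \<Rightarrow>\<^sub>0 'k"
type_synonym ('k, 'w) symel = "('k, 'w) mpol set"

definition mvar :: "'w \<Rightarrow> ('k::comm_ring_1, 'w) mpol" where
  "mvar w = Poly_Mapping.single (Poly_Mapping.single w 1) 1"

definition mconst :: "'k::comm_ring_1 \<Rightarrow> ('k, 'w) mpol" where
  "mconst c = Poly_Mapping.single 0 c"

definition poly_ring :: "'w set \<Rightarrow> ('k::comm_ring_1, 'w) mpol ring" where
  "poly_ring A = \<lparr>carrier = {f. \<forall>m \<in> Poly_Mapping.keys f. Poly_Mapping.keys m \<subseteq> A},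
     monoid.mult = (*), one = 1, zero = 0, add = (+)\<rparr>"

definition sym_ideal :: "('k::comm_ring_1, 'w) module \<Rightarrow> ('k, 'w) mpol set" where
  "sym_ideal W = genideal (poly_ring (carrier W))
     ({mvar (u \<oplus>\<^bsub>W\<^esub> w) - mvar u - mvar w | u w. u \<in> carrier W \<and> w \<in> carrier W} \<union>
      {mvar (c \<odot>\<^bsub>W\<^esub> w) - mconst c * mvar w | c w. w \<in> carrier W})"

definition Sym :: "('k::comm_ring_1, 'w) module \<Rightarrow> ('k, 'w) symel ring" where
  "Sym W = poly_ring (carrier W) Quot sym_ideal W"

definition sym_incl :: "('k::comm_ring_1, 'w) module \<Rightarrow> 'w \<Rightarrow> ('k, 'w) symel" where
  "sym_incl W w = sym_ideal W +>\<^bsub>poly_ring (carrier W)\<^esub> mvar w"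

definition mon_degree :: "('w \<Rightarrow>\<^sub>0 nat) \<Rightarrow> nat" where
  "mon_degree m = (\<Sum>w\<in>Poly_Mapping.keys m. Poly_Mapping.lookup m w)"

definition sym_grade :: "('k::comm_ring_1, 'w) module \<Rightarrow> nat \<Rightarrow> ('k, 'w) symel set" where
  "sym_grade W n = {sym_ideal W +>\<^bsub>poly_ring (carrier W)\<^esub> f | f.
     f \<in> carrier (poly_ring (carrier W)) \<and> (\<forall>m \<in> Poly_Mapping.keys f. mon_degree m = n)}"

text \<open>Substitution \<open>X\<^sub>w \<mapsto> X\<^bsub>h w\<^esub>\<close>.\<close>

definition mrename :: "('w \<Rightarrow> 'w) \<Rightarrow> ('k::comm_ring_1, 'w) mpol \<Rightarrow> ('k, 'w) mpol" where
  "mrename h f = (\<Sum>m\<in>Poly_Mapping.keys f. Poly_Mapping.single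
     (\<Sum>w\<in>Poly_Mapping.keys m. Poly_Mapping.single (h w) (Poly_Mapping.lookup m w))
     (Poly_Mapping.lookup f m))"

text \<open>
  The algebra automorphism of \<open>Sym W\<close> induced by a linear automorphism \<open>h\<close> of \<open>W\<close>; the
  substitution then permutes the cosets of \<open>sym_ideal W\<close>, so the plain image is again a coset.
\<close>

definition sym_map :: "('w \<Rightarrow> 'w) \<Rightarrow> ('k::comm_ring_1, 'w) symel \<Rightarrow> ('k, 'w) symel" where
  "sym_map h C = mrename h ` C"

section \<open>Rings of invariants\<close>

definition GL :: "('k::field \<Rightarrow> 'v::ab_group_add \<Rightarrow> 'v) \<Rightarrow> ('v \<Rightarrow> 'v) monoid" where
  "GL scale = \<lparr>carrier = {g. Vector_Spaces.linear scale scale g \<and> bij g}, monoid.mult = (\<circ>), one = id\<rparr>"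

definition dual :: "('k::field \<Rightarrow> 'v::ab_group_add \<Rightarrow> 'v) \<Rightarrow> ('k, 'v \<Rightarrow> 'k) module" where
  "dual scale = \<lparr>carrier = {\<phi>. Vector_Spaces.linear scale (*) \<phi>}, monoid.mult = undefined, one = undefined,
     zero = (\<lambda>_. 0), add = (\<lambda>\<phi> \<psi> v. \<phi> v + \<psi> v), smult = (\<lambda>c \<phi> v. c * \<phi> v)\<rparr>"

definition dual_act :: "('v \<Rightarrow> 'v) \<Rightarrow> ('v \<Rightarrow> 'k) \<Rightarrow> ('v \<Rightarrow> 'k)" where
  "dual_act g \<phi> = \<phi> \<circ> inv_into UNIV g"

definition invariant_ring ::
  "('k::field \<Rightarrow> 'v::ab_group_add \<Rightarrow> 'v) \<Rightarrow> ('v \<Rightarrow> 'v) set \<Rightarrow> ('k, 'v \<Rightarrow> 'k) symel ring" where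
  "invariant_ring scale G = (Sym (dual scale))
     \<lparr>carrier := {C \<in> carrier (Sym (dual scale)). \<forall>g\<in>G. sym_map (dual_act g) C = C}\<rparr>"

definition invariant_grade ::
  "('k::field \<Rightarrow> 'v::ab_group_add \<Rightarrow> 'v) \<Rightarrow> ('v \<Rightarrow> 'v) set \<Rightarrow> nat \<Rightarrow> ('k, 'v \<Rightarrow> 'k) symel set" where
  "invariant_grade scale G n = carrier (invariant_ring scale G) \<inter> sym_grade (dual scale) n"

text \<open>For a ring \<open>S\<close> with grading \<open>Sn\<close>: the ideal \<open>\<Oplus>\<^sub>n\<^sub>\<ge>\<^sub>1 Sn n\<close>.\<close>

definition irrelevant :: "('r, 'n) ring_scheme \<Rightarrow> (nat \<Rightarrow> 'r set) \<Rightarrow> 'r set" where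
  "irrelevant S Sn = {\<Oplus>\<^bsub>S\<^esub>n\<in>N. h n | N h. finite N \<and> N \<subseteq> {1..} \<and> (\<forall>n\<in>N. h n \<in> Sn n)}"

text \<open>
  Homogeneous elements \<open>x 1, \<dots>, x d\<close> of positive degree generating an ideal that is primary to
  the irrelevant maximal ideal.  In a system of parameters \<open>d\<close> is the Krull dimension of \<open>S\<close>.
\<close>

definition homogeneous_sop ::
  "('r, 'n) ring_scheme \<Rightarrow> (nat \<Rightarrow> 'r set) \<Rightarrow> nat \<Rightarrow> (nat \<Rightarrow> 'r) \<Rightarrow> bool" where
  "homogeneous_sop S Sn d x \<longleftrightarrow> (\<forall>i\<in>{1..d}. \<exists>n\<ge>1. x i \<in> Sn n) \<and>
     radical S (genideal S (x ` {1..d})) = irrelevant S Sn"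

definition top_dickson ::
  "('k::field \<Rightarrow> 'v::ab_group_add \<Rightarrow> 'v) \<Rightarrow> ('k, 'v \<Rightarrow> 'k) symel" where
  "top_dickson scale = (\<Otimes>\<^bsub>Sym (dual scale)\<^esub>\<phi>\<in>carrier (dual scale) - {\<zero>\<^bsub>dual scale\<^esub>}.
     sym_incl (dual scale) \<phi>)"

end

theory Submission
  imports Defs "HOL-Algebra.Subrings"
begin

text \<open>
  Let \<open>S\<close> be the ring of invariants, \<open>J = (x\<^sub>1, \<dots>, x\<^sub>t\<^sub>-\<^sub>1)\<close>, and let \<open>e\<^sub>j\<close> be the given power of the top
  Dickson class, which kills \<open>H\<^sup>j\<close>. Suppose that \<open>a x\<^sub>t = b\<^sub>1 x\<^sub>1 + \<dots> + b\<^sub>t\<^sub>-\<^sub>1 x\<^sub>t\<^sub>-\<^sub>1\<close>. For a fixed exponent \<open>s\<close> let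
  \<open>y\<close> be the sequence \<open>x\<^sub>1, \<dots>, x\<^sub>t, x\<^sub>t\<^sub>+\<^sub>1\<^sup>s, \<dots>, x\<^sub>d\<^sup>s\<close>. Then \<open>(- b\<^sub>1, \<dots>, - b\<^sub>t\<^sub>-\<^sub>1, a, 0, \<dots>, 0)\<close> is a cycle of
  degree one of the Koszul complex \<open>K(y)\<close>. If \<open>q = e\<^sub>0 \<cdots> e\<^sub>d\<^sub>-\<^sub>1\<close> makes it a boundary, then its entry at \<open>t\<close>
  shows that \<open>q a\<close> lies in \<open>J + (x\<^sub>t\<^sub>+\<^sub>1\<^sup>s, \<dots>, x\<^sub>d\<^sup>s)\<close> (\<open>colon_mult_approximation\<close>). As \<open>s\<close> is arbitrary and the
  \<open>x\<^sub>k\<close> have positive degree, comparing homogeneous components gives \<open>q a \<in> J\<close>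
  (\<open>mem_ideal_of_power_approximation\<close>).
  
  That \<open>q\<close> makes the cycle \<open>z\<close> a boundary is a chase in the double complex \<open>K\<^sub>i(y) \<otimes> C\<^sup>j\<close>, where \<open>C\<close> is the
  Cech complex of a sequence whose ideal has the same radical as \<open>(y)\<close>. For \<open>j \<ge> 1\<close> the module \<open>C\<^sup>j\<close> is a product of
  localisations on each of which some element of the ideal \<open>(y)\<close> is invertible, so \<open>K(y) \<otimes> C\<^sup>j\<close> is exact
  (\<open>koszul_exact\<close>, \<open>cech_koszul_acyclic\<close>). Starting from \<open>z\<^sub>0 = z\<close> this yields \<open>z\<^sub>j \<in> K\<^sub>j\<^sub>+\<^sub>1 \<otimes> C\<^sup>j\<close> with
  \<open>\<delta> z\<^sub>j = \<partial> z\<^sub>j\<^sub>+\<^sub>1\<close>, until \<open>K\<^sub>d\<^sub>+\<^sub>1 = 0\<close> makes \<open>z\<^sub>d\<^sub>-\<^sub>1\<close> a cocycle. On the way back each \<open>e\<^sub>j\<close> turns a cocycle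
  of \<open>C\<^sup>j\<close> into a coboundary, which corrects \<open>z\<^sub>j\<^sub>-\<^sub>1\<close> to a cocycle modulo boundaries; after the factor
  \<open>e\<^sub>0\<close> the multiple \<open>q z\<close> itself is a boundary (\<open>double_complex_descent\<close>,
  \<open>product_kills_koszul_homology\<close>).
  
  The argument applies to every graded commutative ring. The ring of invariants is one because the relations of the symmetric algebra are homogeneous and linear substitutions preserve degrees
  (\<open>invariant_ring_graded\<close>).
\<close>

section \<open>Signed sums in abelian groups\<close>

definition signed :: "('m, 'n) ring_scheme \<Rightarrow> nat \<Rightarrow> 'm \<Rightarrow> 'm" where
  "signed M n v = (if even n then v else \<ominus>\<^bsub>M\<^esub> v)"

text \<open>
  The sign of the summand that adds or removes \<open>k\<close>, both in the Koszul and in the Cech differential, is the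
  parity of the number of elements of \<open>B\<close> below \<open>k\<close>. The parity lemmas below are the reason why these
  differentials square to zero and why the mixed terms in the Koszul homotopy formula cancel.
\<close>

definition num_below :: "nat set \<Rightarrow> nat \<Rightarrow> nat" where
  "num_below B k = card {l \<in> B. l < k}"

lemma num_below_insert:
  assumes "finite B" "l \<notin> B"
  shows "num_below (insert l B) k = num_below B k + (if l < k then 1 else 0)"
proof -
  have "{m \<in> insert l B. m < k} = (if l < k then insert l {m \<in> B. m < k} else {m \<in> B. m < k})"
    by auto
  then show ?thesis using assms by (simp add: num_below_def)
qed

lemma num_below_remove:
  assumes "finite B" "l \<in> B"
  shows "num_below B k = num_below (B - {l}) k + (if l < k then 1 else 0)"
  using num_below_insert[of "B - {l}" l k] assms by (simp add: insert_absorb)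

lemma num_below_insert_insert_parity:
  assumes "finite B" "k \<notin> B" "l \<notin> B" "k \<noteq> l"
  shows "odd ((num_below B k + num_below (insert k B) l) + (num_below B l + num_below (insert l B) k))"
  using assms by (auto simp: num_below_insert)

lemma num_below_remove_remove_parity:
  assumes "finite B" "k \<in> B" "l \<in> B" "k \<noteq> l"
  shows "odd ((num_below B k + num_below (B - {k}) l) + (num_below B l + num_below (B - {l}) k))"
  using num_below_remove[of B k l] num_below_remove[of B l k] assms by auto

lemma num_below_insert_remove_parity:
  assumes "finite B" "k \<notin> B" "l \<in> B"
  shows "odd ((num_below B k + num_below (insert k B) l) + (num_below B l + num_below (B - {l}) k))"
proof -
  have "k \<noteq> l" using assms by auto
  moreover have "num_below (insert k B) l = num_below B l + (if k < l then 1 else 0)"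
    using assms by (intro num_below_insert)
  moreover have "num_below B k = num_below (B - {l}) k + (if l < k then 1 else 0)"
    using assms by (intro num_below_remove)
  ultimately have "(num_below B k + num_below (insert k B) l) + (num_below B l + num_below (B - {l}) k)
      = 2 * num_below (B - {l}) k + 2 * num_below B l + 1"
    by (auto split: if_splits)
  then show ?thesis by presburger
qed

context abelian_group
begin

lemma signed_closed [simp, intro]: "v \<in> carrier G \<Longrightarrow> signed G n v \<in> carrier G"
  by (simp add: signed_def)

lemma signed_zero [simp]: "signed G n \<zero> = \<zero>"
  by (simp add: signed_def)

lemma signed_0 [simp]: "signed G 0 v = v"
  by (simp add: signed_def)

lemma signed_add:
  "\<lbrakk>v \<in> carrier G; w \<in> carrier G\<rbrakk> \<Longrightarrow> signed G n (v \<oplus> w) = signed G n v \<oplus> signed G n w"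
  by (simp add: signed_def minus_add)

lemma signed_signed:
  "v \<in> carrier G \<Longrightarrow> signed G n (signed G m v) = signed G (n + m) v"
  by (simp add: signed_def)

lemma signed_cancel:
  assumes "v \<in> carrier G" "odd (n + m)" shows "signed G n v \<oplus> signed G m v = \<zero>"
  using assms by (auto simp: signed_def r_neg l_neg)

lemma signed_finsum:
  assumes "finite A" "f \<in> A \<rightarrow> carrier G"
  shows "signed G n (finsum G f A) = finsum G (\<lambda>i. signed G n (f i)) A"
  using assms by (induction A rule: finite_induct) (simp_all add: signed_add Pi_def)

lemma finsum_swap:
  assumes "finite A" "finite B" "\<And>i k. i \<in> A \<Longrightarrow> k \<in> B \<Longrightarrow> F i k \<in> carrier G"
  shows "(\<Oplus>i\<in>A. \<Oplus>k\<in>B. F i k) = (\<Oplus>k\<in>B. \<Oplus>i\<in>A. F i k)"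
  using assms(1,3)
proof (induction A rule: finite_induct)
  case empty
  then show ?case using assms(2) by (simp add: finsum_zero)
next
  case (insert a A)
  have "(\<Oplus>k\<in>B. \<Oplus>i\<in>insert a A. F i k) = (\<Oplus>k\<in>B. F a k \<oplus> (\<Oplus>i\<in>A. F i k))"
    using insert by (intro finsum_cong') (auto simp: Pi_def)
  also have "\<dots> = (\<Oplus>k\<in>B. F a k) \<oplus> (\<Oplus>k\<in>B. \<Oplus>i\<in>A. F i k)"
    using insert by (intro finsum_addf) (auto simp: Pi_def)
  finally show ?case using insert by (simp add: Pi_def)
qed

lemma finsum_remove:
  assumes "finite A" "a \<in> A" "f \<in> A \<rightarrow> carrier G"
  shows "finsum G f A = f a \<oplus> finsum G f (A - {a})"
proof -
  have "finsum G f (insert a (A - {a})) = f a \<oplus> finsum G f (A - {a})"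
    using assms by (intro finsum_insert) auto
  then show ?thesis using assms(2) by (simp add: insert_absorb)
qed

text \<open>
  The common core of the identities \<open>\<partial>\<partial> = 0\<close>: adding or removing two indices in both orders gives
  opposite terms. Cancelling the two orders against each other avoids a division by two.
\<close>

lemma finsum_skew_zero:
  assumes "finite A"
    and "\<And>i k. i \<in> A \<Longrightarrow> k \<in> A \<Longrightarrow> i \<noteq> k \<Longrightarrow> F i k \<in> carrier G"
    and "\<And>i k. i \<in> A \<Longrightarrow> k \<in> A \<Longrightarrow> i \<noteq> k \<Longrightarrow> F i k \<oplus> F k i = \<zero>"
  shows "(\<Oplus>i\<in>A. \<Oplus>k\<in>A - {i}. F i k) = \<zero>"
  using assms
proof (induction A rule: finite_induct)
  case empty
  then show ?case by simp
next
  case (insert a A)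
  have cl: "(\<Oplus>i\<in>A. F i a) \<in> carrier G"
    using insert.prems(1) insert.hyps(2) by (intro finsum_closed) auto
  have "(\<Oplus>i\<in>A. \<Oplus>k\<in>insert a A - {i}. F i k) = (\<Oplus>i\<in>A. F i a \<oplus> (\<Oplus>k\<in>A - {i}. F i k))"
  proof (intro finsum_cong')
    show "(\<lambda>i. F i a \<oplus> (\<Oplus>k\<in>A - {i}. F i k)) \<in> A \<rightarrow> carrier G"
      using insert by (auto intro!: add.m_closed finsum_closed)
    fix i assume i: "i \<in> A"
    then have "insert a A - {i} = insert a (A - {i})" using insert by auto
    then show "(\<Oplus>k\<in>insert a A - {i}. F i k) = F i a \<oplus> (\<Oplus>k\<in>A - {i}. F i k)"
      using insert i by (simp, intro finsum_insert) auto
  qed simp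
  also have "\<dots> = (\<Oplus>i\<in>A. F i a) \<oplus> (\<Oplus>i\<in>A. \<Oplus>k\<in>A - {i}. F i k)"
    using insert by (intro finsum_addf) (auto intro!: finsum_closed)
  also have "(\<Oplus>i\<in>A. \<Oplus>k\<in>A - {i}. F i k) = \<zero>"
    using insert by (intro insert.IH) auto
  finally have 1: "(\<Oplus>i\<in>A. \<Oplus>k\<in>insert a A - {i}. F i k) = (\<Oplus>i\<in>A. F i a)"
    by (simp only: r_zero[OF cl])
  have "(\<Oplus>i\<in>insert a A. \<Oplus>k\<in>insert a A - {i}. F i k)
      = (\<Oplus>k\<in>insert a A - {a}. F a k) \<oplus> (\<Oplus>i\<in>A. \<Oplus>k\<in>insert a A - {i}. F i k)"
    using insert by (intro finsum_insert) (auto intro!: finsum_closed)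
  also have "insert a A - {a} = A" using insert by auto
  also have "(\<Oplus>k\<in>A. F a k) \<oplus> (\<Oplus>i\<in>A. \<Oplus>k\<in>insert a A - {i}. F i k) = (\<Oplus>i\<in>A. F a i \<oplus> F i a)"
    unfolding 1 using insert by (intro finsum_addf[symmetric]) auto
  also have "\<dots> = \<zero>"
    using insert by (intro add.finprod_one_eqI) auto
  finally show ?case .
qed

end

section \<open>Linear maps\<close>

definition linear_maps ::
  "('r, 'n) ring_scheme \<Rightarrow> ('r, 'm, 'k) module_scheme \<Rightarrow> ('r, 'p, 'l) module_scheme \<Rightarrow> ('m \<Rightarrow> 'p) set"
  where "linear_maps R M N = {h \<in> carrier M \<rightarrow> carrier N.
    (\<forall>v\<in>carrier M. \<forall>w\<in>carrier M. h (v \<oplus>\<^bsub>M\<^esub> w) = h v \<oplus>\<^bsub>N\<^esub> h w) \<and>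
    (\<forall>r\<in>carrier R. \<forall>v\<in>carrier M. h (r \<odot>\<^bsub>M\<^esub> v) = r \<odot>\<^bsub>N\<^esub> h v)}"

locale linear_map = dom: module R M + cod: module R N
  for R :: "('r, 'n) ring_scheme" and M :: "('r, 'm, 'k) module_scheme"
    and N :: "('r, 'p, 'l) module_scheme" +
  fixes h :: "'m \<Rightarrow> 'p"
  assumes linear: "h \<in> linear_maps R M N"
begin

lemma map_closed [simp, intro]: "v \<in> carrier M \<Longrightarrow> h v \<in> carrier N"
  using linear by (auto simp: linear_maps_def)

lemma map_add: "\<lbrakk>v \<in> carrier M; w \<in> carrier M\<rbrakk> \<Longrightarrow> h (v \<oplus>\<^bsub>M\<^esub> w) = h v \<oplus>\<^bsub>N\<^esub> h w"
  using linear by (auto simp: linear_maps_def)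

lemma map_smult: "\<lbrakk>r \<in> carrier R; v \<in> carrier M\<rbrakk> \<Longrightarrow> h (r \<odot>\<^bsub>M\<^esub> v) = r \<odot>\<^bsub>N\<^esub> h v"
  using linear by (auto simp: linear_maps_def)

lemma map_zero [simp]: "h \<zero>\<^bsub>M\<^esub> = \<zero>\<^bsub>N\<^esub>"
proof -
  have "h \<zero>\<^bsub>M\<^esub> \<oplus>\<^bsub>N\<^esub> h \<zero>\<^bsub>M\<^esub> = h \<zero>\<^bsub>M\<^esub>"
    using map_add[of "\<zero>\<^bsub>M\<^esub>" "\<zero>\<^bsub>M\<^esub>"] by simp
  then show ?thesis by (simp add: cod.add.l_cancel_one)
qed

lemma map_minus: "v \<in> carrier M \<Longrightarrow> h (\<ominus>\<^bsub>M\<^esub> v) = \<ominus>\<^bsub>N\<^esub> h v"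
  by (metis cod.M.minus_equality dom.M.a_inv_closed dom.M.l_neg map_add map_closed map_zero)

lemma map_finsum:
  "\<lbrakk>finite A; f \<in> A \<rightarrow> carrier M\<rbrakk> \<Longrightarrow> h (finsum M f A) = finsum N (\<lambda>i. h (f i)) A"
  by (induction A rule: finite_induct) (simp_all add: map_add Pi_def)

lemma map_signed: "v \<in> carrier M \<Longrightarrow> h (signed M n v) = signed N n (h v)"
  by (simp add: signed_def map_minus)

end

context module
begin

lemma smult_signed:
  "\<lbrakk>r \<in> carrier R; v \<in> carrier M\<rbrakk> \<Longrightarrow> r \<odot>\<^bsub>M\<^esub> signed M n v = signed M n (r \<odot>\<^bsub>M\<^esub> v)"
  by (simp add: signed_def smult_r_minus)

lemma smult_finsum_left:
  "\<lbrakk>finite A; f \<in> A \<rightarrow> carrier R; v \<in> carrier M\<rbrakk> \<Longrightarrow>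
    (finsum R f A) \<odot>\<^bsub>M\<^esub> v = (\<Oplus>\<^bsub>M\<^esub>i\<in>A. f i \<odot>\<^bsub>M\<^esub> v)"
  by (induction A rule: finite_induct) (simp_all add: smult_l_distr Pi_def)

lemma smult_commute:
  "\<lbrakk>a \<in> carrier R; b \<in> carrier R; v \<in> carrier M\<rbrakk> \<Longrightarrow> a \<odot>\<^bsub>M\<^esub> (b \<odot>\<^bsub>M\<^esub> v) = b \<odot>\<^bsub>M\<^esub> (a \<odot>\<^bsub>M\<^esub> v)"
  by (metis R.m_comm smult_assoc1)

end

section \<open>The Koszul complex\<close>

text \<open>
  For a family \<open>y\<close> indexed by a finite set \<open>T\<close>, a chain of degree \<open>i\<close> of the Koszul complex with
  coefficients in \<open>M\<close> is represented by its coefficients at the subsets of \<open>T\<close> with \<open>i\<close> elements.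
\<close>

definition subsets_of_card :: "nat set \<Rightarrow> nat \<Rightarrow> nat set set" where
  "subsets_of_card T i = {B. B \<subseteq> T \<and> card B = i}"

definition koszul_diff ::
  "('r, 'm, 'k) module_scheme \<Rightarrow> nat set \<Rightarrow> (nat \<Rightarrow> 'r) \<Rightarrow> (nat set \<Rightarrow> 'm) \<Rightarrow> nat set \<Rightarrow> 'm" where
  "koszul_diff M T y z B =
     (\<Oplus>\<^bsub>M\<^esub>k\<in>T - B. signed M (num_below B k) (y k \<odot>\<^bsub>M\<^esub> z (insert k B)))"

lemma insert_subsets_of_card:
  assumes "B \<in> subsets_of_card T i" "finite T" "k \<in> T - B"
  shows "insert k B \<in> subsets_of_card T (Suc i)"
  using assms by (auto simp: subsets_of_card_def card_insert_if finite_subset)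

lemma remove_subsets_of_card:
  assumes "B \<in> subsets_of_card T (Suc i)" "finite T" "k \<in> B"
  shows "B - {k} \<in> subsets_of_card T i"
  using assms by (auto simp: subsets_of_card_def finite_subset)

locale koszul = module R M
  for R :: "('r, 'n) ring_scheme" and M :: "('r, 'm, 'k) module_scheme" +
  fixes T :: "nat set" and y :: "nat \<Rightarrow> 'r"
  assumes finite_T: "finite T" and y: "y \<in> T \<rightarrow> carrier R"
begin

lemma koszul_diff_terms:
  assumes "B \<in> subsets_of_card T i" "z \<in> subsets_of_card T (Suc i) \<rightarrow> carrier M" "k \<in> T - B"
  shows "y k \<odot>\<^bsub>M\<^esub> z (insert k B) \<in> carrier M"
  using assms y insert_subsets_of_card[OF assms(1) finite_T assms(3)] by (auto simp: Pi_def)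

lemma koszul_diff_closed:
  assumes "B \<in> subsets_of_card T i" "z \<in> subsets_of_card T (Suc i) \<rightarrow> carrier M"
  shows "koszul_diff M T y z B \<in> carrier M"
  unfolding koszul_diff_def using koszul_diff_terms[OF assms] by (intro M.finsum_closed) auto

lemma koszul_diff_cong:
  assumes "B \<in> subsets_of_card T i" "z \<in> subsets_of_card T (Suc i) \<rightarrow> carrier M"
    and "\<And>C. C \<in> subsets_of_card T (Suc i) \<Longrightarrow> z C = z' C"
  shows "koszul_diff M T y z B = koszul_diff M T y z' B"
  unfolding koszul_diff_def
  using koszul_diff_terms[OF assms(1,2)] assms(3)[OF insert_subsets_of_card[OF assms(1) finite_T]]
  by (intro M.finsum_cong') auto

lemma koszul_diff_add:
  assumes "B \<in> subsets_of_card T i" "z \<in> subsets_of_card T (Suc i) \<rightarrow> carrier M"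
    "z' \<in> subsets_of_card T (Suc i) \<rightarrow> carrier M"
  shows "koszul_diff M T y (\<lambda>C. z C \<oplus>\<^bsub>M\<^esub> z' C) B
    = koszul_diff M T y z B \<oplus>\<^bsub>M\<^esub> koszul_diff M T y z' B"
proof -
  have "koszul_diff M T y (\<lambda>C. z C \<oplus>\<^bsub>M\<^esub> z' C) B
    = (\<Oplus>\<^bsub>M\<^esub>k\<in>T - B. signed M (num_below B k) (y k \<odot>\<^bsub>M\<^esub> z (insert k B))
        \<oplus>\<^bsub>M\<^esub> signed M (num_below B k) (y k \<odot>\<^bsub>M\<^esub> z' (insert k B)))"
    unfolding koszul_diff_def
  proof (intro M.finsum_cong')
    fix k assume k: "k \<in> T - B"
    show "signed M (num_below B k) (y k \<odot>\<^bsub>M\<^esub> (z (insert k B) \<oplus>\<^bsub>M\<^esub> z' (insert k B))) =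
        signed M (num_below B k) (y k \<odot>\<^bsub>M\<^esub> z (insert k B)) \<oplus>\<^bsub>M\<^esub> signed M (num_below B k) (y k \<odot>\<^bsub>M\<^esub> z' (insert k B))"
      using k y assms insert_subsets_of_card[OF assms(1) finite_T k] 
      by (subst smult_r_distr) (auto simp: Pi_def M.signed_add)
  qed (use koszul_diff_terms[OF assms(1,2)] koszul_diff_terms[OF assms(1,3)] in auto)
  also have "\<dots> = koszul_diff M T y z B \<oplus>\<^bsub>M\<^esub> koszul_diff M T y z' B"
    unfolding koszul_diff_def using koszul_diff_terms[OF assms(1,2)] koszul_diff_terms[OF assms(1,3)]
    by (intro M.finsum_addf) auto
  finally show ?thesis .
qed

lemma koszul_diff_koszul_diff:
  assumes "B \<in> subsets_of_card T i" "z \<in> subsets_of_card T (Suc (Suc i)) \<rightarrow> carrier M"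
  shows "koszul_diff M T y (koszul_diff M T y z) B = \<zero>\<^bsub>M\<^esub>"
proof -
  have B: "finite B" "B \<subseteq> T" using assms(1) finite_T by (auto simp: subsets_of_card_def finite_subset)
  define F where "F k l = signed M (num_below B k + num_below (insert k B) l)
    (y k \<odot>\<^bsub>M\<^esub> (y l \<odot>\<^bsub>M\<^esub> z (insert l (insert k B))))" for k l
  have z: "z (insert l (insert k B)) \<in> carrier M" if "k \<in> T - B" "l \<in> T - B" "k \<noteq> l" for k l
  proof -
    have "insert l (insert k B) \<in> subsets_of_card T (Suc (Suc i))"
      using insert_subsets_of_card assms(1) finite_T that by (metis DiffD1 DiffD2 DiffI insert_iff)
    then show ?thesis using assms(2) by (auto simp: Pi_def)
  qed
  have yk: "y k \<in> carrier R" if "k \<in> T" for k using y that by auto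
  have "koszul_diff M T y (koszul_diff M T y z) B = (\<Oplus>\<^bsub>M\<^esub>k\<in>T - B. \<Oplus>\<^bsub>M\<^esub>l\<in>(T - B) - {k}. F k l)"
    unfolding koszul_diff_def[of M T y _ B]
  proof (intro M.finsum_cong')
    fix k assume k: "k \<in> T - B"
    have eq: "T - insert k B = (T - B) - {k}" by auto
    have z': "z (insert l (insert k B)) \<in> carrier M" if "l \<in> T" "l \<notin> B" "l \<noteq> k" for l
      using z[OF k, of l] that by auto
    have "signed M (num_below B k) (y k \<odot>\<^bsub>M\<^esub> koszul_diff M T y z (insert k B))
        = (\<Oplus>\<^bsub>M\<^esub>l\<in>(T - B) - {k}. signed M (num_below B k) (y k \<odot>\<^bsub>M\<^esub>
            signed M (num_below (insert k B) l) (y l \<odot>\<^bsub>M\<^esub> z (insert l (insert k B)))))"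
      unfolding koszul_diff_def eq
      using k finite_T z' yk
      by (subst finsum_smult_ldistr M.signed_finsum; simp add: Pi_def)+
    also have "\<dots> = (\<Oplus>\<^bsub>M\<^esub>l\<in>(T - B) - {k}. F k l)"
      using k z' yk by (intro M.finsum_cong') (auto simp: F_def smult_signed M.signed_signed)
    finally show "signed M (num_below B k) (y k \<odot>\<^bsub>M\<^esub> koszul_diff M T y z (insert k B))
        = (\<Oplus>\<^bsub>M\<^esub>l\<in>(T - B) - {k}. F k l)" .
  qed (use z yk in \<open>auto simp: F_def intro!: M.finsum_closed M.signed_closed smult_closed\<close>)
  also have "\<dots> = \<zero>\<^bsub>M\<^esub>"
  proof (intro M.finsum_skew_zero)
    fix k l assume kl: "k \<in> T - B" "l \<in> T - B" "k \<noteq> l"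
    then show "F k l \<in> carrier M" using z yk by (auto simp: F_def)
    have "F l k = signed M (num_below B l + num_below (insert l B) k)
        (y k \<odot>\<^bsub>M\<^esub> (y l \<odot>\<^bsub>M\<^esub> z (insert l (insert k B))))"
      unfolding F_def using kl z yk by (simp add: insert_commute[of k l] smult_commute)
    then show "F k l \<oplus>\<^bsub>M\<^esub> F l k = \<zero>\<^bsub>M\<^esub>"
      unfolding F_def using kl z yk B num_below_insert_insert_parity[of B k l]
      by (simp, intro M.signed_cancel) auto
  qed (use finite_T in auto)
  finally show ?thesis .
qed

text \<open>
  The Koszul complex is functorial in the coefficients; this makes the double complex commute and lets
  exactness on a product be checked factor by factor.
\<close>

lemma koszul_diff_linear:
  assumes "linear_map R M N h" "B \<in> subsets_of_card T i" "z \<in> subsets_of_card T (Suc i) \<rightarrow> carrier M"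
  shows "h (koszul_diff M T y z B) = koszul_diff N T y (\<lambda>C. h (z C)) B"
proof -
  interpret linear_map R M N h by fact
  have z: "z (insert k B) \<in> carrier M" if "k \<in> T - B" for k
    using insert_subsets_of_card[OF assms(2) finite_T that] assms(3) by auto
  have "h (koszul_diff M T y z B)
      = (\<Oplus>\<^bsub>N\<^esub>k\<in>T - B. h (signed M (num_below B k) (y k \<odot>\<^bsub>M\<^esub> z (insert k B))))"
    unfolding koszul_diff_def using finite_T z y by (intro map_finsum) auto
  also have "\<dots> = koszul_diff N T y (\<lambda>C. h (z C)) B"
    unfolding koszul_diff_def
  proof (intro cod.M.finsum_cong')
    fix k assume k: "k \<in> T - B"
    with y have "y k \<in> carrier R" by auto
    then show "h (signed M (num_below B k) (y k \<odot>\<^bsub>M\<^esub> z (insert k B)))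
        = signed N (num_below B k) (y k \<odot>\<^bsub>N\<^esub> h (z (insert k B)))"
      using z[OF k] by (simp add: map_signed map_smult)
  qed (use z y in \<open>auto simp: Pi_def\<close>)
  finally show ?thesis .
qed

lemma koszul_diff_smult:
  assumes "r \<in> carrier R" "B \<in> subsets_of_card T i" "z \<in> subsets_of_card T (Suc i) \<rightarrow> carrier M"
  shows "koszul_diff M T y (\<lambda>C. r \<odot>\<^bsub>M\<^esub> z C) B = r \<odot>\<^bsub>M\<^esub> koszul_diff M T y z B"
proof -
  have "linear_map R M M (\<lambda>v. r \<odot>\<^bsub>M\<^esub> v)"
    using assms(1) module_axioms
    by (auto simp: linear_map_def linear_map_axioms_def linear_maps_def smult_r_distr smult_commute)
  from koszul_diff_linear[OF this assms(2,3)] show ?thesis by simp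
qed

text \<open>
  In terms of the exterior algebra, the Koszul differential is the contraction with \<open>y\<close> and this map is the
  exterior multiplication by \<open>\<Sum> g k e\<^sub>k\<close>, which raises the degree by one.
\<close>

definition exterior_mult :: "(nat \<Rightarrow> 'r) \<Rightarrow> (nat set \<Rightarrow> 'm) \<Rightarrow> nat set \<Rightarrow> 'm" where
  "exterior_mult g z B = (\<Oplus>\<^bsub>M\<^esub>l\<in>B. signed M (num_below B l) (g l \<odot>\<^bsub>M\<^esub> z (B - {l})))"

lemma exterior_mult_closed:
  assumes "g \<in> T \<rightarrow> carrier R" "B \<in> subsets_of_card T (Suc i)" "z \<in> subsets_of_card T i \<rightarrow> carrier M"
  shows "exterior_mult g z B \<in> carrier M"
proof -
  have "B \<subseteq> T" using assms(2) by (auto simp: subsets_of_card_def)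
  then show ?thesis
    unfolding exterior_mult_def using remove_subsets_of_card[OF assms(2) finite_T] assms(1,3)
    by (intro M.finsum_closed) (auto intro!: M.signed_closed smult_closed)
qed

text \<open>
  The identity \<open>\<partial> h + h \<partial> = \<Sum> g k y k\<close> for the exterior multiplication \<open>h\<close>, evaluated at a cycle. The terms of
  \<open>\<partial> (h z)\<close> that put back the index just removed give the part of the scalar with \<open>k \<notin> B\<close>. The mixed
  terms are, up to sign, those of \<open>h (\<partial> z) = 0\<close>, whose diagonal supplies the part with \<open>k \<in> B\<close>.
\<close>

lemma koszul_homotopy:
  assumes g: "g \<in> T \<rightarrow> carrier R" and B: "B \<in> subsets_of_card T i"
    and z: "z \<in> subsets_of_card T i \<rightarrow> carrier M"
    and cycle: "\<And>C. Suc (card C) = i \<Longrightarrow> C \<subseteq> T \<Longrightarrow> koszul_diff M T y z C = \<zero>\<^bsub>M\<^esub>"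
  shows "koszul_diff M T y (exterior_mult g z) B
    = (\<Oplus>\<^bsub>R\<^esub>k\<in>T. g k \<otimes>\<^bsub>R\<^esub> y k) \<odot>\<^bsub>M\<^esub> z B"
proof -
  have finB: "finite B" "B \<subseteq> T" "finite (T - B)"
    using B finite_T by (auto simp: subsets_of_card_def finite_subset)
  have zB: "z B \<in> carrier M" using z B by auto
  have gy: "g k \<in> carrier R" "y k \<in> carrier R" if "k \<in> T" for k using g y that by auto
  have zkl: "z (insert k (B - {l})) \<in> carrier M" if "k \<in> T - B" "l \<in> B" for k l
  proof -
    have "card B = Suc (card (B - {l}))" using that finB by (intro card.remove)
    then have "card (insert k (B - {l})) = i" using that finB B by (simp add: subsets_of_card_def)
    then have "insert k (B - {l}) \<in> subsets_of_card T i"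
      using that finB by (auto simp: subsets_of_card_def)
    then show ?thesis using z by auto
  qed
  define D where "D k = (g k \<otimes>\<^bsub>R\<^esub> y k) \<odot>\<^bsub>M\<^esub> z B" for k
  define P where "P k l = y k \<odot>\<^bsub>M\<^esub> (g l \<odot>\<^bsub>M\<^esub> z (insert k (B - {l})))" for k l
  have D: "D k \<in> carrier M" if "k \<in> T" for k using that gy zB by (simp add: D_def)
  have P: "P k l \<in> carrier M" if "k \<in> T - B" "l \<in> B" for k l
    using that gy zkl finB by (auto simp: P_def)
  define U where "U k l = signed M (num_below B k + num_below (insert k B) l) (P k l)" for k l
  define W where "W k l = signed M (num_below B l + num_below (B - {l}) k) (P k l)" for k l
  have UW: "U k l \<in> carrier M" "W k l \<in> carrier M" if "k \<in> T - B" "l \<in> B" for k l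
    using P[OF that] by (auto simp: U_def W_def)
  \<comment> \<open>\<open>W\<close> collects the off-diagonal terms of \<open>exterior_mult g (\<partial> z) B\<close>, which vanishes as \<open>z\<close> is a cycle.\<close>
  have W: "D l \<oplus>\<^bsub>M\<^esub> (\<Oplus>\<^bsub>M\<^esub>k\<in>T - B. W k l) = \<zero>\<^bsub>M\<^esub>" if l: "l \<in> B" for l
  proof -
    have lT: "l \<in> T" using l finB by auto
    have eq: "T - (B - {l}) = insert l (T - B)" using l finB by auto
    have ins: "insert l (B - {l}) = B" using l by auto
    have rl: "num_below (B - {l}) l = num_below B l" using num_below_remove[OF finB(1) l, of l] by simp
    have "Suc (card (B - {l})) = i"
      using card.remove[OF finB(1) l] B by (simp add: subsets_of_card_def)
    then have "signed M (num_below B l) (g l \<odot>\<^bsub>M\<^esub> koszul_diff M T y z (B - {l})) = \<zero>\<^bsub>M\<^esub>"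
      using cycle[of "B - {l}"] finB gy lT by (simp add: subset_insertI2 Diff_subset[THEN subset_trans])
    moreover have "koszul_diff M T y z (B - {l}) = signed M (num_below B l) (y l \<odot>\<^bsub>M\<^esub> z B) \<oplus>\<^bsub>M\<^esub>
        (\<Oplus>\<^bsub>M\<^esub>k\<in>T - B. signed M (num_below (B - {l}) k) (y k \<odot>\<^bsub>M\<^esub> z (insert k (B - {l}))))"
      unfolding koszul_diff_def eq using finB l lT gy zB zkl
      by (subst M.finsum_insert) (auto simp: insert_absorb rl)
    moreover have "signed M (num_below B l) (g l \<odot>\<^bsub>M\<^esub> (signed M (num_below B l) (y l \<odot>\<^bsub>M\<^esub> z B))) = D l"
      using lT gy zB by (simp add: smult_signed M.signed_signed D_def smult_assoc1) (simp add: signed_def)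
    moreover have "signed M (num_below B l) (g l \<odot>\<^bsub>M\<^esub>
        (\<Oplus>\<^bsub>M\<^esub>k\<in>T - B. signed M (num_below (B - {l}) k) (y k \<odot>\<^bsub>M\<^esub> z (insert k (B - {l})))))
        = (\<Oplus>\<^bsub>M\<^esub>k\<in>T - B. W k l)"
    proof -
      have "signed M (num_below B l) (g l \<odot>\<^bsub>M\<^esub>
          (\<Oplus>\<^bsub>M\<^esub>k\<in>T - B. signed M (num_below (B - {l}) k) (y k \<odot>\<^bsub>M\<^esub> z (insert k (B - {l})))))
        = (\<Oplus>\<^bsub>M\<^esub>k\<in>T - B. signed M (num_below B l) (g l \<odot>\<^bsub>M\<^esub>
            signed M (num_below (B - {l}) k) (y k \<odot>\<^bsub>M\<^esub> z (insert k (B - {l})))))"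
        using finB l lT gy zkl
        by (subst finsum_smult_ldistr M.signed_finsum; simp add: Pi_def)+
      also have "\<dots> = (\<Oplus>\<^bsub>M\<^esub>k\<in>T - B. W k l)"
        using l lT gy zkl
        by (intro M.finsum_cong')
          (auto simp: W_def P_def smult_signed M.signed_signed smult_commute[of "g l"])
      finally show ?thesis .
    qed
    moreover have "(\<Oplus>\<^bsub>M\<^esub>k\<in>T - B. signed M (num_below (B - {l}) k) (y k \<odot>\<^bsub>M\<^esub> z (insert k (B - {l}))))
        \<in> carrier M"
      using l gy zkl by (intro M.finsum_closed) auto
    ultimately show ?thesis
      using lT gy zB by (simp add: smult_r_distr M.signed_add)
  qed
  have UW0: "U k l \<oplus>\<^bsub>M\<^esub> W k l = \<zero>\<^bsub>M\<^esub>" if "k \<in> T - B" "l \<in> B" for k l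
    unfolding U_def W_def using P[OF that] that finB num_below_insert_remove_parity[of B k l]
    by (intro M.signed_cancel) auto
  have con: "exterior_mult g z (insert k B)
      = signed M (num_below B k) (g k \<odot>\<^bsub>M\<^esub> z B) \<oplus>\<^bsub>M\<^esub>
        (\<Oplus>\<^bsub>M\<^esub>l\<in>B. signed M (num_below (insert k B) l) (g l \<odot>\<^bsub>M\<^esub> z (insert k (B - {l}))))"
    if k: "k \<in> T - B" for k
  proof -
    have kB: "k \<in> T" "k \<notin> B" using k by auto
    have eq: "insert k B - {l} = insert k (B - {l})" if "l \<in> B" for l using that kB by auto
    have "exterior_mult g z (insert k B) = signed M (num_below (insert k B) k) (g k \<odot>\<^bsub>M\<^esub> z (insert k B - {k})) \<oplus>\<^bsub>M\<^esub>
        (\<Oplus>\<^bsub>M\<^esub>l\<in>B. signed M (num_below (insert k B) l) (g l \<odot>\<^bsub>M\<^esub> z (insert k B - {l})))"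
      unfolding exterior_mult_def
      using kB finB gy zB zkl[OF k] by (intro M.finsum_insert) (auto simp: eq)
    moreover have "(\<Oplus>\<^bsub>M\<^esub>l\<in>B. signed M (num_below (insert k B) l) (g l \<odot>\<^bsub>M\<^esub> z (insert k B - {l})))
       = (\<Oplus>\<^bsub>M\<^esub>l\<in>B. signed M (num_below (insert k B) l) (g l \<odot>\<^bsub>M\<^esub> z (insert k (B - {l}))))"
      using finB gy zkl[OF k] by (intro M.finsum_cong') (auto simp: eq)
    moreover have "num_below (insert k B) k = num_below B k" "insert k B - {k} = B"
      using num_below_insert[OF finB(1) kB(2), of k] kB by auto
    ultimately show ?thesis by simp
  qed
  have "koszul_diff M T y (exterior_mult g z) B = (\<Oplus>\<^bsub>M\<^esub>k\<in>T - B. D k \<oplus>\<^bsub>M\<^esub> (\<Oplus>\<^bsub>M\<^esub>l\<in>B. U k l))"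
    unfolding koszul_diff_def
  proof (intro M.finsum_cong')
    show "(\<lambda>k. D k \<oplus>\<^bsub>M\<^esub> (\<Oplus>\<^bsub>M\<^esub>l\<in>B. U k l)) \<in> T - B \<rightarrow> carrier M"
      using D UW by (auto intro!: M.add.m_closed M.finsum_closed)
    fix k assume k: "k \<in> T - B"
    then have kT: "k \<in> T" by auto
    have "signed M (num_below B k) (y k \<odot>\<^bsub>M\<^esub> signed M (num_below B k) (g k \<odot>\<^bsub>M\<^esub> z B)) = D k"
      using kT gy zB
      by (simp add: smult_signed M.signed_signed D_def smult_assoc1 smult_commute[of "y k"]) (simp add: signed_def)
    moreover have "signed M (num_below B k) (y k \<odot>\<^bsub>M\<^esub>
        (\<Oplus>\<^bsub>M\<^esub>l\<in>B. signed M (num_below (insert k B) l) (g l \<odot>\<^bsub>M\<^esub> z (insert k (B - {l})))))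
        = (\<Oplus>\<^bsub>M\<^esub>l\<in>B. U k l)"
    proof -
      have gB: "g l \<in> carrier R" if "l \<in> B" for l using gy that finB by auto
      have "signed M (num_below B k) (y k \<odot>\<^bsub>M\<^esub>
          (\<Oplus>\<^bsub>M\<^esub>l\<in>B. signed M (num_below (insert k B) l) (g l \<odot>\<^bsub>M\<^esub> z (insert k (B - {l})))))
        = (\<Oplus>\<^bsub>M\<^esub>l\<in>B. signed M (num_below B k) (y k \<odot>\<^bsub>M\<^esub>
            signed M (num_below (insert k B) l) (g l \<odot>\<^bsub>M\<^esub> z (insert k (B - {l})))))"
        using finB kT gy gB zkl[OF k]
        by (subst finsum_smult_ldistr M.signed_finsum; simp add: Pi_def)+
      also have "\<dots> = (\<Oplus>\<^bsub>M\<^esub>l\<in>B. U k l)"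
        using kT gy gB zkl[OF k]
        by (intro M.finsum_cong') (auto simp: U_def P_def smult_signed M.signed_signed)
      finally show ?thesis .
    qed
    moreover have "(\<Oplus>\<^bsub>M\<^esub>l\<in>B. signed M (num_below (insert k B) l) (g l \<odot>\<^bsub>M\<^esub> z (insert k (B - {l})))) \<in> carrier M"
      using gy finB zkl[OF k] by (intro M.finsum_closed) auto
    ultimately show "signed M (num_below B k) (y k \<odot>\<^bsub>M\<^esub> exterior_mult g z (insert k B))
        = D k \<oplus>\<^bsub>M\<^esub> (\<Oplus>\<^bsub>M\<^esub>l\<in>B. U k l)"
      unfolding con[OF k] using kT gy zB by (simp add: smult_r_distr M.signed_add)
  qed simp
  also have "\<dots> = (\<Oplus>\<^bsub>M\<^esub>k\<in>T - B. D k) \<oplus>\<^bsub>M\<^esub> (\<Oplus>\<^bsub>M\<^esub>k\<in>T - B. \<Oplus>\<^bsub>M\<^esub>l\<in>B. U k l)"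
    using D UW by (intro M.finsum_addf) (auto intro!: M.finsum_closed)
  also have "(\<Oplus>\<^bsub>M\<^esub>k\<in>T - B. \<Oplus>\<^bsub>M\<^esub>l\<in>B. U k l) = (\<Oplus>\<^bsub>M\<^esub>l\<in>B. \<Oplus>\<^bsub>M\<^esub>k\<in>T - B. U k l)"
    using finB UW by (intro M.finsum_swap) auto
  also have "\<dots> = (\<Oplus>\<^bsub>M\<^esub>l\<in>B. D l)"
  proof (intro M.finsum_cong')
    show "D \<in> B \<rightarrow> carrier M" using D finB by auto
    fix l assume l: "l \<in> B"
    have cl: "(\<Oplus>\<^bsub>M\<^esub>k\<in>T - B. U k l) \<in> carrier M" "(\<Oplus>\<^bsub>M\<^esub>k\<in>T - B. W k l) \<in> carrier M" "D l \<in> carrier M"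
      using UW l D finB by (auto intro!: M.finsum_closed)
    have "(\<Oplus>\<^bsub>M\<^esub>k\<in>T - B. U k l) \<oplus>\<^bsub>M\<^esub> (\<Oplus>\<^bsub>M\<^esub>k\<in>T - B. W k l) = (\<Oplus>\<^bsub>M\<^esub>k\<in>T - B. U k l \<oplus>\<^bsub>M\<^esub> W k l)"
      using UW l by (intro M.finsum_addf[symmetric]) auto
    also have "\<dots> = \<zero>\<^bsub>M\<^esub>" using UW0 l by (intro M.add.finprod_one_eqI) auto
    finally show "(\<Oplus>\<^bsub>M\<^esub>k\<in>T - B. U k l) = D l"
      using W[OF l] cl by (metis M.add.inv_equality M.a_comm)
  qed simp
  also have "(\<Oplus>\<^bsub>M\<^esub>k\<in>T - B. D k) \<oplus>\<^bsub>M\<^esub> (\<Oplus>\<^bsub>M\<^esub>l\<in>B. D l) = (\<Oplus>\<^bsub>M\<^esub>k\<in>(T - B) \<union> B. D k)"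
    using finB D by (intro M.finsum_Un_disjoint[symmetric]) auto
  also have "(T - B) \<union> B = T" using finB by auto
  also have "(\<Oplus>\<^bsub>M\<^esub>k\<in>T. D k) = (\<Oplus>\<^bsub>R\<^esub>k\<in>T. g k \<otimes>\<^bsub>R\<^esub> y k) \<odot>\<^bsub>M\<^esub> z B"
    unfolding D_def using finite_T gy zB by (subst smult_finsum_left) auto
  finally show ?thesis .
qed

text \<open>
  By the homotopy formula, multiplication by \<open>u\<close> is null-homotopic. If it is bijective on \<open>M\<close>, a cycle
  \<open>z\<close> can first be divided by \<open>u\<close>, and the quotient is again a cycle, so \<open>z\<close> is the boundary of the
  exterior multiple of \<open>z / u\<close>.
\<close>

lemma koszul_exact:
  assumes g: "g \<in> T \<rightarrow> carrier R"
    and u: "u = (\<Oplus>\<^bsub>R\<^esub>k\<in>T. g k \<otimes>\<^bsub>R\<^esub> y k)"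
    and bij: "bij_betw (\<lambda>v. u \<odot>\<^bsub>M\<^esub> v) (carrier M) (carrier M)"
    and z: "z \<in> subsets_of_card T i \<rightarrow> carrier M"
    and cycle: "\<And>C. Suc (card C) = i \<Longrightarrow> C \<subseteq> T \<Longrightarrow> koszul_diff M T y z C = \<zero>\<^bsub>M\<^esub>"
  obtains w where "w \<in> subsets_of_card T (Suc i) \<rightarrow> carrier M"
    and "\<And>B. B \<in> subsets_of_card T i \<Longrightarrow> koszul_diff M T y w B = z B"
proof -
  have uR: "u \<in> carrier R" unfolding u using g y by (intro R.finsum_closed) auto
  define z' where "z' B = (SOME v. v \<in> carrier M \<and> u \<odot>\<^bsub>M\<^esub> v = z B)" for B
  have z': "z' B \<in> carrier M \<and> u \<odot>\<^bsub>M\<^esub> z' B = z B" if "B \<in> subsets_of_card T i" for B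
  proof -
    have "\<exists>v. v \<in> carrier M \<and> u \<odot>\<^bsub>M\<^esub> v = z B"
      using bij z that unfolding bij_betw_def by (metis Pi_mem imageE)
    then show ?thesis unfolding z'_def by (rule someI_ex)
  qed
  then have z'_closed: "z' \<in> subsets_of_card T i \<rightarrow> carrier M" by auto
  have "koszul_diff M T y z' C = \<zero>\<^bsub>M\<^esub>" if C: "Suc (card C) = i" "C \<subseteq> T" for C
  proof -
    have Ci: "C \<in> subsets_of_card T (card C)" using C by (auto simp: subsets_of_card_def)
    have cl: "z' \<in> subsets_of_card T (Suc (card C)) \<rightarrow> carrier M" using z'_closed C by simp
    have "u \<odot>\<^bsub>M\<^esub> koszul_diff M T y z' C = koszul_diff M T y (\<lambda>B. u \<odot>\<^bsub>M\<^esub> z' B) C"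
      using koszul_diff_smult[OF uR Ci cl] by simp
    also have "\<dots> = koszul_diff M T y z C"
      using Ci cl z' C uR by (intro koszul_diff_cong[OF Ci]) auto
    also have "\<dots> = u \<odot>\<^bsub>M\<^esub> \<zero>\<^bsub>M\<^esub>" using cycle[OF C] uR by simp
    finally show ?thesis
      using bij koszul_diff_closed[OF Ci cl] by (auto simp: bij_betw_def dest: inj_onD)
  qed
  then have "koszul_diff M T y (exterior_mult g z') B = z B" if "B \<in> subsets_of_card T i" for B
    using koszul_homotopy[OF g that z'_closed] z'[OF that] u by simp
  moreover have "exterior_mult g z' \<in> subsets_of_card T (Suc i) \<rightarrow> carrier M"
    using exterior_mult_closed[OF g _ z'_closed] by auto
  ultimately show thesis using that by blast
qed

end

section \<open>The double complex of a cochain complex and a Koszul complex\<close>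

locale cochain_complex =
  fixes R :: "('r, 'n) ring_scheme" (structure)
    and C :: "nat \<Rightarrow> ('r, 'm, 'k) module_scheme"
    and \<delta> :: "nat \<Rightarrow> 'm \<Rightarrow> 'm"
  assumes modules: "\<And>j. module R (C j)"
    and linear: "\<And>j. \<delta> j \<in> linear_maps R (C j) (C (Suc j))"
    and square: "\<And>j v. v \<in> carrier (C j) \<Longrightarrow> \<delta> (Suc j) (\<delta> j v) = \<zero>\<^bsub>C (Suc (Suc j))\<^esub>"
begin

lemma differential: "linear_map R (C j) (C (Suc j)) (\<delta> j)"
  using modules linear by (simp add: linear_map_def linear_map_axioms_def)

definition coboundaries :: "nat \<Rightarrow> 'm set" where
  "coboundaries j = (case j of 0 \<Rightarrow> {\<zero>\<^bsub>C 0\<^esub>} | Suc i \<Rightarrow> \<delta> i ` carrier (C i))"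

definition kills_cohomology :: "nat \<Rightarrow> 'r \<Rightarrow> bool" where
  "kills_cohomology j e \<longleftrightarrow> e \<in> carrier R \<and>
     (\<forall>c\<in>carrier (C j). \<delta> j c = \<zero>\<^bsub>C (Suc j)\<^esub> \<longrightarrow> e \<odot>\<^bsub>C j\<^esub> c \<in> coboundaries j)"

text \<open>
  Exactness in every degree of the Koszul complex with coefficients in the \<open>j\<close>-th term.
\<close>

definition koszul_acyclic :: "nat set \<Rightarrow> (nat \<Rightarrow> 'r) \<Rightarrow> nat \<Rightarrow> bool" where
  "koszul_acyclic T y j \<longleftrightarrow> (\<forall>i z. z \<in> subsets_of_card T i \<rightarrow> carrier (C j) \<longrightarrow>
     (\<forall>B. Suc (card B) = i \<longrightarrow> B \<subseteq> T \<longrightarrow> koszul_diff (C j) T y z B = \<zero>\<^bsub>C j\<^esub>) \<longrightarrow>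
     (\<exists>w. w \<in> subsets_of_card T (Suc i) \<rightarrow> carrier (C j) \<and>
        (\<forall>B\<in>subsets_of_card T i. koszul_diff (C j) T y w B = z B)))"

text \<open>
  The zigzag through the double complex with terms \<open>K\<^sub>i \<otimes> C\<^sup>j\<close>. Since \<open>\<delta> z\<close> is a Koszul
  cycle with coefficients in \<open>C\<^sup>j\<^sup>+\<^sup>1\<close>, it lifts to some \<open>z'\<close> with \<open>\<partial> z' = \<delta> z\<close>. By induction
  \<open>E' z' - \<partial> w'\<close> is a cocycle, so \<open>e (j + 1)\<close> makes it a coboundary \<open>\<delta> v\<close>. Applying \<open>\<partial>\<close> and using
  \<open>\<partial>\<partial> = 0\<close> gives \<open>\<delta> (e (j + 1) E' z) = \<delta> (\<partial> v)\<close>. The lifting ends at \<open>j = d\<close>, where the chains of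
  degree \<open>d + 2\<close> vanish.
\<close>

lemma double_complex_descent:
  assumes T: "finite T" "card T = Suc d" and y: "y \<in> T \<rightarrow> carrier R"
    and e: "\<And>j. j \<le> d \<Longrightarrow> kills_cohomology j (e j)"
    and acyclic: "\<And>j. koszul_acyclic T y (Suc j)"
    and "j \<le> d"
    and "z \<in> subsets_of_card T (Suc j) \<rightarrow> carrier (C j)"
    and "\<And>B. B \<in> subsets_of_card T j \<Longrightarrow> \<delta> j (koszul_diff (C j) T y z B) = \<zero>\<^bsub>C (Suc j)\<^esub>"
  shows "\<exists>w. w \<in> subsets_of_card T (Suc (Suc j)) \<rightarrow> carrier (C j) \<and>
    (\<forall>B\<in>subsets_of_card T (Suc j).
       \<delta> j ((\<Otimes>l\<in>{Suc j..<Suc d}. e l) \<odot>\<^bsub>C j\<^esub> z B) = \<delta> j (koszul_diff (C j) T y w B))"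
  using assms(6-)
proof (induction j arbitrary: z rule: inc_induct)
  have K: "koszul R (C j) T y" for j
    using modules T y by (simp add: koszul_def koszul_axioms_def)
  \<comment> \<open>Pushing a cochain one step along the complex and lifting it along the Koszul differential.\<close>
  have lift: "\<exists>z'. z' \<in> subsets_of_card T (Suc (Suc j)) \<rightarrow> carrier (C (Suc j)) \<and>
      (\<forall>B\<in>subsets_of_card T (Suc j). koszul_diff (C (Suc j)) T y z' B = \<delta> j (z B))"
    if z: "z \<in> subsets_of_card T (Suc j) \<rightarrow> carrier (C j)"
      and cyc: "\<And>B. B \<in> subsets_of_card T j \<Longrightarrow> \<delta> j (koszul_diff (C j) T y z B) = \<zero>\<^bsub>C (Suc j)\<^esub>"
    for j z
  proof -
    interpret koszul R "C j" T y by (rule K)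
    interpret dj: linear_map R "C j" "C (Suc j)" "\<delta> j" by (rule differential)
    have "koszul_diff (C (Suc j)) T y (\<lambda>B. \<delta> j (z B)) B = \<zero>\<^bsub>C (Suc j)\<^esub>"
      if "Suc (card B) = Suc j" "B \<subseteq> T" for B
      using koszul_diff_linear[OF differential _ z, of B] cyc[of B] that
      by (auto simp: subsets_of_card_def)
    moreover have "(\<lambda>B. \<delta> j (z B)) \<in> subsets_of_card T (Suc j) \<rightarrow> carrier (C (Suc j))"
      using z by auto
    ultimately show ?thesis
      using acyclic[of j] unfolding koszul_acyclic_def by blast
  qed
  {
    case base
    interpret koszul R "C d" T y by (rule K)
    interpret dd: linear_map R "C d" "C (Suc d)" "\<delta> d" by (rule differential)
    obtain z' where z': "\<And>B. B \<in> subsets_of_card T (Suc d) \<Longrightarrow> koszul_diff (C (Suc d)) T y z' B = \<delta> d (z B)"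
      using lift[OF base(1) base(2)] by blast
    have "\<delta> d (z B) = \<zero>\<^bsub>C (Suc d)\<^esub>" if B: "B \<in> subsets_of_card T (Suc d)" for B
    proof -
      have "B = T" using B T by (auto simp: subsets_of_card_def card_subset_eq)
      then show ?thesis using z'[OF B] by (simp add: koszul_diff_def)
    qed
    moreover have "koszul_diff (C d) T y (\<lambda>_. \<zero>\<^bsub>C d\<^esub>) B = \<zero>\<^bsub>C d\<^esub>" for B
      unfolding koszul_diff_def using y by (intro M.add.finprod_one_eqI) (auto simp: Pi_def)
    moreover have "\<one> \<odot>\<^bsub>C d\<^esub> z B = z B" if "B \<in> subsets_of_card T (Suc d)" for B
      using base(1) that by (intro smult_one) auto
    ultimately show ?case using base(1)
      by (intro exI[of _ "\<lambda>_. \<zero>\<^bsub>C d\<^esub>"]) auto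
  next
    case (step j)
    interpret kj: koszul R "C j" T y by (rule K)
    interpret kj': koszul R "C (Suc j)" T y by (rule K)
    interpret dj: linear_map R "C j" "C (Suc j)" "\<delta> j" by (rule differential)
    interpret dj': linear_map R "C (Suc j)" "C (Suc (Suc j))" "\<delta> (Suc j)" by (rule differential)
    obtain z' where z': "z' \<in> subsets_of_card T (Suc (Suc j)) \<rightarrow> carrier (C (Suc j))"
      and dz': "\<And>B. B \<in> subsets_of_card T (Suc j) \<Longrightarrow> koszul_diff (C (Suc j)) T y z' B = \<delta> j (z B)"
      using lift[OF step.prems] by blast
    have "\<delta> (Suc j) (koszul_diff (C (Suc j)) T y z' B) = \<zero>\<^bsub>C (Suc (Suc j))\<^esub>"
      if "B \<in> subsets_of_card T (Suc j)" for B
      using dz'[OF that] square[of "z B" j] step.prems(1) that by auto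
    from step.IH[OF z' this] obtain w' where
      w': "w' \<in> subsets_of_card T (Suc (Suc (Suc j))) \<rightarrow> carrier (C (Suc j))" and
      dw': "\<And>B. B \<in> subsets_of_card T (Suc (Suc j)) \<Longrightarrow>
        \<delta> (Suc j) ((\<Otimes>l\<in>{Suc (Suc j)..<Suc d}. e l) \<odot>\<^bsub>C (Suc j)\<^esub> z' B)
          = \<delta> (Suc j) (koszul_diff (C (Suc j)) T y w' B)" by blast
    define E' where "E' = (\<Otimes>l\<in>{Suc (Suc j)..<Suc d}. e l)"
    have eR: "e l \<in> carrier R" if "l \<le> d" for l using e[OF that] by (simp add: kills_cohomology_def)
    have E'R: "E' \<in> carrier R" unfolding E'_def using eR by (intro kj.R.finprod_closed) auto
    have e1: "e (Suc j) \<in> carrier R" using eR step.hyps by auto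
    have E: "(\<Otimes>l\<in>{Suc j..<Suc d}. e l) = e (Suc j) \<otimes> E'"
    proof -
      have "{Suc j..<Suc d} = insert (Suc j) {Suc (Suc j)..<Suc d}" using step.hyps by auto
      then show ?thesis unfolding E'_def using eR e1 by (simp add: Pi_def)
    qed
    define v where "v B = (SOME u. u \<in> carrier (C j) \<and>
      e (Suc j) \<odot>\<^bsub>C (Suc j)\<^esub> (E' \<odot>\<^bsub>C (Suc j)\<^esub> z' B \<ominus>\<^bsub>C (Suc j)\<^esub> koszul_diff (C (Suc j)) T y w' B)
        = \<delta> j u)" for B
    have v: "v B \<in> carrier (C j) \<and>
      e (Suc j) \<odot>\<^bsub>C (Suc j)\<^esub> (E' \<odot>\<^bsub>C (Suc j)\<^esub> z' B \<ominus>\<^bsub>C (Suc j)\<^esub> koszul_diff (C (Suc j)) T y w' B)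
        = \<delta> j (v B)" if B: "B \<in> subsets_of_card T (Suc (Suc j))" for B
    proof -
      let ?c = "E' \<odot>\<^bsub>C (Suc j)\<^esub> z' B \<ominus>\<^bsub>C (Suc j)\<^esub> koszul_diff (C (Suc j)) T y w' B"
      have cl: "E' \<odot>\<^bsub>C (Suc j)\<^esub> z' B \<in> carrier (C (Suc j))"
        "koszul_diff (C (Suc j)) T y w' B \<in> carrier (C (Suc j))"
        using B z' E'R kj'.koszul_diff_closed[OF B w'] by auto
      have "\<delta> (Suc j) ?c = \<delta> (Suc j) (E' \<odot>\<^bsub>C (Suc j)\<^esub> z' B)
          \<ominus>\<^bsub>C (Suc (Suc j))\<^esub> \<delta> (Suc j) (koszul_diff (C (Suc j)) T y w' B)"
        using cl by (simp add: a_minus_def dj'.map_add dj'.map_minus)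
      also have "\<dots> = \<zero>\<^bsub>C (Suc (Suc j))\<^esub>"
        using dw'[OF B] cl by (simp add: E'_def dj'.cod.M.r_neg a_minus_def)
      finally have "e (Suc j) \<odot>\<^bsub>C (Suc j)\<^esub> ?c \<in> coboundaries (Suc j)"
        using e[of "Suc j"] step.hyps cl unfolding kills_cohomology_def by auto
      then have "\<exists>u. u \<in> carrier (C j) \<and> e (Suc j) \<odot>\<^bsub>C (Suc j)\<^esub> ?c = \<delta> j u"
        by (auto simp: coboundaries_def)
      then show ?thesis unfolding v_def by (rule someI_ex)
    qed
    then have v_cl: "v \<in> subsets_of_card T (Suc (Suc j)) \<rightarrow> carrier (C j)" by auto
    have "\<delta> j ((e (Suc j) \<otimes> E') \<odot>\<^bsub>C j\<^esub> z B) = \<delta> j (koszul_diff (C j) T y v B)"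
      if B: "B \<in> subsets_of_card T (Suc j)" for B
    proof -
      let ?w = "koszul_diff (C (Suc j)) T y w'"
      have w_cl: "?w \<in> subsets_of_card T (Suc (Suc j)) \<rightarrow> carrier (C (Suc j))"
        using kj'.koszul_diff_closed[OF _ w'] by auto
      have split: "(e (Suc j) \<otimes> E') \<odot>\<^bsub>C (Suc j)\<^esub> z' D
          = \<delta> j (v D) \<oplus>\<^bsub>C (Suc j)\<^esub> e (Suc j) \<odot>\<^bsub>C (Suc j)\<^esub> ?w D"
        if D: "D \<in> subsets_of_card T (Suc (Suc j))" for D
      proof -
        have cl: "E' \<odot>\<^bsub>C (Suc j)\<^esub> z' D \<in> carrier (C (Suc j))" "?w D \<in> carrier (C (Suc j))"
          using D z' E'R w_cl by auto
        have "E' \<odot>\<^bsub>C (Suc j)\<^esub> z' D = (E' \<odot>\<^bsub>C (Suc j)\<^esub> z' D \<ominus>\<^bsub>C (Suc j)\<^esub> ?w D) \<oplus>\<^bsub>C (Suc j)\<^esub> ?w D"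
          using cl by (simp add: a_minus_def kj'.M.a_assoc kj'.M.l_neg)
        then have "e (Suc j) \<odot>\<^bsub>C (Suc j)\<^esub> (E' \<odot>\<^bsub>C (Suc j)\<^esub> z' D)
            = e (Suc j) \<odot>\<^bsub>C (Suc j)\<^esub> ((E' \<odot>\<^bsub>C (Suc j)\<^esub> z' D \<ominus>\<^bsub>C (Suc j)\<^esub> ?w D) \<oplus>\<^bsub>C (Suc j)\<^esub> ?w D)"
          by (rule arg_cong)
        also have "\<dots> = \<delta> j (v D) \<oplus>\<^bsub>C (Suc j)\<^esub> e (Suc j) \<odot>\<^bsub>C (Suc j)\<^esub> ?w D"
          using v[OF D] cl e1 by (subst kj'.smult_r_distr) auto
        finally show ?thesis using D z' e1 E'R by (subst kj'.smult_assoc1) auto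
      qed
      have "\<delta> j ((e (Suc j) \<otimes> E') \<odot>\<^bsub>C j\<^esub> z B) = (e (Suc j) \<otimes> E') \<odot>\<^bsub>C (Suc j)\<^esub> \<delta> j (z B)"
        using B step.prems(1) e1 E'R by (intro dj.map_smult) auto
      also have "\<dots> = (e (Suc j) \<otimes> E') \<odot>\<^bsub>C (Suc j)\<^esub> koszul_diff (C (Suc j)) T y z' B"
        using dz'[OF B] by simp
      also have "\<dots> = koszul_diff (C (Suc j)) T y (\<lambda>D. (e (Suc j) \<otimes> E') \<odot>\<^bsub>C (Suc j)\<^esub> z' D) B"
        using kj'.koszul_diff_smult[OF _ B z'] e1 E'R by simp
      also have "\<dots> = koszul_diff (C (Suc j)) T y
          (\<lambda>D. \<delta> j (v D) \<oplus>\<^bsub>C (Suc j)\<^esub> e (Suc j) \<odot>\<^bsub>C (Suc j)\<^esub> ?w D) B"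
        using split z' e1 E'R by (intro kj'.koszul_diff_cong[OF B]) auto
      also have "\<dots> = koszul_diff (C (Suc j)) T y (\<lambda>D. \<delta> j (v D)) B \<oplus>\<^bsub>C (Suc j)\<^esub>
          koszul_diff (C (Suc j)) T y (\<lambda>D. e (Suc j) \<odot>\<^bsub>C (Suc j)\<^esub> ?w D) B"
        using v_cl w_cl e1 by (intro kj'.koszul_diff_add[OF B]) auto
      also have "koszul_diff (C (Suc j)) T y (\<lambda>D. e (Suc j) \<odot>\<^bsub>C (Suc j)\<^esub> ?w D) B = \<zero>\<^bsub>C (Suc j)\<^esub>"
        using kj'.koszul_diff_smult[OF e1 B w_cl] kj'.koszul_diff_koszul_diff[OF B w'] e1 by simp
      also have "koszul_diff (C (Suc j)) T y (\<lambda>D. \<delta> j (v D)) B = \<delta> j (koszul_diff (C j) T y v B)"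
        using kj.koszul_diff_linear[OF differential B v_cl] by simp
      finally show ?thesis using kj.koszul_diff_closed[OF B v_cl] by simp
    qed
    then show ?case unfolding E using v_cl by blast
  }
qed

text \<open>
  The last step of the zigzag: at position \<open>0\<close> the only coboundary is zero, so the factor \<open>e 0\<close> turns the
  congruence modulo cocycles provided by the descent into an equality.
\<close>

lemma product_kills_koszul_homology:
  assumes T: "finite T" "card T = Suc d" and y: "y \<in> T \<rightarrow> carrier R"
    and e: "\<And>j. j \<le> d \<Longrightarrow> kills_cohomology j (e j)"
    and acyclic: "\<And>j. koszul_acyclic T y (Suc j)"
    and z: "z \<in> subsets_of_card T 1 \<rightarrow> carrier (C 0)"
    and cycle: "koszul_diff (C 0) T y z {} = \<zero>\<^bsub>C 0\<^esub>"
  obtains w where "w \<in> subsets_of_card T 2 \<rightarrow> carrier (C 0)"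
    and "\<And>B. B \<in> subsets_of_card T 1 \<Longrightarrow>
      (\<Otimes>l\<in>{0..d}. e l) \<odot>\<^bsub>C 0\<^esub> z B = koszul_diff (C 0) T y w B"
proof -
  interpret koszul R "C 0" T y
    using modules T y by (simp add: koszul_def koszul_axioms_def)
  interpret d0: linear_map R "C 0" "C (Suc 0)" "\<delta> 0" by (rule differential)
  have "\<delta> 0 (koszul_diff (C 0) T y z B) = \<zero>\<^bsub>C (Suc 0)\<^esub>" if "B \<in> subsets_of_card T 0" for B
  proof -
    have "B = {}" using that T by (auto simp: subsets_of_card_def finite_subset)
    then show ?thesis using cycle by simp
  qed
  then obtain w where w: "w \<in> subsets_of_card T 2 \<rightarrow> carrier (C 0)"
    and dw: "\<And>B. B \<in> subsets_of_card T 1 \<Longrightarrow>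
       \<delta> 0 ((\<Otimes>l\<in>{1..<Suc d}. e l) \<odot>\<^bsub>C 0\<^esub> z B) = \<delta> 0 (koszul_diff (C 0) T y w B)"
    using double_complex_descent[OF T y e acyclic, of 0 z] z by (auto simp: numeral_2_eq_2)
  define E where "E = (\<Otimes>l\<in>{1..<Suc d}. e l)"
  have eR: "e l \<in> carrier R" if "l \<le> d" for l using e[OF that] by (simp add: kills_cohomology_def)
  have ER: "E \<in> carrier R" unfolding E_def using eR by (intro R.finprod_closed) auto
  have "{0..d} = insert 0 {1..<Suc d}" by auto
  then have E: "(\<Otimes>l\<in>{0..d}. e l) = e 0 \<otimes> E"
    unfolding E_def using eR by (simp add: Pi_def)
  have w': "w \<in> subsets_of_card T (Suc 1) \<rightarrow> carrier (C 0)" using w by (simp add: numeral_2_eq_2)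
  have "(e 0 \<otimes> E) \<odot>\<^bsub>C 0\<^esub> z B = koszul_diff (C 0) T y (\<lambda>D. e 0 \<odot>\<^bsub>C 0\<^esub> w D) B"
    if B: "B \<in> subsets_of_card T 1" for B
  proof -
    let ?w = "koszul_diff (C 0) T y w B"
    have cl: "E \<odot>\<^bsub>C 0\<^esub> z B \<in> carrier (C 0)" "?w \<in> carrier (C 0)" "z B \<in> carrier (C 0)"
      using B z ER koszul_diff_closed[OF B w'] by auto
    have "\<delta> 0 (E \<odot>\<^bsub>C 0\<^esub> z B \<ominus>\<^bsub>C 0\<^esub> ?w) = \<delta> 0 (E \<odot>\<^bsub>C 0\<^esub> z B) \<ominus>\<^bsub>C (Suc 0)\<^esub> \<delta> 0 ?w"
      using cl by (simp add: a_minus_def d0.map_add d0.map_minus)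
    also have "\<dots> = \<zero>\<^bsub>C (Suc 0)\<^esub>"
      using dw[OF B] cl by (simp add: E_def d0.cod.M.r_neg a_minus_def)
    finally have "e 0 \<odot>\<^bsub>C 0\<^esub> (E \<odot>\<^bsub>C 0\<^esub> z B \<ominus>\<^bsub>C 0\<^esub> ?w) \<in> coboundaries 0"
      using e[of 0] cl unfolding kills_cohomology_def by auto
    then have "e 0 \<odot>\<^bsub>C 0\<^esub> (E \<odot>\<^bsub>C 0\<^esub> z B) \<ominus>\<^bsub>C 0\<^esub> e 0 \<odot>\<^bsub>C 0\<^esub> ?w = \<zero>\<^bsub>C 0\<^esub>"
      using cl eR[of 0] by (simp add: coboundaries_def a_minus_def smult_r_distr smult_r_minus)
    then have "e 0 \<odot>\<^bsub>C 0\<^esub> (E \<odot>\<^bsub>C 0\<^esub> z B) = e 0 \<odot>\<^bsub>C 0\<^esub> ?w"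
      using cl eR[of 0] M.minus_equality[of "e 0 \<odot>\<^bsub>C 0\<^esub> (E \<odot>\<^bsub>C 0\<^esub> z B)" "\<ominus>\<^bsub>C 0\<^esub> (e 0 \<odot>\<^bsub>C 0\<^esub> ?w)"]
      by (simp add: a_minus_def)
    then show ?thesis
      using cl eR[of 0] ER koszul_diff_smult[OF _ B w', of "e 0"] by (simp add: smult_assoc1)
  qed
  moreover have "(\<lambda>D. e 0 \<odot>\<^bsub>C 0\<^esub> w D) \<in> subsets_of_card T 2 \<rightarrow> carrier (C 0)"
    using w eR[of 0] by auto
  ultimately show thesis using that E by metis
qed

end

section \<open>Localisation\<close>

text \<open>
  Fractions \<open>m / s\<close> over a multiplicatively closed set. Well-definedness and the module laws reduce to
  identities between representatives, because every class is of the form \<open>frac m s\<close>.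
\<close>

locale localized_module = module R M
  for R :: "('r, 'n) ring_scheme" (structure) and M :: "('r, 'm) module" (structure) +
  fixes U :: "'r set"
  assumes U_subset: "U \<subseteq> carrier R" and U_one: "\<one> \<in> U"
    and U_mult: "\<And>s t. s \<in> U \<Longrightarrow> t \<in> U \<Longrightarrow> s \<otimes> t \<in> U"
begin

abbreviation frac :: "'m \<Rightarrow> 'r \<Rightarrow> ('m \<times> 'r) set" where
  "frac \<equiv> mfrac R M U"

lemma U_carrier [simp, intro]: "s \<in> U \<Longrightarrow> s \<in> carrier R"
  using U_subset by auto

lemma frac_rel_iff:
  "((m, s), (m', s')) \<in> frac_rel R M U \<longleftrightarrow> m \<in> carrier M \<and> m' \<in> carrier M \<and> s \<in> U \<and> s' \<in> U \<and>
     (\<exists>u\<in>U. (u \<otimes> s') \<odot>\<^bsub>M\<^esub> m = (u \<otimes> s) \<odot>\<^bsub>M\<^esub> m')"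
  unfolding frac_rel_def by (auto simp: smult_assoc1)

lemma frac_rel_trans:
  assumes "((m, s), (m', s')) \<in> frac_rel R M U" "((m', s'), (m'', s'')) \<in> frac_rel R M U"
  shows "((m, s), (m'', s'')) \<in> frac_rel R M U"
proof -
  obtain u where u: "u \<in> U" "(u \<otimes> s') \<odot>\<^bsub>M\<^esub> m = (u \<otimes> s) \<odot>\<^bsub>M\<^esub> m'"
    using assms(1) by (auto simp: frac_rel_iff)
  obtain v where v: "v \<in> U" "(v \<otimes> s'') \<odot>\<^bsub>M\<^esub> m' = (v \<otimes> s') \<odot>\<^bsub>M\<^esub> m''"
    using assms(2) by (auto simp: frac_rel_iff)
  have m: "m \<in> carrier M" "m' \<in> carrier M" "m'' \<in> carrier M" and s: "s \<in> U" "s' \<in> U" "s'' \<in> U"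
    using assms by (auto simp: frac_rel_iff)
  note c = m s u(1) v(1)
  have "(u \<otimes> v \<otimes> s' \<otimes> s'') \<odot>\<^bsub>M\<^esub> m = (v \<otimes> s'') \<odot>\<^bsub>M\<^esub> ((u \<otimes> s') \<odot>\<^bsub>M\<^esub> m)"
    using c by (subst smult_assoc1[symmetric]) (auto simp: m_ac)
  also have "\<dots> = (u \<otimes> s) \<odot>\<^bsub>M\<^esub> ((v \<otimes> s'') \<odot>\<^bsub>M\<^esub> m')"
    unfolding u(2) using c by (intro smult_commute) auto
  also have "\<dots> = (u \<otimes> v \<otimes> s' \<otimes> s) \<odot>\<^bsub>M\<^esub> m''"
    unfolding v(2) using c by (subst smult_assoc1[symmetric]) (auto simp: m_ac)
  finally show ?thesis using c by (auto simp: frac_rel_iff intro!: U_mult bexI[of _ "u \<otimes> v \<otimes> s'"])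
qed

lemma frac_rel_equiv: "equiv (carrier M \<times> U) (frac_rel R M U)"
proof (intro equivI)
  show "frac_rel R M U \<subseteq> (carrier M \<times> U) \<times> carrier M \<times> U" by (auto simp: frac_rel_def)
  show "refl_on (carrier M \<times> U) (frac_rel R M U)"
    using U_one by (auto simp: refl_on_def frac_rel_iff)
  show "sym (frac_rel R M U)" unfolding sym_def by (auto simp: frac_rel_iff intro: sym)
  show "trans (frac_rel R M U)" unfolding trans_def using frac_rel_trans by auto
qed

lemma frac_eq_iff:
  assumes "m \<in> carrier M" "s \<in> U" "m' \<in> carrier M" "s' \<in> U"
  shows "frac m s = frac m' s' \<longleftrightarrow> (\<exists>u\<in>U. (u \<otimes> s') \<odot>\<^bsub>M\<^esub> m = (u \<otimes> s) \<odot>\<^bsub>M\<^esub> m')"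
  using eq_equiv_class_iff[OF frac_rel_equiv, of "(m, s)" "(m', s')"] assms
  by (simp add: mfrac_def frac_rel_iff)

lemma frac_eqI:
  assumes "m \<in> carrier M" "s \<in> U" "m' \<in> carrier M" "s' \<in> U" "s' \<odot>\<^bsub>M\<^esub> m = s \<odot>\<^bsub>M\<^esub> m'"
  shows "frac m s = frac m' s'"
  using assms U_one by (subst frac_eq_iff) (auto intro!: bexI[of _ \<one>])

lemma mem_frac:
  assumes "m \<in> carrier M" "s \<in> U" 
  shows "(m, s) \<in> frac m s"
  using assms U_one by (auto simp: mfrac_def frac_rel_iff)

lemma frac_mem:
  assumes "(m', s') \<in> frac m s"
  shows "m \<in> carrier M" "s \<in> U" "m' \<in> carrier M" "s' \<in> U" "frac m' s' = frac m s"
proof -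
  have r: "((m, s), (m', s')) \<in> frac_rel R M U" using assms by (simp add: mfrac_def)
  then show "m \<in> carrier M" "s \<in> U" "m' \<in> carrier M" "s' \<in> U" by (auto simp: frac_rel_iff)
  show "frac m' s' = frac m s"
    using equiv_class_eq[OF frac_rel_equiv r] by (simp add: mfrac_def)
qed

lemma UN_frac:
  assumes "m \<in> carrier M" "s \<in> U" "\<And>m' s'. m' \<in> carrier M \<Longrightarrow> s' \<in> U \<Longrightarrow> frac m' s' = frac m s \<Longrightarrow> F m' s' = F m s"
  shows "(\<Union>(m', s')\<in>frac m s. F m' s') = F m s"
proof -
  have "F m' s' = F m s" if "(m', s') \<in> frac m s" for m' s'
    by (rule assms(3)[OF frac_mem(3,4,5)[OF that]])
  then have "(\<Union>(m', s')\<in>frac m s. F m' s') = (\<Union>p\<in>frac m s. F m s)"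
    by (intro SUP_cong refl) auto
  also have "\<dots> = F m s" using mem_frac[OF assms(1,2)] by (subst UN_constant) auto
  finally show ?thesis .
qed

lemma carrier_localization:
  "carrier (localization R M U) = {frac m s | m s. m \<in> carrier M \<and> s \<in> U}"
  by (auto simp: localization_def quotient_def mfrac_def)

lemma frac_closed [simp, intro]:
  "m \<in> carrier M \<Longrightarrow> s \<in> U \<Longrightarrow> frac m s \<in> carrier (localization R M U)"
  by (auto simp: carrier_localization)

lemma zero_localization: "\<zero>\<^bsub>localization R M U\<^esub> = frac \<zero>\<^bsub>M\<^esub> \<one>"
  by (simp add: localization_def)

lemma frac_zero: "s \<in> U \<Longrightarrow> frac \<zero>\<^bsub>M\<^esub> s = \<zero>\<^bsub>localization R M U\<^esub>"
  unfolding zero_localization using U_one by (intro frac_eqI) auto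

lemma frac_smult:
  assumes "r \<in> carrier R" "m \<in> carrier M" "s \<in> U"
  shows "r \<odot>\<^bsub>localization R M U\<^esub> frac m s = frac (r \<odot>\<^bsub>M\<^esub> m) s"
proof -
  have "(\<Union>(m', s')\<in>frac m s. frac (r \<odot>\<^bsub>M\<^esub> m') s') = frac (r \<odot>\<^bsub>M\<^esub> m) s"
  proof (rule UN_frac)
    fix m' s' assume m': "m' \<in> carrier M" "s' \<in> U" and eq: "frac m' s' = frac m s"
    then obtain u where u: "u \<in> U" "(u \<otimes> s) \<odot>\<^bsub>M\<^esub> m' = (u \<otimes> s') \<odot>\<^bsub>M\<^esub> m"
      using frac_eq_iff[of m' s' m s] assms by auto
    have "(u \<otimes> s) \<odot>\<^bsub>M\<^esub> (r \<odot>\<^bsub>M\<^esub> m') = r \<odot>\<^bsub>M\<^esub> ((u \<otimes> s) \<odot>\<^bsub>M\<^esub> m')"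
      using u m' assms by (intro smult_commute) auto
    also have "\<dots> = (u \<otimes> s') \<odot>\<^bsub>M\<^esub> (r \<odot>\<^bsub>M\<^esub> m)"
      unfolding u(2) using u(1) m' assms by (intro smult_commute) auto
    finally show "frac (r \<odot>\<^bsub>M\<^esub> m') s' = frac (r \<odot>\<^bsub>M\<^esub> m) s"
      using u(1) m' assms by (subst frac_eq_iff) auto
  qed (use assms in auto)
  then show ?thesis by (simp add: localization_def)
qed

lemma frac_add_cong:
  assumes c: "m \<in> carrier M" "s \<in> U" "m' \<in> carrier M" "s' \<in> U"
    "n \<in> carrier M" "t \<in> U" "n' \<in> carrier M" "t' \<in> U"
    and eq: "frac m s = frac m' s'" "frac n t = frac n' t'"
  shows "frac ((t \<odot>\<^bsub>M\<^esub> m) \<oplus>\<^bsub>M\<^esub> (s \<odot>\<^bsub>M\<^esub> n)) (s \<otimes> t) = frac ((t' \<odot>\<^bsub>M\<^esub> m') \<oplus>\<^bsub>M\<^esub> (s' \<odot>\<^bsub>M\<^esub> n')) (s' \<otimes> t')"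
proof -
  obtain u where u: "u \<in> U" "(u \<otimes> s') \<odot>\<^bsub>M\<^esub> m = (u \<otimes> s) \<odot>\<^bsub>M\<^esub> m'"
    using eq(1) c frac_eq_iff by auto
  obtain v where v: "v \<in> U" "(v \<otimes> t') \<odot>\<^bsub>M\<^esub> n = (v \<otimes> t) \<odot>\<^bsub>M\<^esub> n'"
    using eq(2) c frac_eq_iff by auto
  note c' = c u(1) v(1)
  have "((u \<otimes> v) \<otimes> (s' \<otimes> t')) \<odot>\<^bsub>M\<^esub> ((t \<odot>\<^bsub>M\<^esub> m) \<oplus>\<^bsub>M\<^esub> (s \<odot>\<^bsub>M\<^esub> n)) =
      (v \<otimes> t' \<otimes> t) \<odot>\<^bsub>M\<^esub> ((u \<otimes> s') \<odot>\<^bsub>M\<^esub> m) \<oplus>\<^bsub>M\<^esub> (u \<otimes> s' \<otimes> s) \<odot>\<^bsub>M\<^esub> ((v \<otimes> t') \<odot>\<^bsub>M\<^esub> n)"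
    using c' by (simp add: smult_r_distr smult_assoc1[symmetric] m_ac)
  also have "\<dots> = ((u \<otimes> v) \<otimes> (s \<otimes> t)) \<odot>\<^bsub>M\<^esub> ((t' \<odot>\<^bsub>M\<^esub> m') \<oplus>\<^bsub>M\<^esub> (s' \<odot>\<^bsub>M\<^esub> n'))"
    unfolding u(2) v(2) using c' by (simp add: smult_r_distr smult_assoc1[symmetric] m_ac)
  finally show ?thesis
    using c' by (subst frac_eq_iff) (auto intro!: U_mult bexI[of _ "u \<otimes> v"])
qed

lemma frac_add:
  assumes "m \<in> carrier M" "s \<in> U" "n \<in> carrier M" "t \<in> U"
  shows "frac m s \<oplus>\<^bsub>localization R M U\<^esub> frac n t = frac ((t \<odot>\<^bsub>M\<^esub> m) \<oplus>\<^bsub>M\<^esub> (s \<odot>\<^bsub>M\<^esub> n)) (s \<otimes> t)"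
proof -
  have "(\<Union>(n', t')\<in>frac n t. frac ((t' \<odot>\<^bsub>M\<^esub> m') \<oplus>\<^bsub>M\<^esub> (s' \<odot>\<^bsub>M\<^esub> n')) (s' \<otimes> t'))
      = frac ((t \<odot>\<^bsub>M\<^esub> m') \<oplus>\<^bsub>M\<^esub> (s' \<odot>\<^bsub>M\<^esub> n)) (s' \<otimes> t)" if "m' \<in> carrier M" "s' \<in> U" for m' s'
    using assms that by (intro UN_frac frac_add_cong) auto
  moreover have "(\<Union>(m', s')\<in>frac m s. (\<Union>(n', t')\<in>frac n t.
        frac ((t' \<odot>\<^bsub>M\<^esub> m') \<oplus>\<^bsub>M\<^esub> (s' \<odot>\<^bsub>M\<^esub> n')) (s' \<otimes> t')))
      = (\<Union>(n', t')\<in>frac n t. frac ((t' \<odot>\<^bsub>M\<^esub> m) \<oplus>\<^bsub>M\<^esub> (s \<odot>\<^bsub>M\<^esub> n')) (s \<otimes> t'))"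
  proof (rule UN_frac)
    fix m' s' assume m': "m' \<in> carrier M" "s' \<in> U" and eq: "frac m' s' = frac m s"
    then show "(\<Union>(n', t')\<in>frac n t. frac ((t' \<odot>\<^bsub>M\<^esub> m') \<oplus>\<^bsub>M\<^esub> (s' \<odot>\<^bsub>M\<^esub> n')) (s' \<otimes> t'))
      = (\<Union>(n', t')\<in>frac n t. frac ((t' \<odot>\<^bsub>M\<^esub> m) \<oplus>\<^bsub>M\<^esub> (s \<odot>\<^bsub>M\<^esub> n')) (s \<otimes> t'))"
    proof (intro SUP_cong refl)
      fix p assume "p \<in> frac n t"
      then obtain n' t' where p: "p = (n', t')" "(n', t') \<in> frac n t" by (cases p) auto
      show "(case p of (n', t') \<Rightarrow> frac ((t' \<odot>\<^bsub>M\<^esub> m') \<oplus>\<^bsub>M\<^esub> (s' \<odot>\<^bsub>M\<^esub> n')) (s' \<otimes> t'))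
        = (case p of (n', t') \<Rightarrow> frac ((t' \<odot>\<^bsub>M\<^esub> m) \<oplus>\<^bsub>M\<^esub> (s \<odot>\<^bsub>M\<^esub> n')) (s \<otimes> t'))"
        using frac_mem(3,4)[OF p(2)] m' eq assms unfolding p(1) prod.case
        by (intro frac_add_cong) auto
    qed
  qed (use assms in auto)
  ultimately show ?thesis using assms by (simp add: localization_def)
qed

lemma localization_cases:
  assumes "X \<in> carrier (localization R M U)"
  obtains m s where "m \<in> carrier M" "s \<in> U" "X = frac m s"
  using assms by (auto simp: carrier_localization)

lemma localization_module: "module R (localization R M U)"
proof (intro moduleI abelian_groupI R.is_cring)
  let ?L = "localization R M U"
  fix X Y assume X: "X \<in> carrier ?L" and Y: "Y \<in> carrier ?L"
  then show "X \<oplus>\<^bsub>?L\<^esub> Y \<in> carrier ?L"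
    by (elim localization_cases) (auto simp: frac_add intro!: frac_closed U_mult)
  show "X \<oplus>\<^bsub>?L\<^esub> Y = Y \<oplus>\<^bsub>?L\<^esub> X"
    using X Y by (elim localization_cases) (auto simp: frac_add m_comm M.a_comm)
  show "\<exists>Z\<in>carrier ?L. Z \<oplus>\<^bsub>?L\<^esub> X = \<zero>\<^bsub>?L\<^esub>"
    using X
  proof (elim localization_cases)
    fix m s assume m: "m \<in> carrier M" "s \<in> U" "X = frac m s"
    have "frac (\<ominus>\<^bsub>M\<^esub> m) s \<oplus>\<^bsub>?L\<^esub> frac m s = \<zero>\<^bsub>?L\<^esub>"
      using m by (simp add: frac_add smult_r_minus M.l_neg frac_zero U_mult)
    then show ?thesis using m by (intro bexI[of _ "frac (\<ominus>\<^bsub>M\<^esub> m) s"]) auto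
  qed
  show "\<zero>\<^bsub>?L\<^esub> \<oplus>\<^bsub>?L\<^esub> X = X"
    using X by (elim localization_cases) (auto simp: zero_localization frac_add U_one)
next
  let ?L = "localization R M U"
  show "\<zero>\<^bsub>?L\<^esub> \<in> carrier ?L" by (auto simp: zero_localization U_one)
next
  let ?L = "localization R M U"
  fix X Y Z assume "X \<in> carrier ?L" "Y \<in> carrier ?L" "Z \<in> carrier ?L"
  then show "X \<oplus>\<^bsub>?L\<^esub> Y \<oplus>\<^bsub>?L\<^esub> Z = X \<oplus>\<^bsub>?L\<^esub> (Y \<oplus>\<^bsub>?L\<^esub> Z)"
  proof (elim localization_cases)
    fix l r m s n t assume c: "l \<in> carrier M" "r \<in> U" "m \<in> carrier M" "s \<in> U" "n \<in> carrier M" "t \<in> U"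
      and XYZ: "X = frac l r" "Y = frac m s" "Z = frac n t"
    show ?thesis
      using c unfolding XYZ
      by (simp add: frac_add U_mult smult_r_distr smult_assoc1[symmetric] m_ac M.a_ac)
  qed
next
  let ?L = "localization R M U"
  fix a X assume a: "a \<in> carrier R" and X: "X \<in> carrier ?L"
  then show "a \<odot>\<^bsub>?L\<^esub> X \<in> carrier ?L"
    by (elim localization_cases) (auto simp: frac_smult)
  fix Y assume Y: "Y \<in> carrier ?L"
  show "a \<odot>\<^bsub>?L\<^esub> (X \<oplus>\<^bsub>?L\<^esub> Y) = a \<odot>\<^bsub>?L\<^esub> X \<oplus>\<^bsub>?L\<^esub> a \<odot>\<^bsub>?L\<^esub> Y"
    using X Y
  proof (elim localization_cases)
    fix m s n t assume c: "m \<in> carrier M" "s \<in> U" "n \<in> carrier M" "t \<in> U"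
      and XY: "X = frac m s" "Y = frac n t"
    show ?thesis
      using c a unfolding XY
      by (simp add: frac_add frac_smult U_mult smult_r_distr smult_assoc1[symmetric] m_ac)
  qed
next
  let ?L = "localization R M U"
  fix a b X assume a: "a \<in> carrier R" "b \<in> carrier R" and X: "X \<in> carrier ?L"
  show "(a \<oplus> b) \<odot>\<^bsub>?L\<^esub> X = a \<odot>\<^bsub>?L\<^esub> X \<oplus>\<^bsub>?L\<^esub> b \<odot>\<^bsub>?L\<^esub> X"
    using X
  proof (elim localization_cases)
    fix m s assume c: "m \<in> carrier M" "s \<in> U" and XY: "X = frac m s"
    have "frac ((a \<oplus> b) \<odot>\<^bsub>M\<^esub> m) s = frac (s \<odot>\<^bsub>M\<^esub> (a \<odot>\<^bsub>M\<^esub> m) \<oplus>\<^bsub>M\<^esub> s \<odot>\<^bsub>M\<^esub> (b \<odot>\<^bsub>M\<^esub> m)) (s \<otimes> s)"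
      using c a
      by (intro frac_eqI) (auto simp: U_mult smult_l_distr smult_r_distr smult_assoc1[symmetric] m_ac)
    then show ?thesis
      using c a unfolding XY by (simp add: frac_add frac_smult)
  qed
  show "(a \<otimes> b) \<odot>\<^bsub>?L\<^esub> X = a \<odot>\<^bsub>?L\<^esub> (b \<odot>\<^bsub>?L\<^esub> X)"
    using X a by (elim localization_cases) (auto simp: frac_smult smult_assoc1)
next
  let ?L = "localization R M U"
  fix X assume "X \<in> carrier ?L"
  then show "\<one> \<odot>\<^bsub>?L\<^esub> X = X"
    by (elim localization_cases) (auto simp: frac_smult)
qed

text \<open>
  Denominators act invertibly; for \<open>f \<in> U\<close> the inverse sends \<open>m / s\<close> to \<open>m / (f s)\<close>. This is what makes
  the Koszul complex exact on the localised terms of the Cech complex.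
\<close>

lemma smult_denominator_bij:
  assumes f: "f \<in> U"
  shows "bij_betw (\<lambda>X. f \<odot>\<^bsub>localization R M U\<^esub> X) (carrier (localization R M U)) (carrier (localization R M U))"
proof -
  let ?L = "localization R M U"
  interpret L: module R ?L by (rule localization_module)
  have "X = Y" if X: "X \<in> carrier ?L" and Y: "Y \<in> carrier ?L" and eq: "f \<odot>\<^bsub>?L\<^esub> X = f \<odot>\<^bsub>?L\<^esub> Y" for X Y
    using X Y
  proof (elim localization_cases)
    fix m s n t assume c: "m \<in> carrier M" "s \<in> U" "n \<in> carrier M" "t \<in> U"
      and XY: "X = frac m s" "Y = frac n t"
    obtain u where u: "u \<in> U" "(u \<otimes> t) \<odot>\<^bsub>M\<^esub> (f \<odot>\<^bsub>M\<^esub> m) = (u \<otimes> s) \<odot>\<^bsub>M\<^esub> (f \<odot>\<^bsub>M\<^esub> n)"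
      using eq c f unfolding XY by (auto simp: frac_smult frac_eq_iff)
    then have "(u \<otimes> f \<otimes> t) \<odot>\<^bsub>M\<^esub> m = (u \<otimes> f \<otimes> s) \<odot>\<^bsub>M\<^esub> n"
      using c f by (simp add: smult_assoc1[symmetric] m_ac)
    then show ?thesis
      unfolding XY using c f u(1) by (subst frac_eq_iff) (auto intro!: U_mult bexI[of _ "u \<otimes> f"])
  qed
  moreover have "\<exists>Y\<in>carrier ?L. X = f \<odot>\<^bsub>?L\<^esub> Y" if X: "X \<in> carrier ?L" for X
    using X
  proof (elim localization_cases)
    fix m s assume c: "m \<in> carrier M" "s \<in> U" and X: "X = frac m s"
    have "frac m s = frac (f \<odot>\<^bsub>M\<^esub> m) (f \<otimes> s)"
      using c f by (intro frac_eqI) (auto simp: U_mult smult_assoc1[symmetric] m_ac)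
    then show ?thesis
      unfolding X using c f by (intro bexI[of _ "frac m (f \<otimes> s)"]) (auto simp: frac_smult U_mult)
  qed
  ultimately show ?thesis
    using f unfolding bij_betw_def by (intro conjI inj_onI) (auto simp: image_iff)
qed

lemma loc_map_frac:
  assumes V: "localized_module R M V" "U \<subseteq> V" and m: "m \<in> carrier M" "s \<in> U"
  shows "loc_map R M V (frac m s) = mfrac R M V m s"
proof -
  interpret V: localized_module R M V by fact
  show ?thesis
    unfolding loc_map_def
  proof (rule UN_frac)
    fix m' s' assume m': "m' \<in> carrier M" "s' \<in> U" and "frac m' s' = frac m s"
    then obtain u where "u \<in> U" "(u \<otimes> s) \<odot>\<^bsub>M\<^esub> m' = (u \<otimes> s') \<odot>\<^bsub>M\<^esub> m"
      using frac_eq_iff[of m' s' m s] m by auto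
    then show "mfrac R M V m' s' = mfrac R M V m s"
      using m m' V(2) by (subst V.frac_eq_iff) auto
  qed (use m in auto)
qed

lemma loc_map_linear:
  assumes V: "localized_module R M V" "U \<subseteq> V"
  shows "linear_map R (localization R M U) (localization R M V) (loc_map R M V)"
proof -
  interpret V: localized_module R M V by fact
  have UV: "s \<in> V" if "s \<in> U" for s using that V(2) by auto
  show ?thesis
    unfolding linear_map_def linear_map_axioms_def linear_maps_def
  proof (intro conjI CollectI ballI localization_module V.localization_module Pi_I)
    fix X assume X: "X \<in> carrier (localization R M U)"
    then show "loc_map R M V X \<in> carrier (localization R M V)"
      by (elim localization_cases) (auto simp: loc_map_frac[OF V] UV)
    {
      fix Y assume "Y \<in> carrier (localization R M U)"
      with X show "loc_map R M V (X \<oplus>\<^bsub>localization R M U\<^esub> Y)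
          = loc_map R M V X \<oplus>\<^bsub>localization R M V\<^esub> loc_map R M V Y"
        by (elim localization_cases) (auto simp: loc_map_frac[OF V] UV frac_add V.frac_add U_mult)
    }
    {
      fix r assume "r \<in> carrier R"
      with X show "loc_map R M V (r \<odot>\<^bsub>localization R M U\<^esub> X) = r \<odot>\<^bsub>localization R M V\<^esub> loc_map R M V X"
        by (elim localization_cases) (auto simp: loc_map_frac[OF V] UV frac_smult V.frac_smult)
    }
  qed
qed

lemma loc_map_loc_map:
  assumes V: "localized_module R M V" "U \<subseteq> V" and W: "localized_module R M W" "V \<subseteq> W"
    and X: "X \<in> carrier (localization R M U)"
  shows "loc_map R M W (loc_map R M V X) = loc_map R M W X"
proof -
  interpret V: localized_module R M V by fact
  show ?thesis
    using X V(2) W(2)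
    by (elim localization_cases)
      (auto simp: loc_map_frac[OF V] loc_map_frac[OF W(1)] V.loc_map_frac[OF W] subset_iff)
qed

end

section \<open>Monomial denominators\<close>

context cring
begin

lemma monomials_memI: "(\<Otimes>i\<in>A. (fs ! i) [^] (e i :: nat)) \<in> monomials R fs A"
  by (auto simp: monomials_def)

lemma monomials_submonoid:
  assumes "set fs \<subseteq> carrier R" "A \<subseteq> {..<length fs}"
  shows "monomials R fs A \<subseteq> carrier R" "\<one> \<in> monomials R fs A"
    and "\<And>s t. s \<in> monomials R fs A \<Longrightarrow> t \<in> monomials R fs A \<Longrightarrow> s \<otimes> t \<in> monomials R fs A"
proof -
  have fs: "fs ! i \<in> carrier R" if "i \<in> A" for i
    by (rule subsetD[OF assms(1) nth_mem]) (use that assms in auto)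
  show "monomials R fs A \<subseteq> carrier R"
    using fs by (auto simp: monomials_def intro!: finprod_closed)
  show "\<one> \<in> monomials R fs A"
    using monomials_memI[of fs "\<lambda>_. 0" A] by (simp add: finprod_one)
  fix s t assume "s \<in> monomials R fs A" "t \<in> monomials R fs A"
  then obtain e e' where e: "s = (\<Otimes>i\<in>A. (fs ! i) [^] (e i :: nat))" "t = (\<Otimes>i\<in>A. (fs ! i) [^] (e' i :: nat))"
    by (auto simp: monomials_def)
  have "s \<otimes> t = (\<Otimes>i\<in>A. (fs ! i) [^] e i \<otimes> (fs ! i) [^] e' i)"
    unfolding e using fs by (intro finprod_multf[symmetric]) auto
  also have "\<dots> = (\<Otimes>i\<in>A. (fs ! i) [^] (e i + e' i))"
    using fs by (intro finprod_cong') (auto simp: nat_pow_mult)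
  finally show "s \<otimes> t \<in> monomials R fs A"
    using monomials_memI[of fs "\<lambda>i. e i + e' i" A] by simp
qed

lemma monomials_mono:
  assumes "set fs \<subseteq> carrier R" "A \<subseteq> B" "B \<subseteq> {..<length fs}"
  shows "monomials R fs A \<subseteq> monomials R fs B"
proof
  fix s assume "s \<in> monomials R fs A"
  then obtain e where e: "s = (\<Otimes>i\<in>A. (fs ! i) [^] (e i :: nat))"
    by (auto simp: monomials_def)
  have fs: "fs ! i \<in> carrier R" if "i \<in> B" for i
    by (rule subsetD[OF assms(1) nth_mem]) (use that assms in auto)
  have "finite B" using assms(3) finite_subset by blast
  then have "s = (\<Otimes>i\<in>B. (fs ! i) [^] (if i \<in> A then e i else 0))"
    unfolding e using assms(2) fs by (intro finprod_mono_neutral_cong_left) auto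
  then show "s \<in> monomials R fs B" using monomials_memI by metis
qed

lemma nth_mem_monomials:
  assumes "set fs \<subseteq> carrier R" "A \<subseteq> {..<length fs}" "i \<in> A"
  shows "fs ! i \<in> monomials R fs A"
proof -
  have fs: "fs ! i \<in> carrier R" by (rule subsetD[OF assms(1) nth_mem]) (use assms in auto)
  have "monomials R fs {i} \<subseteq> monomials R fs A" using assms by (intro monomials_mono) auto
  moreover have "fs ! i \<in> monomials R fs {i}"
    using monomials_memI[of fs "\<lambda>_. 1" "{i}"] fs by simp
  ultimately show ?thesis by auto
qed

end

lemma localized_module_monomials:
  assumes "module R M" "set fs \<subseteq> carrier R" "A \<subseteq> {..<length fs}"
  shows "localized_module R M (monomials R fs A)"
proof -
  interpret module R M by fact
  show ?thesis
    using monomials_submonoid[OF assms(2,3)] by unfold_locales auto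
qed

section \<open>The Cech complex\<close>

text \<open>
  As \<open>N\<close> contains zero, \<open>c\<close> lies in its own coset and \<open>r \<odot> c\<close> in the scalar multiple of that coset, which is \<open>N\<close>.
\<close>

lemma ann_quot_moduleD:
  assumes "r \<in> ann R (quot_module (M\<lparr>carrier := Z\<rparr>) N)"
    and "abelian_group M" "N \<subseteq> carrier M" "\<zero>\<^bsub>M\<^esub> \<in> N"
    and c: "c \<in> Z" "c \<in> carrier M" "r \<odot>\<^bsub>M\<^esub> c \<in> carrier M"
  shows "r \<odot>\<^bsub>M\<^esub> c \<in> N"
proof -
  interpret abelian_group M by fact
  let ?Q = "quot_module (M\<lparr>carrier := Z\<rparr>) N"
  have coset: "N +>\<^bsub>M\<lparr>carrier := Z\<rparr>\<^esub> v = (\<lambda>n. n \<oplus>\<^bsub>M\<^esub> v) ` N" for v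
    by (auto simp: a_r_coset_def r_coset_def)
  have self: "v \<in> (\<lambda>n. n \<oplus>\<^bsub>M\<^esub> v) ` N" if "v \<in> carrier M" for v
    using assms(4) that by (intro image_eqI[of _ _ "\<zero>\<^bsub>M\<^esub>"]) auto
  have "N +>\<^bsub>M\<lparr>carrier := Z\<rparr>\<^esub> c \<in> carrier ?Q"
    using c(1) by (auto simp: quot_module_def A_RCOSETS_def RCOSETS_def a_r_coset_def)
  then have "r \<odot>\<^bsub>?Q\<^esub> (N +>\<^bsub>M\<lparr>carrier := Z\<rparr>\<^esub> c) = N"
    using assms(1) by (auto simp: ann_def quot_module_def)
  moreover have "r \<odot>\<^bsub>M\<^esub> c \<in> r \<odot>\<^bsub>?Q\<^esub> (N +>\<^bsub>M\<lparr>carrier := Z\<rparr>\<^esub> c)"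
  proof -
    have "r \<odot>\<^bsub>?Q\<^esub> (N +>\<^bsub>M\<lparr>carrier := Z\<rparr>\<^esub> c)
        = (\<Union>m\<in>(\<lambda>n. n \<oplus>\<^bsub>M\<^esub> c) ` N. (\<lambda>n. n \<oplus>\<^bsub>M\<^esub> (r \<odot>\<^bsub>M\<^esub> m)) ` N)"
      by (simp add: quot_module_def coset)
    then show ?thesis using self[OF c(2)] self[OF c(3)] by blast
  qed
  ultimately show ?thesis by simp
qed

lemma cech_index_eq: "cech_index fs j = subsets_of_card {..<length fs} j"
  by (simp add: cech_index_def subsets_of_card_def)

locale cech = module R M
  for R :: "('r, 'n) ring_scheme" (structure) and M :: "('r, 'm) module" (structure) +
  fixes fs :: "'r list"
  assumes fs: "set fs \<subseteq> carrier R"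
begin

abbreviation L :: "nat set \<Rightarrow> ('r, ('m \<times> 'r) set) module" where
  "L \<equiv> cech_summand R M fs"

abbreviation C :: "nat \<Rightarrow> ('r, nat set \<Rightarrow> ('m \<times> 'r) set) module" where
  "C \<equiv> cech_module R M fs"

abbreviation res :: "nat set \<Rightarrow> ('m \<times> 'r) set \<Rightarrow> ('m \<times> 'r) set" where
  "res B \<equiv> loc_map R M (monomials R fs B)"

lemma index_finite: "A \<in> cech_index fs j \<Longrightarrow> finite A" "A \<in> cech_index fs j \<Longrightarrow> A \<subseteq> {..<length fs}"
  by (auto simp: cech_index_def finite_subset)

lemma index_remove: "B \<in> cech_index fs (Suc j) \<Longrightarrow> i \<in> B \<Longrightarrow> B - {i} \<in> cech_index fs j"
  by (simp add: cech_index_eq remove_subsets_of_card)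

lemma loc_monomials: "A \<subseteq> {..<length fs} \<Longrightarrow> localized_module R M (monomials R fs A)"
  by (intro localized_module_monomials module_axioms fs)

lemma summand_module: "A \<subseteq> {..<length fs} \<Longrightarrow> module R (L A)"
  by (intro localized_module.localization_module loc_monomials)

lemma res_linear:
  assumes "A \<subseteq> B" "B \<subseteq> {..<length fs}"
  shows "linear_map R (L A) (L B) (res B)"
  using assms fs by (intro localized_module.loc_map_linear loc_monomials monomials_mono) auto

lemma res_res:
  assumes "A \<subseteq> B" "B \<subseteq> D" "D \<subseteq> {..<length fs}" "X \<in> carrier (L A)"
  shows "res D (res B X) = res D X"
  using assms fs
  by (intro localized_module.loc_map_loc_map[where U = "monomials R fs A"] loc_monomials monomials_mono) auto

lemma cech_carrier: "carrier (C j) = (\<Pi>\<^sub>E A\<in>cech_index fs j. carrier (L A))"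
  by (simp add: cech_module_def)

lemma cech_zero_apply: "A \<in> cech_index fs j \<Longrightarrow> \<zero>\<^bsub>C j\<^esub> A = \<zero>\<^bsub>L A\<^esub>"
  by (simp add: cech_module_def)

lemma cech_add_apply: "A \<in> cech_index fs j \<Longrightarrow> (b \<oplus>\<^bsub>C j\<^esub> c) A = b A \<oplus>\<^bsub>L A\<^esub> c A"
  by (simp add: cech_module_def)

lemma cech_smult_apply: "A \<in> cech_index fs j \<Longrightarrow> (r \<odot>\<^bsub>C j\<^esub> c) A = r \<odot>\<^bsub>L A\<^esub> c A"
  by (simp add: cech_module_def)

lemma cech_apply: "c \<in> carrier (C j) \<Longrightarrow> A \<in> cech_index fs j \<Longrightarrow> c A \<in> carrier (L A)"
  by (auto simp: cech_carrier)

lemma cech_ext: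
  assumes "b \<in> carrier (C j)" "c \<in> carrier (C j)" "\<And>A. A \<in> cech_index fs j \<Longrightarrow> b A = c A"
  shows "b = c"
  using assms unfolding cech_carrier by (rule PiE_ext)

lemma cech_closed:
  "\<zero>\<^bsub>C j\<^esub> \<in> carrier (C j)"
  "b \<in> carrier (C j) \<Longrightarrow> c \<in> carrier (C j) \<Longrightarrow> b \<oplus>\<^bsub>C j\<^esub> c \<in> carrier (C j)"
  "r \<in> carrier R \<Longrightarrow> c \<in> carrier (C j) \<Longrightarrow> r \<odot>\<^bsub>C j\<^esub> c \<in> carrier (C j)"
proof -
  have m: "module R (L A)" if "A \<in> cech_index fs j" for A
    using summand_module index_finite that by blast
  have g: "abelian_group (L A)" if "A \<in> cech_index fs j" for A
    using m[OF that] by (simp add: module_def)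
  have memI: "c \<in> carrier (C j)"
    if "\<And>A. A \<in> cech_index fs j \<Longrightarrow> c A \<in> carrier (L A)"
      and "\<And>A. A \<notin> cech_index fs j \<Longrightarrow> c A = undefined" for c
    unfolding cech_carrier using that by (rule PiE_I)
  show "\<zero>\<^bsub>C j\<^esub> \<in> carrier (C j)"
    by (rule memI) (simp_all add: cech_module_def abelian_monoid.zero_closed[OF abelian_group.axioms(1)[OF g]])
  show "b \<oplus>\<^bsub>C j\<^esub> c \<in> carrier (C j)" if "b \<in> carrier (C j)" "c \<in> carrier (C j)"
  proof (rule memI)
    fix A assume A: "A \<in> cech_index fs j"
    show "(b \<oplus>\<^bsub>C j\<^esub> c) A \<in> carrier (L A)"
      unfolding cech_add_apply[OF A]
      by (rule abelian_monoid.a_closed[OF abelian_group.axioms(1)[OF g[OF A]]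
            cech_apply[OF that(1) A] cech_apply[OF that(2) A]])
  qed (simp add: cech_module_def)
  show "r \<odot>\<^bsub>C j\<^esub> c \<in> carrier (C j)" if "r \<in> carrier R" "c \<in> carrier (C j)"
  proof (rule memI)
    fix A assume A: "A \<in> cech_index fs j"
    show "(r \<odot>\<^bsub>C j\<^esub> c) A \<in> carrier (L A)"
      unfolding cech_smult_apply[OF A] by (rule module.smult_closed[OF m[OF A] that(1) cech_apply[OF that(2) A]])
  qed (simp add: cech_module_def)
qed

lemma cech_module: "module R (C j)"
proof -
  have m: "module R (L A)" if "A \<in> cech_index fs j" for A
    using summand_module index_finite that by blast
  have g: "abelian_group (L A)" if "A \<in> cech_index fs j" for A
    using m[OF that] by (simp add: module_def)
  note am = abelian_group.axioms(1)[OF g]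
  note app = cech_zero_apply cech_add_apply cech_smult_apply cech_apply
  show ?thesis
  proof (intro moduleI abelian_groupI R.is_cring cech_closed)
    fix b c d assume b: "b \<in> carrier (C j)" and c: "c \<in> carrier (C j)" and d: "d \<in> carrier (C j)"
    show "b \<oplus>\<^bsub>C j\<^esub> c \<oplus>\<^bsub>C j\<^esub> d = b \<oplus>\<^bsub>C j\<^esub> (c \<oplus>\<^bsub>C j\<^esub> d)"
      using b c d by (intro cech_ext[of _ j] cech_closed) (auto simp: app abelian_monoid.a_assoc[OF am])
  next
    fix b c assume b: "b \<in> carrier (C j)" and c: "c \<in> carrier (C j)"
    show "b \<oplus>\<^bsub>C j\<^esub> c = c \<oplus>\<^bsub>C j\<^esub> b"
      using b c by (intro cech_ext[of _ j] cech_closed) (auto simp: app abelian_monoid.a_comm[OF am])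
  next
    fix b assume b: "b \<in> carrier (C j)"
    show "\<zero>\<^bsub>C j\<^esub> \<oplus>\<^bsub>C j\<^esub> b = b"
      using b by (intro cech_ext[of _ j] cech_closed) (auto simp: app abelian_monoid.l_zero[OF am])
    define b' where "b' = (\<lambda>A\<in>cech_index fs j. \<ominus>\<^bsub>L A\<^esub> b A)"
    have b': "b' \<in> carrier (C j)"
      using b by (auto simp: b'_def cech_carrier PiE_mem intro!: abelian_group.a_inv_closed[OF g])
    moreover have "b' \<oplus>\<^bsub>C j\<^esub> b = \<zero>\<^bsub>C j\<^esub>"
      using b b' by (intro cech_ext[of _ j] cech_closed) (auto simp: app b'_def abelian_group.l_neg[OF g])
    ultimately show "\<exists>b'\<in>carrier (C j). b' \<oplus>\<^bsub>C j\<^esub> b = \<zero>\<^bsub>C j\<^esub>" by blast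
    show "\<one> \<odot>\<^bsub>C j\<^esub> b = b"
      using b by (intro cech_ext[of _ j] cech_closed) (auto simp: app module.smult_one[OF m])
  next
    fix r s b assume r: "r \<in> carrier R" "s \<in> carrier R" and b: "b \<in> carrier (C j)"
    show "(r \<oplus> s) \<odot>\<^bsub>C j\<^esub> b = r \<odot>\<^bsub>C j\<^esub> b \<oplus>\<^bsub>C j\<^esub> s \<odot>\<^bsub>C j\<^esub> b"
      using r b by (intro cech_ext[of _ j] cech_closed) (auto simp: app module.smult_l_distr[OF m])
    show "(r \<otimes> s) \<odot>\<^bsub>C j\<^esub> b = r \<odot>\<^bsub>C j\<^esub> (s \<odot>\<^bsub>C j\<^esub> b)"
      using r b by (intro cech_ext[of _ j] cech_closed) (auto simp: app module.smult_assoc1[OF m])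
  next
    fix r b c assume r: "r \<in> carrier R" and b: "b \<in> carrier (C j)" "c \<in> carrier (C j)"
    show "r \<odot>\<^bsub>C j\<^esub> (b \<oplus>\<^bsub>C j\<^esub> c) = r \<odot>\<^bsub>C j\<^esub> b \<oplus>\<^bsub>C j\<^esub> r \<odot>\<^bsub>C j\<^esub> c"
      using r b by (intro cech_ext[of _ j] cech_closed) (auto simp: app module.smult_r_distr[OF m])
  qed
qed

lemma evaluation_linear:
  assumes "A \<in> cech_index fs j"
  shows "linear_map R (C j) (L A) (\<lambda>c. c A)"
  using assms summand_module[OF index_finite(2)] cech_module
  by (auto simp: linear_map_def linear_map_axioms_def linear_maps_def
      cech_apply cech_add_apply cech_smult_apply)

lemma cech_diff_apply:
  "B \<in> cech_index fs (Suc j) \<Longrightarrow>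
   cech_diff R M fs j c B = (\<Oplus>\<^bsub>L B\<^esub>i\<in>B. signed (L B) (num_below B i) (res B (c (B - {i}))))"
  by (simp add: cech_diff_def signed_def num_below_def Let_def)

lemma cech_diff_term:
  assumes "B \<in> cech_index fs (Suc j)" "c \<in> carrier (C j)" "i \<in> B"
  shows "res B (c (B - {i})) \<in> carrier (L B)"
proof -
  interpret linear_map R "L (B - {i})" "L B" "res B"
    using index_finite[OF assms(1)] by (intro res_linear) auto
  show ?thesis using cech_apply[OF assms(2) index_remove[OF assms(1,3)]] by blast
qed

lemma cech_diff_linear: "linear_map R (C j) (C (Suc j)) (cech_diff R M fs j)"
proof -
  have closed: "cech_diff R M fs j c \<in> carrier (C (Suc j))" if c: "c \<in> carrier (C j)" for c
    unfolding cech_carrier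
  proof (rule PiE_I)
    fix B assume B: "B \<in> cech_index fs (Suc j)"
    interpret LB: module R "L B" by (intro summand_module index_finite(2)[OF B])
    show "cech_diff R M fs j c B \<in> carrier (L B)"
      unfolding cech_diff_apply[OF B] using cech_diff_term[OF B c]
      by (intro LB.M.finsum_closed) auto
  qed (simp add: cech_diff_def)
  moreover have "cech_diff R M fs j (b \<oplus>\<^bsub>C j\<^esub> c) = cech_diff R M fs j b \<oplus>\<^bsub>C (Suc j)\<^esub> cech_diff R M fs j c"
    if b: "b \<in> carrier (C j)" and c: "c \<in> carrier (C j)" for b c
  proof (rule cech_ext[OF closed cech_closed(2)[OF closed closed]])
    fix B assume B: "B \<in> cech_index fs (Suc j)"
    interpret LB: module R "L B" by (intro summand_module index_finite(2)[OF B])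
    have "cech_diff R M fs j (b \<oplus>\<^bsub>C j\<^esub> c) B = (\<Oplus>\<^bsub>L B\<^esub>i\<in>B.
        signed (L B) (num_below B i) (res B (b (B - {i}))) \<oplus>\<^bsub>L B\<^esub> signed (L B) (num_below B i) (res B (c (B - {i}))))"
      unfolding cech_diff_apply[OF B]
    proof (intro LB.M.finsum_cong')
      fix i assume i: "i \<in> B"
      interpret linear_map R "L (B - {i})" "L B" "res B"
        using index_finite[OF B] by (intro res_linear) auto
      note ind = index_remove[OF B i]
      show "signed (L B) (num_below B i) (res B ((b \<oplus>\<^bsub>C j\<^esub> c) (B - {i}))) =
         signed (L B) (num_below B i) (res B (b (B - {i}))) \<oplus>\<^bsub>L B\<^esub> signed (L B) (num_below B i) (res B (c (B - {i})))"
        using cech_apply[OF b ind] cech_apply[OF c ind]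
        by (simp add: cech_add_apply[OF ind] map_add LB.M.signed_add map_closed)
    qed (use cech_diff_term[OF B b] cech_diff_term[OF B c] in auto)
    also have "\<dots> = cech_diff R M fs j b B \<oplus>\<^bsub>L B\<^esub> cech_diff R M fs j c B"
      unfolding cech_diff_apply[OF B] using cech_diff_term[OF B b] cech_diff_term[OF B c]
      by (intro LB.M.finsum_addf) auto
    finally show "cech_diff R M fs j (b \<oplus>\<^bsub>C j\<^esub> c) B
        = (cech_diff R M fs j b \<oplus>\<^bsub>C (Suc j)\<^esub> cech_diff R M fs j c) B"
      by (simp add: cech_add_apply[OF B])
  qed (use b c cech_closed in auto)
  moreover have "cech_diff R M fs j (r \<odot>\<^bsub>C j\<^esub> c) = r \<odot>\<^bsub>C (Suc j)\<^esub> cech_diff R M fs j c"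
    if r: "r \<in> carrier R" and c: "c \<in> carrier (C j)" for r c
  proof (rule cech_ext[OF closed cech_closed(3)[OF _ closed]])
    fix B assume B: "B \<in> cech_index fs (Suc j)"
    interpret LB: module R "L B" by (intro summand_module index_finite(2)[OF B])
    have "cech_diff R M fs j (r \<odot>\<^bsub>C j\<^esub> c) B = (\<Oplus>\<^bsub>L B\<^esub>i\<in>B.
        r \<odot>\<^bsub>L B\<^esub> signed (L B) (num_below B i) (res B (c (B - {i}))))"
      unfolding cech_diff_apply[OF B]
    proof (intro LB.M.finsum_cong')
      fix i assume i: "i \<in> B"
      interpret linear_map R "L (B - {i})" "L B" "res B"
        using index_finite[OF B] by (intro res_linear) auto
      note ind = index_remove[OF B i]
      show "signed (L B) (num_below B i) (res B ((r \<odot>\<^bsub>C j\<^esub> c) (B - {i}))) =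
         r \<odot>\<^bsub>L B\<^esub> signed (L B) (num_below B i) (res B (c (B - {i})))"
        using cech_apply[OF c ind] r
        by (simp add: cech_smult_apply[OF ind] map_smult LB.smult_signed map_closed)
    qed (use cech_diff_term[OF B c] r in auto)
    also have "\<dots> = r \<odot>\<^bsub>L B\<^esub> cech_diff R M fs j c B"
      unfolding cech_diff_apply[OF B] using cech_diff_term[OF B c] index_finite[OF B] r
      by (intro LB.finsum_smult_ldistr[symmetric]) auto
    finally show "cech_diff R M fs j (r \<odot>\<^bsub>C j\<^esub> c) B = (r \<odot>\<^bsub>C (Suc j)\<^esub> cech_diff R M fs j c) B"
      by (simp add: cech_smult_apply[OF B])
  qed (use r c cech_closed in auto)
  ultimately show ?thesis
    using cech_module by (auto simp: linear_map_def linear_map_axioms_def linear_maps_def)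
qed

lemma cech_diff_cech_diff:
  assumes c: "c \<in> carrier (C j)"
  shows "cech_diff R M fs (Suc j) (cech_diff R M fs j c) = \<zero>\<^bsub>C (Suc (Suc j))\<^esub>"
proof -
  interpret d: linear_map R "C j" "C (Suc j)" "cech_diff R M fs j" by (rule cech_diff_linear)
  interpret d': linear_map R "C (Suc j)" "C (Suc (Suc j))" "cech_diff R M fs (Suc j)" by (rule cech_diff_linear)
  show ?thesis
  proof (rule cech_ext[of _ "Suc (Suc j)"])
    fix D assume D: "D \<in> cech_index fs (Suc (Suc j))"
    interpret LD: module R "L D" by (intro summand_module index_finite(2)[OF D])
    define F where "F i l = signed (L D) (num_below D i + num_below (D - {i}) l) (res D (c (D - {i} - {l})))" for i l
    have t: "res D (c (D - {i} - {l})) \<in> carrier (L D)" if "i \<in> D" "l \<in> D" "i \<noteq> l" for i l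
    proof -
      interpret linear_map R "L (D - {i} - {l})" "L D" "res D"
        using index_finite[OF D] by (intro res_linear) auto
      have "D - {i} - {l} \<in> cech_index fs j" using that index_remove[OF index_remove[OF D]] by auto
      then show ?thesis using cech_apply[OF c] by blast
    qed
    have "cech_diff R M fs (Suc j) (cech_diff R M fs j c) D = (\<Oplus>\<^bsub>L D\<^esub>i\<in>D. \<Oplus>\<^bsub>L D\<^esub>l\<in>D - {i}. F i l)"
      unfolding cech_diff_apply[OF D]
    proof (intro LD.M.finsum_cong')
      fix i assume i: "i \<in> D"
      note B = index_remove[OF D i]
      interpret r: linear_map R "L (D - {i})" "L D" "res D"
        using index_finite[OF D] by (intro res_linear) auto
      note tB = cech_diff_term[OF B c]
      have "res D (cech_diff R M fs j c (D - {i})) = (\<Oplus>\<^bsub>L D\<^esub>l\<in>D - {i}.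
          res D (signed (L (D - {i})) (num_below (D - {i}) l) (res (D - {i}) (c (D - {i} - {l})))))"
        unfolding cech_diff_apply[OF B] using tB index_finite[OF B]
        by (intro r.map_finsum) auto
      also have "\<dots> = (\<Oplus>\<^bsub>L D\<^esub>l\<in>D - {i}. signed (L D) (num_below (D - {i}) l) (res D (c (D - {i} - {l}))))"
      proof (intro LD.M.finsum_cong')
        fix l assume l: "l \<in> D - {i}"
        have "c (D - {i} - {l}) \<in> carrier (L (D - {i} - {l}))"
          by (rule cech_apply[OF c index_remove[OF B l]])
        then have "res D (res (D - {i}) (c (D - {i} - {l}))) = res D (c (D - {i} - {l}))"
          by (rule res_res[OF Diff_subset Diff_subset index_finite(2)[OF D]])
        then show "res D (signed (L (D - {i})) (num_below (D - {i}) l) (res (D - {i}) (c (D - {i} - {l}))))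
            = signed (L D) (num_below (D - {i}) l) (res D (c (D - {i} - {l})))"
          using tB[OF l] by (simp add: r.map_signed)
      qed (use t i in auto)
      finally show "signed (L D) (num_below D i) (res D (cech_diff R M fs j c (D - {i}))) = (\<Oplus>\<^bsub>L D\<^esub>l\<in>D - {i}. F i l)"
        unfolding F_def using t i index_finite[OF D]
        by (simp add: LD.M.signed_finsum Pi_def LD.M.signed_signed cong: LD.M.finsum_cong)
    qed (use t in \<open>auto simp: F_def intro!: LD.M.finsum_closed\<close>)
    also have "\<dots> = \<zero>\<^bsub>L D\<^esub>"
    proof (intro LD.M.finsum_skew_zero index_finite(1)[OF D])
      fix i l assume il: "i \<in> D" "l \<in> D" "i \<noteq> l"
      then show "F i l \<in> carrier (L D)" using t by (auto simp: F_def)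
      have "D - {l} - {i} = D - {i} - {l}" by auto
      then show "F i l \<oplus>\<^bsub>L D\<^esub> F l i = \<zero>\<^bsub>L D\<^esub>"
        unfolding F_def using t[OF il] il num_below_remove_remove_parity[OF index_finite(1)[OF D], of i l]
        by (simp, intro LD.M.signed_cancel) auto
    qed
    finally show "cech_diff R M fs (Suc j) (cech_diff R M fs j c) D = \<zero>\<^bsub>C (Suc (Suc j))\<^esub> D"
      by (simp add: cech_zero_apply[OF D])
  qed (use c cech_closed in auto)
qed

sublocale cochain_complex R C "cech_diff R M fs"
proof (rule cochain_complex.intro)
  show "cech_diff R M fs j \<in> linear_maps R (C j) (C (Suc j))" for j
    by (rule linear_map.linear[OF cech_diff_linear])
qed (fact cech_module cech_diff_cech_diff)+

lemma coboundaries_eq: "cech_coboundaries R M fs j = coboundaries j"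
  by (simp add: cech_coboundaries_def coboundaries_def)

lemma ann_kills_cohomology:
  assumes e: "e \<in> ann R (cech_cohomology R M fs j)"
  shows "kills_cohomology j e"
  unfolding kills_cohomology_def
proof (intro conjI ballI impI)
  show eR: "e \<in> carrier R" using e by (simp add: ann_def)
  interpret Cj: module R "C j" by (rule cech_module)
  fix c assume c: "c \<in> carrier (C j)" "cech_diff R M fs j c = \<zero>\<^bsub>C (Suc j)\<^esub>"
  have zero: "\<zero>\<^bsub>C j\<^esub> \<in> coboundaries j \<and> coboundaries j \<subseteq> carrier (C j)"
  proof (cases j)
    case 0
    then show ?thesis by (simp add: coboundaries_def cech_closed)
  next
    case (Suc i)
    interpret d: linear_map R "C i" "C (Suc i)" "cech_diff R M fs i" by (rule cech_diff_linear)
    have "\<zero>\<^bsub>C j\<^esub> = cech_diff R M fs i \<zero>\<^bsub>C i\<^esub>" by (simp add: Suc)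
    then have "\<zero>\<^bsub>C j\<^esub> \<in> cech_diff R M fs i ` carrier (C i)" using d.dom.M.zero_closed by (rule image_eqI)
    then show ?thesis by (auto simp: Suc coboundaries_def)
  qed
  show "e \<odot>\<^bsub>C j\<^esub> c \<in> coboundaries j"
  proof (rule ann_quot_moduleD)
    show "e \<in> ann R (quot_module ((C j)\<lparr>carrier := cech_cocycles R M fs j\<rparr>) (coboundaries j))"
      using e by (simp add: cech_cohomology_def coboundaries_eq)
    show "abelian_group (C j)" ..
    show "c \<in> cech_cocycles R M fs j" using c by (simp add: cech_cocycles_def)
  qed (use zero c eR in auto)
qed

text \<open>
  In positive degree each summand of the Cech complex is a localisation at some \<open>f = fs ! l\<close>. A power of
  \<open>f\<close> lies in the ideal of the \<open>y k\<close> and acts invertibly there, so the Koszul complex on \<open>y\<close> is exact on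
  every summand and hence on their product.
\<close>

lemma cech_koszul_acyclic:
  assumes T: "finite T" and y: "y \<in> T \<rightarrow> carrier R"
    and powers: "\<And>f. f \<in> set fs \<Longrightarrow> \<exists>n::nat. \<exists>g\<in>T \<rightarrow> carrier R. f [^] n = (\<Oplus>k\<in>T. g k \<otimes> y k)"
  shows "koszul_acyclic T y (Suc j)"
  unfolding koszul_acyclic_def
proof (intro allI impI)
  fix i z
  assume z: "z \<in> subsets_of_card T i \<rightarrow> carrier (C (Suc j))"
    and cycle: "\<forall>B. Suc (card B) = i \<longrightarrow> B \<subseteq> T \<longrightarrow> koszul_diff (C (Suc j)) T y z B = \<zero>\<^bsub>C (Suc j)\<^esub>"
  interpret K: koszul R "C (Suc j)" T y
    using cech_module T y by (simp add: koszul_def koszul_axioms_def)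
  have "\<exists>w. w \<in> subsets_of_card T (Suc i) \<rightarrow> carrier (L A) \<and>
      (\<forall>B\<in>subsets_of_card T i. koszul_diff (L A) T y w B = z B A)" if A: "A \<in> cech_index fs (Suc j)" for A
  proof -
    note AI = index_finite[OF A]
    interpret LA: koszul R "L A" T y
      using summand_module[OF AI(2)] T y by (simp add: koszul_def koszul_axioms_def)
    interpret lm: localized_module R M "monomials R fs A" by (rule loc_monomials[OF AI(2)])
    have "A \<noteq> {}" using A by (auto simp: cech_index_def)
    then obtain l where l: "l \<in> A" by auto
    define f where "f = fs ! l"
    have f: "f \<in> set fs" "f \<in> monomials R fs A"
      using l AI nth_mem_monomials[OF fs AI(2) l] by (auto simp: f_def)
    obtain n :: nat and g where g: "g \<in> T \<rightarrow> carrier R" "f [^] n = (\<Oplus>k\<in>T. g k \<otimes> y k)"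
      using powers[OF f(1)] by auto
    have "f [^] n \<in> monomials R fs A"
      using f(2) by (induction n) (auto simp: lm.U_one lm.U_mult)
    note bij = lm.smult_denominator_bij[OF this]
    have zA: "(\<lambda>B. z B A) \<in> subsets_of_card T i \<rightarrow> carrier (L A)"
      using z cech_apply[OF _ A] by auto
    have cyc: "koszul_diff (L A) T y (\<lambda>B. z B A) D = \<zero>\<^bsub>L A\<^esub>" if D: "Suc (card D) = i" "D \<subseteq> T" for D
    proof -
      have "koszul_diff (L A) T y (\<lambda>B. z B A) D = koszul_diff (C (Suc j)) T y z D A"
        using K.koszul_diff_linear[OF evaluation_linear[OF A], of D "card D" z] D z
        by (auto simp: subsets_of_card_def)
      then show ?thesis using cycle D by (simp add: cech_zero_apply[OF A])
    qed
    show ?thesis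
      by (rule LA.koszul_exact[OF g(1) g(2) bij zA cyc]) auto
  qed
  then obtain w where w: "\<And>A. A \<in> cech_index fs (Suc j) \<Longrightarrow> w A \<in> subsets_of_card T (Suc i) \<rightarrow> carrier (L A)"
    and dw: "\<And>A B. A \<in> cech_index fs (Suc j) \<Longrightarrow> B \<in> subsets_of_card T i \<Longrightarrow> koszul_diff (L A) T y (w A) B = z B A"
    by metis
  define v where "v B = (\<lambda>A\<in>cech_index fs (Suc j). w A B)" for B
  have v: "v \<in> subsets_of_card T (Suc i) \<rightarrow> carrier (C (Suc j))"
    using w by (auto simp: v_def cech_carrier Pi_def)
  have "koszul_diff (C (Suc j)) T y v B = z B" if B: "B \<in> subsets_of_card T i" for B
  proof (rule cech_ext)
    show "koszul_diff (C (Suc j)) T y v B \<in> carrier (C (Suc j))" by (rule K.koszul_diff_closed[OF B v])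
    show "z B \<in> carrier (C (Suc j))" using z B by auto
    fix A assume A: "A \<in> cech_index fs (Suc j)"
    interpret LA: koszul R "L A" T y
      using summand_module[OF index_finite(2)[OF A]] T y by (simp add: koszul_def koszul_axioms_def)
    have "koszul_diff (C (Suc j)) T y v B A = koszul_diff (L A) T y (\<lambda>D. v D A) B"
      using K.koszul_diff_linear[OF evaluation_linear[OF A] B v] by simp
    also have "\<dots> = koszul_diff (L A) T y (w A) B"
      using A by (simp add: v_def)
    finally show "koszul_diff (C (Suc j)) T y v B A = z B A" using dw[OF A B] by simp
  qed
  then show "\<exists>w. w \<in> subsets_of_card T (Suc i) \<rightarrow> carrier (C (Suc j)) \<and>
      (\<forall>B\<in>subsets_of_card T i. koszul_diff (C (Suc j)) T y w B = z B)"
    using v by blast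
qed

text \<open>
  The degree-zero term of the Cech complex is the localisation of \<open>M\<close> at \<open>{\<one>}\<close>, which is \<open>M\<close> itself.
\<close>

definition embed :: "'m \<Rightarrow> nat set \<Rightarrow> ('m \<times> 'r) set" where
  "embed m = (\<lambda>A\<in>cech_index fs 0. mfrac R M (monomials R fs A) m \<one>)"

lemma cech_index_0: "cech_index fs 0 = {{}}"
  using index_finite(1)[of _ 0] by (auto simp: cech_index_def card_eq_0_iff)

lemma embed_linear: "linear_map R M (C 0) embed"
  and embed_inj: "inj_on embed (carrier M)"
  and embed_surj: "embed ` carrier M = carrier (C 0)"
proof -
  interpret lm: localized_module R M "monomials R fs {}" by (rule loc_monomials) simp
  have one: "monomials R fs {} = {\<one>}" by (auto simp: monomials_def)
  have app: "embed m {} = lm.frac m \<one>" for m by (simp add: embed_def cech_index_0)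
  have closed: "embed m \<in> carrier (C 0)" if "m \<in> carrier M" for m
    using that lm.U_one by (auto simp: embed_def cech_carrier cech_index_0)
  have mem: "{} \<in> cech_index fs 0" by (simp add: cech_index_0)
  have ext: "b = c" if "b \<in> carrier (C 0)" "c \<in> carrier (C 0)" "b {} = c {}" for b c
    using that by (intro cech_ext[of b 0 c]) (auto simp: cech_index_0)
  have "embed (m \<oplus>\<^bsub>M\<^esub> n) = embed m \<oplus>\<^bsub>C 0\<^esub> embed n" if "m \<in> carrier M" "n \<in> carrier M" for m n
    using that lm.U_one
    by (intro ext closed cech_closed) (auto simp: cech_add_apply[OF mem] app lm.frac_add)
  moreover have "embed (r \<odot>\<^bsub>M\<^esub> m) = r \<odot>\<^bsub>C 0\<^esub> embed m" if "r \<in> carrier R" "m \<in> carrier M" for r m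
    using that lm.U_one
    by (intro ext closed cech_closed) (auto simp: cech_smult_apply[OF mem] app lm.frac_smult)
  ultimately show "linear_map R M (C 0) embed"
    using closed module_axioms cech_module
    by (auto simp: linear_map_def linear_map_axioms_def linear_maps_def)
  show "inj_on embed (carrier M)"
  proof (rule inj_onI)
    fix m n assume mn: "m \<in> carrier M" "n \<in> carrier M" "embed m = embed n"
    then have "lm.frac m \<one> = lm.frac n \<one>" by (metis app)
    then have "\<exists>u\<in>monomials R fs {}. (u \<otimes> \<one>) \<odot>\<^bsub>M\<^esub> m = (u \<otimes> \<one>) \<odot>\<^bsub>M\<^esub> n"
      using lm.frac_eq_iff[OF mn(1) lm.U_one mn(2) lm.U_one] by simp
    then show "m = n" using mn by (simp add: one)
  qed
  show "embed ` carrier M = carrier (C 0)"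
  proof (intro equalityI subsetI)
    fix c assume c: "c \<in> carrier (C 0)"
    then have "c {} \<in> carrier (L {})" by (rule cech_apply) (rule mem)
    then obtain m s where m: "m \<in> carrier M" "s \<in> monomials R fs {}" "c {} = lm.frac m s"
      by (elim lm.localization_cases) auto
    then have "c = embed m" using c by (intro ext closed) (auto simp: app one)
    then show "c \<in> embed ` carrier M" using m by blast
  qed (use closed in auto)
qed

text \<open>
  The double complex argument for the Cech complex, transported along \<open>embed\<close> back to \<open>M\<close>. The
  hypothesis on powers says that \<open>fs\<close> lies in the radical of the ideal generated by \<open>y\<close>.
\<close>

theorem annihilators_kill_koszul_cycles:
  assumes T: "finite T" "card T = Suc d" and y: "y \<in> T \<rightarrow> carrier R"
    and e: "\<And>j. j \<le> d \<Longrightarrow> e j \<in> ann R (cech_cohomology R M fs j)"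
    and powers: "\<And>f. f \<in> set fs \<Longrightarrow> \<exists>n::nat. \<exists>g\<in>T \<rightarrow> carrier R. f [^] n = (\<Oplus>k\<in>T. g k \<otimes> y k)"
    and z: "z \<in> subsets_of_card T 1 \<rightarrow> carrier M"
    and cycle: "koszul_diff M T y z {} = \<zero>\<^bsub>M\<^esub>"
  obtains w where "w \<in> subsets_of_card T 2 \<rightarrow> carrier M"
    and "\<And>B. B \<in> subsets_of_card T 1 \<Longrightarrow>
      (\<Otimes>l\<in>{0..d}. e l) \<odot>\<^bsub>M\<^esub> z B = koszul_diff M T y w B"
proof -
  interpret K: koszul R M T y
    using module_axioms T y by (simp add: koszul_def koszul_axioms_def)
  interpret em: linear_map R M "C 0" embed by (rule embed_linear)
  have e0: "{} \<in> subsets_of_card T 0" by (simp add: subsets_of_card_def)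
  have "koszul_diff (C 0) T y (\<lambda>B. embed (z B)) {} = \<zero>\<^bsub>C 0\<^esub>"
    using K.koszul_diff_linear[OF embed_linear e0, of z] z by (simp add: cycle)
  moreover have "(\<lambda>B. embed (z B)) \<in> subsets_of_card T 1 \<rightarrow> carrier (C 0)" using z by auto
  ultimately obtain w where w: "w \<in> subsets_of_card T 2 \<rightarrow> carrier (C 0)"
    and dw: "\<And>B. B \<in> subsets_of_card T 1 \<Longrightarrow>
      (\<Otimes>l\<in>{0..d}. e l) \<odot>\<^bsub>C 0\<^esub> embed (z B) = koszul_diff (C 0) T y w B"
    using product_kills_koszul_homology[OF T y ann_kills_cohomology[OF e]
        cech_koszul_acyclic[OF T(1) y powers]] by metis
  define v where "v B = inv_into (carrier M) embed (w B)" for B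
  have v: "v B \<in> carrier M" "embed (v B) = w B" if "B \<in> subsets_of_card T 2" for B
    using that w embed_surj by (auto simp: v_def intro!: inv_into_into f_inv_into_f)
  have v_cl: "v \<in> subsets_of_card T 2 \<rightarrow> carrier M" using v by auto
  have eR: "(\<Otimes>l\<in>{0..d}. e l) \<in> carrier R"
    using e by (intro R.finprod_closed) (auto simp: ann_def)
  have "(\<Otimes>l\<in>{0..d}. e l) \<odot>\<^bsub>M\<^esub> z B = koszul_diff M T y v B" if B: "B \<in> subsets_of_card T 1" for B
  proof -
    interpret K0: koszul R "C 0" T y
      using cech_module T y by (simp add: koszul_def koszul_axioms_def)
    have v': "v \<in> subsets_of_card T (Suc 1) \<rightarrow> carrier M" using v_cl by (simp add: numeral_2_eq_2)
    have w': "w \<in> subsets_of_card T (Suc 1) \<rightarrow> carrier (C 0)" using w by (simp add: numeral_2_eq_2)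
    have zB: "z B \<in> carrier M" using z B by auto
    have "embed ((\<Otimes>l\<in>{0..d}. e l) \<odot>\<^bsub>M\<^esub> z B) = koszul_diff (C 0) T y w B"
      using dw[OF B] em.map_smult[OF eR zB] by simp
    also have "\<dots> = koszul_diff (C 0) T y (\<lambda>D. embed (v D)) B"
      using v by (intro K0.koszul_diff_cong[OF B w']) (simp add: numeral_2_eq_2)
    also have "\<dots> = embed (koszul_diff M T y v B)"
      using K.koszul_diff_linear[OF embed_linear B v'] by simp
    finally show ?thesis
      using embed_inj K.koszul_diff_closed[OF B v'] eR zB by (auto dest: inj_onD)
  qed
  then show thesis using that v_cl by blast
qed

end

section \<open>Ideals and radicals\<close>

context cring
begin

lemma finsum_mem_ideal:
  assumes "ideal J R" "finite A" "\<And>k. k \<in> A \<Longrightarrow> f k \<in> J"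
  shows "finsum R f A \<in> J"
proof -
  interpret ideal J R by fact
  show ?thesis
    using assms(2,3)
    by (induction A rule: finite_induct) (auto simp: a_Hcarr Pi_def)
qed

lemma genideal_image_memE:
  assumes T: "finite T" and y: "y \<in> T \<rightarrow> carrier R" and r: "r \<in> genideal R (y ` T)"
  obtains b where "b \<in> T \<rightarrow> carrier R" "r = (\<Oplus>k\<in>T. b k \<otimes> y k)"
proof -
  define J where "J = {\<Oplus>k\<in>T. b k \<otimes> y k | b. b \<in> T \<rightarrow> carrier R}"
  have yc: "y k \<in> carrier R" if "k \<in> T" for k using y that by auto
  have bc: "b k \<in> carrier R" if "b \<in> T \<rightarrow> carrier R" "k \<in> T" for b k using that by auto
  have "ideal J R"
  proof (intro idealI ring_axioms)
    show "subgroup J (add_monoid R)"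
    proof (rule add.subgroupI)
      show "J \<subseteq> carrier R" using yc by (auto simp: J_def Pi_def intro!: finsum_closed)
      show "J \<noteq> {}" by (auto simp: J_def)
    next
      fix r assume "r \<in> J"
      then obtain b where b: "b \<in> T \<rightarrow> carrier R" "r = (\<Oplus>k\<in>T. b k \<otimes> y k)" by (auto simp: J_def)
      have "(\<Oplus>k\<in>T. b k \<otimes> y k) \<oplus> (\<Oplus>k\<in>T. (\<ominus> b k) \<otimes> y k) = (\<Oplus>k\<in>T. b k \<otimes> y k \<oplus> (\<ominus> b k) \<otimes> y k)"
        using b yc by (intro finsum_addf[symmetric]) auto
      also have "\<dots> = \<zero>"
        using bc[OF b(1)] yc by (intro add.finprod_one_eqI) (auto simp: l_minus r_neg)
      finally have "\<ominus> r = (\<Oplus>k\<in>T. (\<ominus> b k) \<otimes> y k)"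
        using b yc by (intro minus_equality) (auto simp: a_comm Pi_def)
      then show "\<ominus> r \<in> J" unfolding J_def using b by (intro CollectI exI[of _ "\<lambda>k. \<ominus> b k"]) auto
    next
      fix r r' assume "r \<in> J" "r' \<in> J"
      then obtain b b' where b: "b \<in> T \<rightarrow> carrier R" "r = (\<Oplus>k\<in>T. b k \<otimes> y k)"
        and b': "b' \<in> T \<rightarrow> carrier R" "r' = (\<Oplus>k\<in>T. b' k \<otimes> y k)" by (auto simp: J_def)
      have "r \<oplus> r' = (\<Oplus>k\<in>T. b k \<otimes> y k \<oplus> b' k \<otimes> y k)"
        unfolding b b' using b(1) b'(1) yc by (intro finsum_addf[symmetric]) auto
      also have "\<dots> = (\<Oplus>k\<in>T. (b k \<oplus> b' k) \<otimes> y k)"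
        using bc[OF b(1)] bc[OF b'(1)] yc by (intro finsum_cong') (auto simp: l_distr)
      finally show "r \<oplus> r' \<in> J"
        unfolding J_def using b b' by (intro CollectI exI[of _ "\<lambda>k. b k \<oplus> b' k"]) auto
    qed
  next
    fix r a assume "r \<in> J" and a: "a \<in> carrier R"
    then obtain b where b: "b \<in> T \<rightarrow> carrier R" "r = (\<Oplus>k\<in>T. b k \<otimes> y k)" by (auto simp: J_def)
    have "a \<otimes> r = (\<Oplus>k\<in>T. a \<otimes> (b k \<otimes> y k))"
      unfolding b using T a b(1) yc by (intro finsum_rdistr) auto
    also have "\<dots> = (\<Oplus>k\<in>T. (a \<otimes> b k) \<otimes> y k)"
      using bc[OF b(1)] a yc by (intro finsum_cong') (auto simp: m_assoc)
    finally show "a \<otimes> r \<in> J"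
      unfolding J_def using a b by (intro CollectI exI[of _ "\<lambda>k. a \<otimes> b k"]) auto
    moreover have "r \<in> carrier R" using b yc by (auto simp: Pi_def intro!: finsum_closed)
    ultimately show "r \<otimes> a \<in> J" using a by (simp add: m_comm)
  qed
  moreover have "y ` T \<subseteq> J"
  proof
    fix r assume "r \<in> y ` T"
    then obtain l where l: "l \<in> T" "r = y l" by auto
    have "(\<Oplus>k\<in>T. (if k = l then \<one> else \<zero>) \<otimes> y k) = (\<Oplus>k\<in>T. if l = k then y k else \<zero>)"
      using yc by (intro finsum_cong') auto
    also have "\<dots> = r" using l T y by (subst finsum_singleton) auto
    finally show "r \<in> J"
      unfolding J_def by (intro CollectI exI[of _ "\<lambda>k. if k = l then \<one> else \<zero>"]) auto
  qed
  ultimately have "genideal R (y ` T) \<subseteq> J" by (rule genideal_minimal)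
  then show thesis using r that by (auto simp: J_def)
qed

lemma mem_radicalI: "r \<in> carrier R \<Longrightarrow> r [^] (n::nat) \<in> J \<Longrightarrow> r \<in> radical R J"
  by (auto simp: radical_def)

lemma radical_superset: "J \<subseteq> carrier R \<Longrightarrow> J \<subseteq> radical R J"
  by (auto intro!: mem_radicalI[of _ 1])

lemma radical_idem: "radical R (radical R J) = radical R J"
proof
  show "radical R (radical R J) \<subseteq> radical R J"
    by (auto simp: radical_def nat_pow_pow)
  show "radical R J \<subseteq> radical R (radical R J)"
    by (intro radical_superset) (auto simp: radical_def)
qed

text \<open>
  Binomial expansion in disguise: splitting off one factor \<open>a \<oplus> b\<close> and absorbing \<open>a\<close> or \<open>b\<close> into the
  multiplier \<open>c\<close> lowers one of the exponents, so the claim follows by induction on \<open>n + m\<close>.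
\<close>

lemma sum_power_mem_ideal:
  assumes J: "ideal J R" and ab: "a \<in> carrier R" "b \<in> carrier R" and "c \<in> carrier R"
    and "c \<otimes> a [^] (n::nat) \<in> J" "c \<otimes> b [^] (m::nat) \<in> J"
  shows "c \<otimes> (a \<oplus> b) [^] (n + m) \<in> J"
  using assms(4-)
proof (induction "n + m" arbitrary: n m c)
  case 0
  then show ?case by simp
next
  case (Suc l)
  interpret ideal J R by fact
  show ?case
  proof (cases "n = 0 \<or> m = 0")
    case True
    then have "c \<in> J" using Suc.prems by auto
    then show ?thesis using ab by (intro I_r_closed) auto
  next
    case False
    then obtain n' m' where nm: "n = Suc n'" "m = Suc m'" by (metis not0_implies_Suc)
    have "(c \<otimes> a) \<otimes> (a \<oplus> b) [^] (n' + m) \<in> J"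
    proof (rule Suc.hyps(1))
      have "(c \<otimes> a) \<otimes> a [^] n' = c \<otimes> a [^] n"
        using Suc.prems(1) ab by (simp add: nm m_assoc nat_pow_Suc2[symmetric] del: nat_pow_Suc)
      then show "(c \<otimes> a) \<otimes> a [^] n' \<in> J" using Suc.prems by simp
      have "(c \<otimes> a) \<otimes> b [^] m = a \<otimes> (c \<otimes> b [^] m)" using Suc.prems(1) ab by (simp add: m_ac)
      then show "(c \<otimes> a) \<otimes> b [^] m \<in> J" using Suc.prems ab by (simp add: I_l_closed)
    qed (use Suc nm ab in auto)
    moreover have "(c \<otimes> b) \<otimes> (a \<oplus> b) [^] (n + m') \<in> J"
    proof (rule Suc.hyps(1))
      have "(c \<otimes> b) \<otimes> b [^] m' = c \<otimes> b [^] m"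
        using Suc.prems(1) ab by (simp add: nm m_assoc nat_pow_Suc2[symmetric] del: nat_pow_Suc)
      then show "(c \<otimes> b) \<otimes> b [^] m' \<in> J" using Suc.prems by simp
      have "(c \<otimes> b) \<otimes> a [^] n = b \<otimes> (c \<otimes> a [^] n)" using Suc.prems(1) ab by (simp add: m_ac)
      then show "(c \<otimes> b) \<otimes> a [^] n \<in> J" using Suc.prems ab by (simp add: I_l_closed)
    qed (use Suc nm ab in auto)
    ultimately have "(c \<otimes> a) \<otimes> (a \<oplus> b) [^] l \<oplus> (c \<otimes> b) \<otimes> (a \<oplus> b) [^] l \<in> J"
      using Suc.hyps(2) nm by (auto intro: a_closed)
    moreover have "c \<otimes> (a \<oplus> b) [^] Suc l = (c \<otimes> a) \<otimes> (a \<oplus> b) [^] l \<oplus> (c \<otimes> b) \<otimes> (a \<oplus> b) [^] l"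
    proof -
      have "c \<otimes> (P \<otimes> (a \<oplus> b)) = (c \<otimes> a) \<otimes> P \<oplus> (c \<otimes> b) \<otimes> P" if "P \<in> carrier R" for P
        using that Suc.prems(1) ab by (simp add: r_distr m_ac)
      then show ?thesis using ab by simp
    qed
    ultimately show ?thesis using Suc.hyps(2) by simp
  qed
qed

lemma radical_ideal:
  assumes J: "ideal J R"
  shows "ideal (radical R J) R"
proof -
  interpret J: ideal J R by fact
  have mult: "a \<otimes> r \<in> radical R J" if "r \<in> radical R J" "a \<in> carrier R" for a r
  proof -
    obtain n :: nat where n: "r \<in> carrier R" "r [^] n \<in> J" using \<open>r \<in> radical R J\<close> by (auto simp: radical_def)
    then have "(a \<otimes> r) [^] n \<in> J" using \<open>a \<in> carrier R\<close> by (simp add: nat_pow_distrib J.I_l_closed)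
    then show ?thesis using n \<open>a \<in> carrier R\<close> by (intro mem_radicalI) auto
  qed
  show ?thesis
  proof (intro idealI ring_axioms)
    show "subgroup (radical R J) (add_monoid R)"
    proof (rule add.subgroupI)
      show "radical R J \<subseteq> carrier R" by (auto simp: radical_def)
      show "radical R J \<noteq> {}" 
      proof -
        have "\<zero> \<in> J" by simp
        then show ?thesis using radical_superset[OF J.a_subset] by blast
      qed
      fix r assume r: "r \<in> radical R J"
      then have "\<ominus> r = (\<ominus> \<one>) \<otimes> r" by (auto simp: radical_def l_minus)
      then show "\<ominus> r \<in> radical R J" using mult[OF r, of "\<ominus> \<one>"] by simp
      fix r' assume "r' \<in> radical R J"
      with r obtain n m :: nat where c: "r \<in> carrier R" "r [^] n \<in> J" "r' \<in> carrier R" "r' [^] m \<in> J"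
        by (auto simp: radical_def)
      then have "\<one> \<otimes> (r \<oplus> r') [^] (n + m) \<in> J" by (intro sum_power_mem_ideal J) auto
      then show "r \<oplus> r' \<in> radical R J" using c by (auto intro!: mem_radicalI)
    qed
    fix r a assume "r \<in> radical R J" "a \<in> carrier R"
    then show "a \<otimes> r \<in> radical R J" "r \<otimes> a \<in> radical R J"
      using mult[of r a] by (auto simp: m_comm radical_def)
  qed
qed

lemma self_module_module: "module R (self_module R)"
proof (rule moduleI)
  show "abelian_group (self_module R)"
    by (rule abelian_groupI) (auto simp: self_module_def a_ac intro: l_neg intro!: bexI[of _ "\<ominus> _"])
qed (auto simp: self_module_def l_distr r_distr m_assoc cring_axioms)

end

lemma self_module_finsum: "finsum (self_module R) f A = finsum R f A"
  by (simp add: finsum_def finprod_def self_module_def)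

lemma self_module_minus: "\<ominus>\<^bsub>self_module R\<^esub> v = \<ominus>\<^bsub>R\<^esub> v"
  by (simp add: a_inv_def m_inv_def self_module_def)

lemma self_module_simps [simp]:
  "carrier (self_module R) = carrier R" "\<zero>\<^bsub>self_module R\<^esub> = \<zero>\<^bsub>R\<^esub>"
  "v \<oplus>\<^bsub>self_module R\<^esub> w = v \<oplus>\<^bsub>R\<^esub> w" "r \<odot>\<^bsub>self_module R\<^esub> v = r \<otimes>\<^bsub>R\<^esub> v"
  by (simp_all add: self_module_def)

section \<open>Colon ideals\<close>

lemma (in cring) colon_quot_annI:
  assumes J: "ideal J R" and x: "x \<in> carrier R" and q: "q \<in> carrier R"
    and kill: "\<And>a. a \<in> colon R J x \<Longrightarrow> q \<otimes> a \<in> J"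
  shows "q \<in> ann R (colon_quot R J x)"
proof -
  interpret J: ideal J R by fact
  have coset: "J +>\<^bsub>(self_module R)\<lparr>carrier := colon R J x\<rparr>\<^esub> v = (\<lambda>n. n \<oplus> v) ` J" for v
    by (auto simp: a_r_coset_def r_coset_def)
  have "q \<odot>\<^bsub>colon_quot R J x\<^esub> X = J" if X: "X \<in> carrier (colon_quot R J x)" for X
  proof -
    obtain a where a: "a \<in> colon R J x" and Xa: "X = (\<lambda>n. n \<oplus> a) ` J"
      using X by (auto simp: colon_quot_def quot_module_def A_RCOSETS_def RCOSETS_def r_coset_def)
    have aR: "a \<in> carrier R" using a by (simp add: colon_def)
    have "(\<lambda>n. n \<oplus> q \<otimes> m) ` J = J" if "m \<in> X" for m
    proof -
      obtain n where n: "n \<in> J" "m = n \<oplus> a" using \<open>m \<in> X\<close> Xa by auto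
      have "q \<otimes> m = q \<otimes> n \<oplus> q \<otimes> a" using n q aR J.a_Hcarr by (simp add: r_distr)
      then have "q \<otimes> m \<in> J" using kill[OF a] n q by (auto intro!: J.a_closed J.I_l_closed)
      then have "J +> q \<otimes> m = J" by (rule J.a_rcos_const)
      then show ?thesis by (auto simp: a_r_coset_def r_coset_def)
    qed
    moreover have "q \<odot>\<^bsub>colon_quot R J x\<^esub> X = (\<Union>m\<in>X. (\<lambda>n. n \<oplus> q \<otimes> m) ` J)"
      by (simp add: colon_quot_def quot_module_def coset)
    moreover have "X \<noteq> {}" 
    proof -
      have "\<zero> \<in> J" by simp
      then show ?thesis unfolding Xa by blast
    qed
    ultimately show ?thesis by simp
  qed
  then show ?thesis using q by (simp add: ann_def colon_quot_def quot_module_def)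
qed

section \<open>Graded rings\<close>

text \<open>
  The map \<open>pr n\<close> stands for the projection to the homogeneous part \<open>gr n\<close>. The axioms are what the
  comparison of degrees in a sum of multiples of homogeneous elements requires: a multiplication by
  such an element shifts the components, and every element is the finite sum of its components.
\<close>

locale graded_cring = cring R for R (structure) +
  fixes gr :: "nat \<Rightarrow> 'a set" and pr :: "nat \<Rightarrow> 'a \<Rightarrow> 'a"
  assumes gr_carrier: "gr n \<subseteq> carrier R"
    and pr_closed: "c \<in> carrier R \<Longrightarrow> pr n c \<in> carrier R"
    and pr_add: "b \<in> carrier R \<Longrightarrow> c \<in> carrier R \<Longrightarrow> pr n (b \<oplus> c) = pr n b \<oplus> pr n c"
    and pr_mult: "c \<in> carrier R \<Longrightarrow> x \<in> gr m \<Longrightarrow>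
      pr n (c \<otimes> x) = (if m \<le> n then pr (n - m) c \<otimes> x else \<zero>)"
    and pr_sum: "c \<in> carrier R \<Longrightarrow> \<exists>N. c = (\<Oplus>n\<in>{..<N}. pr n c)"
begin

lemma pr_zero: "pr n \<zero> = \<zero>"
  using pr_add[of \<zero> \<zero> n] pr_closed[of \<zero> n] by (simp add: add.l_cancel_one)

lemma pr_finsum:
  assumes "finite A" "f \<in> A \<rightarrow> carrier R"
  shows "pr n (finsum R f A) = (\<Oplus>k\<in>A. pr n (f k))"
  using assms
proof (induction A rule: finite_induct)
  case (insert a A)
  then have "f k \<in> carrier R" if "k \<in> insert a A" for k using that by auto
  then show ?case using insert by (simp add: pr_add pr_closed Pi_def)
qed (simp add: pr_zero)

lemma pr_mult_power:
  assumes "c \<in> carrier R" "x \<in> gr m" "m \<ge> 1" "n < s"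
  shows "pr n (c \<otimes> x [^] s) = \<zero>"
  using assms(4)
proof (induction s arbitrary: n)
  case (Suc s)
  have x: "x \<in> carrier R" using assms(2) gr_carrier by auto
  have "pr n (c \<otimes> x [^] Suc s) = pr n ((c \<otimes> x [^] s) \<otimes> x)" using assms(1) x by (simp add: m_assoc)
  also have "\<dots> = (if m \<le> n then pr (n - m) (c \<otimes> x [^] s) \<otimes> x else \<zero>)"
    using assms(1,2) x by (intro pr_mult) auto
  also have "\<dots> = \<zero>"
    using Suc.IH[of "n - m"] Suc.prems assms(3) x by (auto simp: less_Suc_eq_le)
  finally show ?case .
qed simp

text \<open>
  A form of Krull's intersection theorem. The components of \<open>r\<close> live in degrees below some \<open>N\<close>, whereas
  the \<open>N\<close>-th power of an element of positive degree contributes only to degrees at least \<open>N\<close>. Taking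
  \<open>s = N\<close> and comparing components therefore leaves only multiples of the \<open>x k\<close> with \<open>k \<in> P\<close>.
\<close>

lemma mem_ideal_of_power_approximation:
  assumes T: "finite T" "P \<subseteq> T"
    and x: "\<And>k. k \<in> T \<Longrightarrow> \<exists>m\<ge>1. x k \<in> gr m"
    and r: "r \<in> carrier R"
    and approx: "\<And>s. \<exists>c\<in>T \<rightarrow> carrier R. r = (\<Oplus>k\<in>T. c k \<otimes> (if k \<in> P then x k else x k [^] (s::nat)))"
  shows "r \<in> genideal R (x ` P)"
proof -
  have xR: "x k \<in> carrier R" if "k \<in> T" for k using x[OF that] gr_carrier by auto
  then have sub: "x ` P \<subseteq> carrier R" using T by auto
  interpret J: ideal "genideal R (x ` P)" R by (rule genideal_ideal[OF sub])
  obtain N where N: "r = (\<Oplus>n\<in>{..<N}. pr n r)" using pr_sum[OF r] by auto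
  obtain c where c: "c \<in> T \<rightarrow> carrier R"
    and rc: "r = (\<Oplus>k\<in>T. c k \<otimes> (if k \<in> P then x k else x k [^] N))" using approx[of N] by auto
  have "pr n r \<in> genideal R (x ` P)" if n: "n < N" for n
  proof -
    have "pr n r = (\<Oplus>k\<in>T. pr n (c k \<otimes> (if k \<in> P then x k else x k [^] N)))"
      unfolding rc using c xR T(1) by (intro pr_finsum) auto
    also have "\<dots> \<in> genideal R (x ` P)"
    proof (intro finsum_mem_ideal J.ideal_axioms T(1))
      fix k assume k: "k \<in> T"
      then obtain m where m: "m \<ge> 1" "x k \<in> gr m" using x by auto
      have ck: "c k \<in> carrier R" using c k by auto
      show "pr n (c k \<otimes> (if k \<in> P then x k else x k [^] N)) \<in> genideal R (x ` P)"
      proof (cases "k \<in> P")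
        case True
        then have "x k \<in> genideal R (x ` P)" using genideal_self[OF sub] by auto
        then show ?thesis
          using True pr_mult[OF ck m(2)] pr_closed[OF ck] by (auto intro!: J.I_l_closed)
      next
        case False
        then show ?thesis using pr_mult_power[OF ck m(2,1) n] by simp
      qed
    qed
    finally show ?thesis .
  qed
  then show ?thesis by (subst N) (auto intro!: finsum_mem_ideal J.ideal_axioms)
qed

text \<open>
  Writing \<open>a \<otimes> x t = \<Oplus> b k \<otimes> x k\<close> makes the vector with entry \<open>a\<close> at \<open>t\<close>, \<open>\<ominus> b k\<close> at \<open>k < t\<close> and
  \<open>0\<close> beyond a Koszul cycle for the sequence \<open>y\<close> in which the \<open>x k\<close> with \<open>k > t\<close> are replaced by powers.
  The sequence \<open>y\<close> generates the same ideal as \<open>x\<close> up to radical, so the product of the annihilators makes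
  this cycle a boundary, and the coefficient at \<open>t\<close> of a boundary only involves the \<open>y k\<close> with \<open>k \<noteq> t\<close>.
\<close>

lemma colon_mult_approximation:
  assumes e: "\<And>j. j \<le> d \<Longrightarrow> e j \<in> ann R (cech_cohomology R (self_module R) fs j)"
    and fs: "set fs \<subseteq> carrier R"
    and x: "x \<in> {1..Suc d} \<rightarrow> carrier R"
    and rad: "set fs \<subseteq> radical R (genideal R (x ` {1..Suc d}))"
    and t: "t \<in> {1..Suc d}"
    and a: "a \<in> colon R (genideal R (x ` {1..<t})) (x t)"
  shows "\<exists>c\<in>{1..Suc d} - {t} \<rightarrow> carrier R. (\<Otimes>j\<in>{0..d}. e j) \<otimes> a
    = (\<Oplus>k\<in>{1..Suc d} - {t}. c k \<otimes> (if k \<in> {1..<t} then x k else x k [^] (s::nat)))"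
proof -
  define T where "T = {1..Suc d}"
  \<comment> \<open>At \<open>t\<close> the exponent stays one, because the cycle comes from a relation with \<open>x t\<close> itself.\<close>
  define y where "y k = (if k \<in> {1..t} then x k else x k [^] s)" for k
  have T: "finite T" "card T = Suc d" by (auto simp: T_def)
  have xR: "x k \<in> carrier R" if "k \<in> T" for k using x that by (auto simp: T_def)
  have yR: "y k \<in> carrier R" if "k \<in> T" for k using xR[OF that] by (simp add: y_def)
  then have y: "y \<in> T \<rightarrow> carrier R" by auto
  have aR: "a \<in> carrier R" using a by (simp add: colon_def)
  have tT: "t \<in> T" using t by (simp add: T_def)
  have yT: "y ` T \<subseteq> carrier R" using y by auto
  have powers: "\<exists>n::nat. \<exists>g\<in>T \<rightarrow> carrier R. f [^] n = (\<Oplus>k\<in>T. g k \<otimes> y k)" if f: "f \<in> set fs" for f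
  proof -
    note Jy = genideal_ideal[OF yT]
    have "x k \<in> radical R (genideal R (y ` T))" if k: "k \<in> T" for k
    proof -
      have "y k \<in> genideal R (y ` T)" using genideal_self[OF yT] k by auto
      then show ?thesis
        using mem_radicalI[of "x k" 1] mem_radicalI[of "x k" s] xR[OF k] by (auto simp: y_def split: if_splits)
    qed
    then have "genideal R (x ` T) \<subseteq> radical R (genideal R (y ` T))"
      by (intro genideal_minimal radical_ideal Jy) auto
    then have "radical R (genideal R (x ` T)) \<subseteq> radical R (radical R (genideal R (y ` T)))"
      by (auto simp: radical_def)
    then have "f \<in> radical R (genideal R (y ` T))"
      using rad f by (auto simp: radical_idem T_def)
    then obtain n :: nat where "f [^] n \<in> genideal R (y ` T)" by (auto simp: radical_def)
    then show ?thesis by (elim genideal_image_memE[OF T(1) y]) blast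
  qed
  have P: "{1..<t} \<subseteq> T" using t by (auto simp: T_def)
  have "a \<otimes> x t \<in> genideal R (x ` {1..<t})" using a by (simp add: colon_def)
  then obtain b where b: "b \<in> {1..<t} \<rightarrow> carrier R" and ab: "a \<otimes> x t = (\<Oplus>k\<in>{1..<t}. b k \<otimes> x k)"
    using xR P by (elim genideal_image_memE[rotated 2]) auto
  have bR: "b k \<in> carrier R" if "1 \<le> k" "k < t" for k using b that by auto
  define \<zeta> where "\<zeta> k = (if k = t then a else if k \<in> {1..<t} then \<ominus> b k else \<zero>)" for k
  have \<zeta>: "\<zeta> k \<in> carrier R" for k using aR b by (auto simp: \<zeta>_def)
  \<comment> \<open>Chains of degree one are indexed by singletons.\<close>
  define z where "z B = \<zeta> (the_elem B)" for B
  interpret M: module R "self_module R" by (rule self_module_module)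
  interpret cech R "self_module R" fs using fs by unfold_locales
  have "koszul_diff (self_module R) T y z {} = (\<Oplus>k\<in>T. y k \<otimes> \<zeta> k)"
    by (simp add: koszul_diff_def z_def num_below_def signed_def self_module_finsum)
  also have "\<dots> = y t \<otimes> \<zeta> t \<oplus> (\<Oplus>k\<in>T - {t}. y k \<otimes> \<zeta> k)"
    using yR \<zeta> by (intro finsum_remove T tT) auto
  also have "(\<Oplus>k\<in>T - {t}. y k \<otimes> \<zeta> k) = (\<Oplus>k\<in>{1..<t}. x k \<otimes> (\<ominus> b k))"
    using T P yR xR \<zeta> b by (intro add.finprod_mono_neutral_cong_right) (auto simp: \<zeta>_def y_def)
  also have "y t \<otimes> \<zeta> t = (\<Oplus>k\<in>{1..<t}. b k \<otimes> x k)"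
    using ab aR xR[OF tT] t by (simp add: y_def \<zeta>_def m_comm)
  also have "(\<Oplus>k\<in>{1..<t}. b k \<otimes> x k) \<oplus> (\<Oplus>k\<in>{1..<t}. x k \<otimes> (\<ominus> b k))
      = (\<Oplus>k\<in>{1..<t}. b k \<otimes> x k \<oplus> x k \<otimes> (\<ominus> b k))"
    using bR xR P by (intro finsum_addf[symmetric]) (auto simp: subset_iff)
  also have "\<dots> = \<zero>"
  proof (intro add.finprod_one_eqI)
    fix k assume "k \<in> {1..<t}"
    then have "b k \<in> carrier R" "x k \<in> carrier R" using b xR P by auto
    then show "b k \<otimes> x k \<oplus> x k \<otimes> (\<ominus> b k) = \<zero>" by (simp add: r_minus m_comm r_neg)
  qed
  finally have cycle: "koszul_diff (self_module R) T y z {} = \<zero>\<^bsub>self_module R\<^esub>" by simp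
  have "z \<in> subsets_of_card T 1 \<rightarrow> carrier (self_module R)" using \<zeta> by (simp add: z_def)
  from annihilators_kill_koszul_cycles[OF T y e powers this cycle]
  obtain w where w: "w \<in> subsets_of_card T 2 \<rightarrow> carrier (self_module R)"
    and dw: "\<And>B. B \<in> subsets_of_card T 1 \<Longrightarrow>
      (\<Otimes>l\<in>{0..d}. e l) \<odot>\<^bsub>self_module R\<^esub> z B = koszul_diff (self_module R) T y w B" by blast
  define c where "c k = signed R (num_below {t} k) (w (insert k {t}))" for k
  have wk: "w (insert k {t}) \<in> carrier R" if "k \<in> T - {t}" for k
  proof -
    have "insert k {t} \<in> subsets_of_card T 2" using that tT by (auto simp: subsets_of_card_def)
    then show ?thesis using w by auto
  qed
  have "{t} \<in> subsets_of_card T 1" using tT by (simp add: subsets_of_card_def)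
  from dw[OF this] have "(\<Otimes>l\<in>{0..d}. e l) \<otimes> a
      = (\<Oplus>k\<in>T - {t}. signed (self_module R) (num_below {t} k) (y k \<otimes> w (insert k {t})))"
    by (simp add: z_def \<zeta>_def koszul_diff_def self_module_finsum)
  also have "\<dots> = (\<Oplus>k\<in>T - {t}. c k \<otimes> (if k \<in> {1..<t} then x k else x k [^] s))"
  proof (intro finsum_cong')
    fix k assume k: "k \<in> T - {t}"
    then have "(if k \<in> {1..<t} then x k else x k [^] s) = y k" by (auto simp: y_def T_def)
    then show "signed (self_module R) (num_below {t} k) (y k \<otimes> w (insert k {t}))
        = c k \<otimes> (if k \<in> {1..<t} then x k else x k [^] s)"
      using wk[OF k] yR[of k] k by (simp add: c_def signed_def self_module_minus r_minus m_comm)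
  qed (use wk xR in \<open>auto simp: c_def\<close>)
  finally show ?thesis using wk unfolding T_def by (intro bexI[of _ c]) (auto simp: c_def T_def)
qed

text \<open>
  The sequence chosen in the definition of local cohomology generates \<open>I\<close> up to radical, as the parameters
  \<open>x\<close> themselves show that such a sequence exists. Letting the exponent in the approximation grow then
  gives membership in the ideal generated by \<open>x 1, \<dots>, x (t - 1)\<close>.
\<close>

theorem annihilator_of_colon_quotients:
  assumes x: "\<And>i. i \<in> {1..d} \<Longrightarrow> \<exists>n\<ge>1. x i \<in> gr n"
    and rad: "radical R (genideal R (x ` {1..d})) = I"
    and e: "\<And>j. j < d \<Longrightarrow> e j \<in> ann R (local_cohomology R I (self_module R) j)"
    and t: "t \<in> {1..d}"
  shows "(\<Otimes>j\<in>{0..d - 1}. e j) \<in> ann R (colon_quot R (genideal R (x ` {1..<t})) (x t))"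
proof -
  obtain d' where d: "d = Suc d'" using t by (cases d) auto
  have xR: "x i \<in> carrier R" if "i \<in> {1..d}" for i using x[OF that] gr_carrier by auto
  define good where "good = (\<lambda>fs. set fs \<subseteq> carrier R \<and> radical R (genideal R (set fs)) = radical R I)"
  define fs where "fs = (SOME fs. good fs)"
  have I: "radical R I = I" using radical_idem rad by metis
  have "good (map x [1..<Suc d])"
  proof -
    have "set (map x [1..<Suc d]) = x ` {1..d}" by (auto simp: atLeastLessThanSuc_atLeastAtMost)
    then show ?thesis using xR rad I by (auto simp: good_def)
  qed
  then have "good fs" unfolding fs_def by (rule someI)
  then have fs: "set fs \<subseteq> carrier R" "radical R (genideal R (set fs)) = radical R I"
    by (auto simp: good_def)
  have e': "e j \<in> ann R (cech_cohomology R (self_module R) fs j)" if "j \<le> d'" for j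
    using e[of j] that unfolding d by (simp add: local_cohomology_def fs_def good_def)
  have "set fs \<subseteq> radical R (genideal R (set fs))"
    using genideal_self[OF fs(1)] radical_superset ideal.Icarr[OF genideal_ideal[OF fs(1)]] by blast
  then have rad': "set fs \<subseteq> radical R (genideal R (x ` {1..Suc d'}))"
    using fs(2) I rad d by simp
  have eR: "(\<Otimes>j\<in>{0..d'}. e j) \<in> carrier R"
    using e' by (intro finprod_closed) (auto simp: ann_def)
  have sub: "x ` {1..<t} \<subseteq> carrier R" using xR t by auto
  have "(\<Otimes>j\<in>{0..d'}. e j) \<otimes> a \<in> genideal R (x ` {1..<t})"
    if a: "a \<in> colon R (genideal R (x ` {1..<t})) (x t)" for a
  proof (rule mem_ideal_of_power_approximation)
    show "{1..<t} \<subseteq> {1..d} - {t}" using t by auto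
    show "\<exists>m\<ge>1. x k \<in> gr m" if "k \<in> {1..d} - {t}" for k using x that by auto
    show "(\<Otimes>j\<in>{0..d'}. e j) \<otimes> a \<in> carrier R" using eR a by (auto simp: colon_def)
    fix s :: nat
    show "\<exists>c\<in>{1..d} - {t} \<rightarrow> carrier R. (\<Otimes>j\<in>{0..d'}. e j) \<otimes> a
      = (\<Oplus>k\<in>{1..d} - {t}. c k \<otimes> (if k \<in> {1..<t} then x k else x k [^] s))"
      unfolding d using xR t by (intro colon_mult_approximation[OF e' fs(1) _ rad' _ a]) (auto simp: d)
  qed simp
  then show ?thesis
    unfolding d using xR t sub eR by (intro colon_quot_annI genideal_ideal) (auto simp: d)
qed

end

section \<open>Homogeneous components and substitutions of polynomials\<close>

lemma poly_mapping_expand: "f = (\<Sum>m\<in>Poly_Mapping.keys f. Poly_Mapping.single m (Poly_Mapping.lookup f m))"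
proof (rule poly_mapping_eqI)
  fix k
  have "Poly_Mapping.lookup (\<Sum>m\<in>Poly_Mapping.keys f. Poly_Mapping.single m (Poly_Mapping.lookup f m)) k
      = (\<Sum>m\<in>Poly_Mapping.keys f. if m = k then Poly_Mapping.lookup f m else 0)"
    unfolding lookup_sum by (intro sum.cong) (auto simp: lookup_single when_def)
  also have "\<dots> = Poly_Mapping.lookup f k"
    by (simp add: sum.delta in_keys_iff)
  finally show "Poly_Mapping.lookup f k
    = Poly_Mapping.lookup (\<Sum>m\<in>Poly_Mapping.keys f. Poly_Mapping.single m (Poly_Mapping.lookup f m)) k" ..
qed

lemma mon_degree_zero [simp]: "mon_degree 0 = 0"
  by (simp add: mon_degree_def)

lemma mon_degree_add: "mon_degree (m + m') = mon_degree m + mon_degree m'"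
  unfolding mon_degree_def by (rule setsum_keys_plus_distrib) auto

lemma mon_degree_single [simp]: "mon_degree (Poly_Mapping.single w k) = k"
  by (simp add: mon_degree_def)

lemma mon_degree_sum: "mon_degree (sum f A) = (\<Sum>a\<in>A. mon_degree (f a))"
  by (induction A rule: infinite_finite_induct) (simp_all add: mon_degree_add)

definition homog_component :: "nat \<Rightarrow> ('k::comm_ring_1, 'w) mpol \<Rightarrow> ('k, 'w) mpol" where
  "homog_component n f = Poly_Mapping.mapp (\<lambda>m c. if mon_degree m = n then c else 0) f"

lemma lookup_homog_component:
  "Poly_Mapping.lookup (homog_component n f) m = (if mon_degree m = n then Poly_Mapping.lookup f m else 0)"
  by (simp add: homog_component_def lookup_mapp when_def in_keys_iff)

lemma keys_homog_component: "Poly_Mapping.keys (homog_component n f) \<subseteq> Poly_Mapping.keys f"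
  by (simp add: homog_component_def keys_mapp_subset)

lemma homog_component_zero [simp]: "homog_component n 0 = 0"
  by (rule poly_mapping_eqI) (simp add: lookup_homog_component)

lemma homog_component_add: "homog_component n (f + g) = homog_component n f + homog_component n g"
  by (rule poly_mapping_eqI) (simp add: lookup_homog_component lookup_add)

lemma homog_component_minus: "homog_component n (f - g) = homog_component n f - homog_component n g"
  by (rule poly_mapping_eqI) (simp add: lookup_homog_component lookup_minus)

lemma homog_component_sum: "homog_component n (sum f A) = (\<Sum>a\<in>A. homog_component n (f a))"
  by (induction A rule: infinite_finite_induct) (simp_all add: homog_component_add)

lemma homog_component_single:
  "homog_component n (Poly_Mapping.single m c) = (if mon_degree m = n then Poly_Mapping.single m c else 0)"
  by (rule poly_mapping_eqI) (auto simp: lookup_homog_component lookup_single when_def)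

lemma homog_component_homogeneous:
  assumes "\<forall>m\<in>Poly_Mapping.keys f. mon_degree m = d"
  shows "homog_component n f = (if n = d then f else 0)"
  using assms by (intro poly_mapping_eqI) (auto simp: lookup_homog_component in_keys_iff)

lemma sum_homog_components:
  "\<exists>N. f = (\<Sum>n<N. homog_component n f)"
proof -
  define N where "N = Suc (\<Sum>m\<in>Poly_Mapping.keys f. mon_degree m)"
  have N: "mon_degree m < N" if "m \<in> Poly_Mapping.keys f" for m
    unfolding N_def using member_le_sum[OF that, of mon_degree] by simp
  have "f = (\<Sum>n<N. homog_component n f)"
  proof (rule poly_mapping_eqI)
    fix m
    have "Poly_Mapping.lookup (\<Sum>n<N. homog_component n f) m
        = (\<Sum>n<N. if n = mon_degree m then Poly_Mapping.lookup f m else 0)"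
      unfolding lookup_sum by (intro sum.cong) (auto simp: lookup_homog_component)
    also have "\<dots> = Poly_Mapping.lookup f m"
      using N[of m] by (auto simp: sum.delta in_keys_iff)
    finally show "Poly_Mapping.lookup f m = Poly_Mapping.lookup (\<Sum>n<N. homog_component n f) m" ..
  qed
  then show ?thesis by blast
qed

lemma mult_expand:
  "g * f = (\<Sum>a\<in>Poly_Mapping.keys g. \<Sum>b\<in>Poly_Mapping.keys f.
     Poly_Mapping.single (a + b) (Poly_Mapping.lookup g a * Poly_Mapping.lookup f b))"
  for f g :: "('k::comm_ring_1, 'w) mpol"
proof -
  have "g * f = (\<Sum>a\<in>Poly_Mapping.keys g. Poly_Mapping.single a (Poly_Mapping.lookup g a)) *
      (\<Sum>b\<in>Poly_Mapping.keys f. Poly_Mapping.single b (Poly_Mapping.lookup f b))"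
    using poly_mapping_expand[of g] poly_mapping_expand[of f] by simp
  then show ?thesis by (simp add: sum_product mult_single)
qed

text \<open>
  In a product of monomials the degrees add up, so with a homogeneous factor of degree \<open>d\<close> the component of
  degree \<open>n\<close> comes exactly from the component of degree \<open>n - d\<close> of the other factor.
\<close>

lemma homog_component_mult:
  assumes "\<forall>m\<in>Poly_Mapping.keys f. mon_degree m = d"
  shows "homog_component n (g * f) = (if d \<le> n then homog_component (n - d) g * f else 0)"
proof -
  have "homog_component n (g * f) = (\<Sum>a\<in>Poly_Mapping.keys g. \<Sum>b\<in>Poly_Mapping.keys f.
      if d \<le> n \<and> mon_degree a = n - d
      then Poly_Mapping.single (a + b) (Poly_Mapping.lookup g a * Poly_Mapping.lookup f b) else 0)"
    unfolding mult_expand[of g f] homog_component_sum homog_component_single mon_degree_add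
    using assms by (intro sum.cong refl if_cong) auto
  also have "\<dots> = (if d \<le> n then (\<Sum>a\<in>Poly_Mapping.keys g.
      if mon_degree a = n - d then Poly_Mapping.single a (Poly_Mapping.lookup g a) else 0)
      * (\<Sum>b\<in>Poly_Mapping.keys f. Poly_Mapping.single b (Poly_Mapping.lookup f b)) else 0)"
    by (auto simp: sum_product mult_single intro!: sum.cong)
  also have "(\<Sum>a\<in>Poly_Mapping.keys g.
      if mon_degree a = n - d then Poly_Mapping.single a (Poly_Mapping.lookup g a) else 0)
      = homog_component (n - d) g"
    by (subst (3) poly_mapping_expand[of g]) (simp add: homog_component_sum homog_component_single)
  finally show ?thesis using poly_mapping_expand[of f] by simp
qed

definition rename_monomial :: "('w \<Rightarrow> 'w) \<Rightarrow> ('w \<Rightarrow>\<^sub>0 nat) \<Rightarrow> ('w \<Rightarrow>\<^sub>0 nat)" where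
  "rename_monomial h m = (\<Sum>w\<in>Poly_Mapping.keys m. Poly_Mapping.single (h w) (Poly_Mapping.lookup m w))"

lemma mrename_eq: "mrename h f
  = (\<Sum>m\<in>Poly_Mapping.keys f. Poly_Mapping.single (rename_monomial h m) (Poly_Mapping.lookup f m))"
  by (simp add: mrename_def rename_monomial_def)

lemma rename_monomial_zero [simp]: "rename_monomial h 0 = 0"
  by (simp add: rename_monomial_def)

lemma rename_monomial_add: "rename_monomial h (m + m') = rename_monomial h m + rename_monomial h m'"
  unfolding rename_monomial_def by (rule setsum_keys_plus_distrib) (simp_all add: single_add)

lemma rename_monomial_sum: "rename_monomial h (sum f A) = (\<Sum>a\<in>A. rename_monomial h (f a))"
  by (induction A rule: infinite_finite_induct) (simp_all add: rename_monomial_add)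

lemma rename_monomial_single [simp]:
  "rename_monomial h (Poly_Mapping.single w k) = Poly_Mapping.single (h w) k"
  by (cases "k = 0") (simp_all add: rename_monomial_def)

lemma mon_degree_rename [simp]: "mon_degree (rename_monomial h m) = mon_degree m"
  by (simp add: rename_monomial_def mon_degree_sum) (simp add: mon_degree_def)

lemma mrename_zero [simp]: "mrename h 0 = 0"
  by (simp add: mrename_eq)

lemma mrename_add: "mrename h (f + g) = mrename h f + mrename h g"
  unfolding mrename_eq by (rule setsum_keys_plus_distrib) (simp_all add: single_add)

lemma mrename_uminus: "mrename h (- f) = - mrename h f"
  by (metis add_eq_0_iff mrename_add mrename_zero ab_left_minus)

lemma mrename_minus: "mrename h (f - g) = mrename h f - mrename h g"
  by (metis add_uminus_conv_diff mrename_add mrename_uminus)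

lemma mrename_sum: "mrename h (sum f A) = (\<Sum>a\<in>A. mrename h (f a))"
  by (induction A rule: infinite_finite_induct) (simp_all add: mrename_add)

lemma mrename_single [simp]:
  "mrename h (Poly_Mapping.single m c) = Poly_Mapping.single (rename_monomial h m) c"
  by (cases "c = 0") (simp_all add: mrename_eq)

lemma mrename_mvar [simp]: "mrename h (mvar w) = mvar (h w)"
  by (simp add: mvar_def)

lemma mrename_mconst [simp]: "mrename h (mconst c) = mconst c"
  by (simp add: mconst_def)

lemma mrename_one [simp]: "mrename h 1 = 1"
  using mrename_mconst[of h 1] by (simp add: mconst_def)

lemma mrename_mult: "mrename h (g * f) = mrename h g * mrename h f"
proof -
  have "mrename h (g * f) = (\<Sum>a\<in>Poly_Mapping.keys g. \<Sum>b\<in>Poly_Mapping.keys f. Poly_Mapping.single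
      (rename_monomial h a + rename_monomial h b) (Poly_Mapping.lookup g a * Poly_Mapping.lookup f b))"
    by (simp add: mult_expand[of g f] mrename_sum rename_monomial_add)
  then show ?thesis by (simp add: mrename_eq sum_product mult_single)
qed

lemma homog_component_mrename: "homog_component n (mrename h f) = mrename h (homog_component n f)"
proof -
  have "mrename h (homog_component n f)
      = mrename h (homog_component n (\<Sum>m\<in>Poly_Mapping.keys f. Poly_Mapping.single m (Poly_Mapping.lookup f m)))"
    using poly_mapping_expand[of f] by simp
  also have "\<dots> = homog_component n (mrename h f)"
    by (auto simp: mrename_eq[of h f] homog_component_sum homog_component_single mrename_sum intro!: sum.cong)
  finally show ?thesis ..
qed

lemma mrename_inverse:
  assumes f: "f \<in> carrier (poly_ring A)" and inv: "\<And>w. w \<in> A \<Longrightarrow> h' (h w) = w"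
  shows "mrename h' (mrename h f) = f"
proof -
  have mon: "rename_monomial h' (rename_monomial h m) = m" if "m \<in> Poly_Mapping.keys f" for m
  proof -
    have "Poly_Mapping.keys m \<subseteq> A" using f that by (auto simp: poly_ring_def)
    then have "rename_monomial h' (rename_monomial h m)
        = (\<Sum>w\<in>Poly_Mapping.keys m. Poly_Mapping.single w (Poly_Mapping.lookup m w))"
      unfolding rename_monomial_def[of h m] rename_monomial_sum using inv by (intro sum.cong) auto
    then show ?thesis using poly_mapping_expand[of m] by simp
  qed
  have "mrename h' (mrename h f)
      = (\<Sum>m\<in>Poly_Mapping.keys f. Poly_Mapping.single m (Poly_Mapping.lookup f m))"
    unfolding mrename_eq[of h f] mrename_sum using mon by (intro sum.cong) auto
  then show ?thesis using poly_mapping_expand[of f] by simp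
qed

section \<open>The symmetric algebra\<close>

lemma poly_ring_simps [simp]:
  "f \<otimes>\<^bsub>poly_ring A\<^esub> g = f * g" "f \<oplus>\<^bsub>poly_ring A\<^esub> g = f + g" "\<one>\<^bsub>poly_ring A\<^esub> = 1" "\<zero>\<^bsub>poly_ring A\<^esub> = 0"
  by (simp_all add: poly_ring_def)

lemma poly_ring_carrier: "f \<in> carrier (poly_ring A) \<longleftrightarrow> (\<forall>m\<in>Poly_Mapping.keys f. Poly_Mapping.keys m \<subseteq> A)"
  by (simp add: poly_ring_def)

lemma poly_ring_add: "f \<in> carrier (poly_ring A) \<Longrightarrow> g \<in> carrier (poly_ring A) \<Longrightarrow> f + g \<in> carrier (poly_ring A)"
  unfolding poly_ring_carrier using keys_add[of f g] by blast

lemma poly_ring_sum: "(\<And>i. i \<in> B \<Longrightarrow> f i \<in> carrier (poly_ring A)) \<Longrightarrow> sum f B \<in> carrier (poly_ring A)"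
  by (induction B rule: infinite_finite_induct) (auto intro: poly_ring_add simp: poly_ring_carrier[of 0])

lemma poly_ring_single: "Poly_Mapping.keys m \<subseteq> A \<Longrightarrow> Poly_Mapping.single m c \<in> carrier (poly_ring A)"
  by (simp add: poly_ring_carrier)

lemma poly_ring_mult:
  assumes "f \<in> carrier (poly_ring A)" "g \<in> carrier (poly_ring A)"
  shows "f * g \<in> carrier (poly_ring A)"
  unfolding mult_expand
proof (intro poly_ring_sum poly_ring_single)
  fix a b assume "a \<in> Poly_Mapping.keys f" "b \<in> Poly_Mapping.keys g"
  then show "Poly_Mapping.keys (a + b) \<subseteq> A"
    using assms keys_add[of a b] unfolding poly_ring_carrier by blast
qed

lemma poly_ring_mconst: "mconst c \<in> carrier (poly_ring A)"
  by (simp add: mconst_def poly_ring_single)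

lemma poly_ring_one: "1 \<in> carrier (poly_ring A)"
  by (simp add: poly_ring_carrier)

lemma poly_ring_uminus: "f \<in> carrier (poly_ring A) \<Longrightarrow> - f \<in> carrier (poly_ring A)"
  by (simp add: poly_ring_carrier)

lemma poly_ring_minus: "f \<in> carrier (poly_ring A) \<Longrightarrow> g \<in> carrier (poly_ring A) \<Longrightarrow> f - g \<in> carrier (poly_ring A)"
  using poly_ring_add[of f A "- g"] poly_ring_uminus[of g A] by simp

lemma poly_ring_mvar: "w \<in> A \<Longrightarrow> mvar w \<in> carrier (poly_ring A)"
  by (simp add: mvar_def poly_ring_single)

lemma poly_ring_homog_component: "f \<in> carrier (poly_ring A) \<Longrightarrow> homog_component n f \<in> carrier (poly_ring A)"
  unfolding poly_ring_carrier using keys_homog_component by blast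

lemma poly_ring_mrename:
  assumes "f \<in> carrier (poly_ring A)" "h ` A \<subseteq> A"
  shows "mrename h f \<in> carrier (poly_ring A)"
  unfolding mrename_eq
proof (intro poly_ring_sum poly_ring_single)
  fix m assume m: "m \<in> Poly_Mapping.keys f"
  have "Poly_Mapping.keys (rename_monomial h m) \<subseteq> h ` Poly_Mapping.keys m"
    unfolding rename_monomial_def by (rule subset_trans[OF keys_sum]) (auto split: if_splits)
  then show "Poly_Mapping.keys (rename_monomial h m) \<subseteq> A"
    using assms m unfolding poly_ring_carrier by blast
qed

lemma poly_ring_cring: "cring (poly_ring A)"
proof (intro cringI abelian_groupI comm_monoidI)
  fix f assume "f \<in> carrier (poly_ring A)"
  then show "\<exists>g\<in>carrier (poly_ring A). g \<oplus>\<^bsub>poly_ring A\<^esub> f = \<zero>\<^bsub>poly_ring A\<^esub>"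
    by (intro bexI[of _ "- f"]) (auto intro: poly_ring_uminus)
qed (auto simp: poly_ring_add poly_ring_mult algebra_simps poly_ring_carrier[of 0] poly_ring_carrier[of 1])

lemma poly_ring_a_inv: "f \<in> carrier (poly_ring A) \<Longrightarrow> \<ominus>\<^bsub>poly_ring A\<^esub> f = - f"
proof -
  assume f: "f \<in> carrier (poly_ring A)"
  interpret cring "poly_ring A" by (rule poly_ring_cring)
  show ?thesis using f by (intro minus_equality) (auto intro: poly_ring_uminus)
qed

locale symmetric_algebra =
  fixes W :: "('k::comm_ring_1, 'w) module"
  assumes W_add: "\<And>u w. u \<in> carrier W \<Longrightarrow> w \<in> carrier W \<Longrightarrow> u \<oplus>\<^bsub>W\<^esub> w \<in> carrier W"
    and W_smult: "\<And>c w. w \<in> carrier W \<Longrightarrow> c \<odot>\<^bsub>W\<^esub> w \<in> carrier W"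
begin

abbreviation P where "P \<equiv> poly_ring (carrier W) :: ('k, 'w) mpol ring"
abbreviation I where "I \<equiv> sym_ideal W"
abbreviation coset where "coset f \<equiv> I +>\<^bsub>P\<^esub> f"

definition relations :: "('k, 'w) mpol set" where
  "relations = {mvar (u \<oplus>\<^bsub>W\<^esub> w) - mvar u - mvar w | u w. u \<in> carrier W \<and> w \<in> carrier W} \<union>
      {mvar (c \<odot>\<^bsub>W\<^esub> w) - mconst c * mvar w | c w. w \<in> carrier W}"

lemma relations_P: "relations \<subseteq> carrier P"
  unfolding relations_def
  by (auto intro!: poly_ring_minus poly_ring_mvar poly_ring_mult poly_ring_mconst W_add W_smult)

lemma I_eq: "I = genideal P relations"
  by (simp add: sym_ideal_def relations_def)

lemma I_ideal: "ideal I P"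
  unfolding I_eq by (intro ring.genideal_ideal cring.axioms(1) poly_ring_cring relations_P)

lemma relations_I: "relations \<subseteq> I"
  unfolding I_eq by (intro ring.genideal_self cring.axioms(1) poly_ring_cring relations_P)

lemma I_P: "f \<in> I \<Longrightarrow> f \<in> carrier P"
  using ideal.Icarr[OF I_ideal] .

lemma I_zero: "0 \<in> I"
  using additive_subgroup.zero_closed[OF ideal.axioms(1)[OF I_ideal]] by simp

lemma I_add: "f \<in> I \<Longrightarrow> g \<in> I \<Longrightarrow> f + g \<in> I"
  using additive_subgroup.a_closed[OF ideal.axioms(1)[OF I_ideal]] by fastforce

lemma I_mult: "f \<in> I \<Longrightarrow> g \<in> carrier P \<Longrightarrow> g * f \<in> I"
  using ideal.I_l_closed[OF I_ideal] by fastforce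

lemma I_uminus: "f \<in> I \<Longrightarrow> - f \<in> I"
  using I_mult[of f "- 1"] poly_ring_uminus[OF poly_ring_one, of "carrier W"] by simp

lemma I_minus: "f \<in> I \<Longrightarrow> g \<in> I \<Longrightarrow> f - g \<in> I"
  using I_add[of f "- g"] I_uminus[of g] by simp

lemma I_sum: "(\<And>i. i \<in> B \<Longrightarrow> f i \<in> I) \<Longrightarrow> sum f B \<in> I"
  by (induction B rule: infinite_finite_induct) (auto intro: I_add I_zero)

text \<open>
  Induction over the ideal of relations: the elements with property \<open>Q\<close> form an ideal that contains the
  generators. The closure under additive inverses is multiplication by \<open>- 1\<close>.
\<close>

lemma I_induct [consumes 1, case_names relation zero add mult]:
  assumes "f \<in> I" and "\<And>r. r \<in> relations \<Longrightarrow> Q r" and "Q 0"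
    and "\<And>f g. f \<in> carrier P \<Longrightarrow> g \<in> carrier P \<Longrightarrow> Q f \<Longrightarrow> Q g \<Longrightarrow> Q (f + g)"
    and mult: "\<And>f g. f \<in> carrier P \<Longrightarrow> g \<in> carrier P \<Longrightarrow> Q f \<Longrightarrow> Q (g * f)"
  shows "Q f"
proof -
  interpret P: cring P by (rule poly_ring_cring)
  have mult': "Q (f * g)" if "f \<in> carrier P" "g \<in> carrier P" "Q f" for f g
    using mult[OF that] by (simp add: mult.commute)
  have "ideal {f \<in> carrier P. Q f} P"
  proof (intro idealI P.ring_axioms)
    show "subgroup {f \<in> carrier P. Q f} (add_monoid P)"
    proof (rule P.add.subgroupI)
      show "{f \<in> carrier P. Q f} \<noteq> {}" using assms(3) P.zero_closed by auto
      fix f assume "f \<in> {f \<in> carrier P. Q f}"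
      then show "\<ominus>\<^bsub>P\<^esub> f \<in> {f \<in> carrier P. Q f}"
        using mult[of f "- 1"] poly_ring_uminus[OF poly_ring_one, of "carrier W"]
        by (auto simp: poly_ring_a_inv poly_ring_uminus)
    qed (auto simp: assms poly_ring_add)
  qed (auto simp: poly_ring_mult intro: mult mult')
  then have "I \<subseteq> {f \<in> carrier P. Q f}"
    unfolding I_eq using relations_P assms(2) by (intro P.genideal_minimal) auto
  then show ?thesis using assms(1) by auto
qed

text \<open>
  The relations are homogeneous of degree one, so their ideal is homogeneous. The polynomial multiplier
  is split into monomials to reduce to homogeneous factors.
\<close>

lemma homog_component_I:
  assumes "f \<in> I" shows "homog_component n f \<in> I"
proof -
  have "\<forall>n. homog_component n f \<in> I"
    using assms
  proof (induction rule: I_induct)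
    case (relation r)
    have deg_mvar: "\<forall>m\<in>Poly_Mapping.keys (mvar w :: ('k, 'w) mpol). mon_degree m = 1" for w
      by (simp add: mvar_def)
    have deg_mult: "mconst c * mvar w = Poly_Mapping.single (Poly_Mapping.single w 1) c" for c :: 'k and w :: 'w
      by (simp add: mvar_def mconst_def mult_single)
    have "homog_component n r = (if n = 1 then r else 0)" for n
      using relation unfolding relations_def
      by (auto simp: homog_component_minus homog_component_homogeneous[OF deg_mvar]
          deg_mult homog_component_single)
    then show ?case using relation relations_I I_zero by auto
  next
    case (mult f g)
    show ?case
    proof
      fix n
      have "g * f = (\<Sum>m\<in>Poly_Mapping.keys g. f * Poly_Mapping.single m (Poly_Mapping.lookup g m))"
        by (subst poly_mapping_expand[of g]) (simp add: sum_distrib_left mult.commute[of _ f])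
      then have "homog_component n (g * f)
          = (\<Sum>m\<in>Poly_Mapping.keys g. homog_component n (f * Poly_Mapping.single m (Poly_Mapping.lookup g m)))"
        by (simp add: homog_component_sum)
      also have "\<dots> \<in> I"
      proof (intro I_sum)
        fix m assume m: "m \<in> Poly_Mapping.keys g"
        have "homog_component n (f * Poly_Mapping.single m (Poly_Mapping.lookup g m))
            = (if mon_degree m \<le> n
               then homog_component (n - mon_degree m) f * Poly_Mapping.single m (Poly_Mapping.lookup g m) else 0)"
          by (rule homog_component_mult) simp
        moreover have "Poly_Mapping.single m (Poly_Mapping.lookup g m) \<in> carrier P"
          using mult(2) m by (intro poly_ring_single) (auto simp: poly_ring_carrier)
        ultimately show "homog_component n (f * Poly_Mapping.single m (Poly_Mapping.lookup g m)) \<in> I"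
          using mult(3) I_zero by (auto simp: mult.commute[of _ "Poly_Mapping.single _ _"] intro: I_mult)
      qed
      finally show "homog_component n (g * f) \<in> I" .
    qed
  qed (auto simp: I_zero homog_component_add I_add)
  then show ?thesis ..
qed

lemma coset_eq: "coset f = (\<lambda>i. i + f) ` I"
  by (auto simp: a_r_coset_def r_coset_def)

lemma coset_eq_iff: "coset f = coset g \<longleftrightarrow> f - g \<in> I"
proof
  assume "coset f = coset g"
  moreover have "f \<in> coset f" unfolding coset_eq using I_zero by force
  ultimately obtain i where "i \<in> I" "f = i + g" unfolding coset_eq by auto
  then show "f - g \<in> I" by simp
next
  assume fg: "f - g \<in> I"
  have "i + f \<in> coset g" if "i \<in> I" for i
    unfolding coset_eq using I_add[OF that fg] by (intro image_eqI[of _ _ "i + (f - g)"]) auto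
  moreover have "i + g \<in> coset f" if "i \<in> I" for i
    unfolding coset_eq using I_minus[OF that fg] by (intro image_eqI[of _ _ "i - (f - g)"]) auto
  ultimately show "coset f = coset g" unfolding coset_eq by blast
qed

lemma Sym_cring: "cring (Sym W)"
  unfolding Sym_def by (rule ideal.quotient_is_cring[OF I_ideal poly_ring_cring])

lemma Sym_carrier: "carrier (Sym W) = coset ` carrier P"
  by (auto simp: Sym_def FactRing_def A_RCOSETS_def RCOSETS_def a_r_coset_def)

lemma Sym_ops:
  "f \<in> carrier P \<Longrightarrow> g \<in> carrier P \<Longrightarrow> coset f \<oplus>\<^bsub>Sym W\<^esub> coset g = coset (f + g)"
  "f \<in> carrier P \<Longrightarrow> g \<in> carrier P \<Longrightarrow> coset f \<otimes>\<^bsub>Sym W\<^esub> coset g = coset (f * g)"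
  "\<one>\<^bsub>Sym W\<^esub> = coset 1" "\<zero>\<^bsub>Sym W\<^esub> = coset 0"
proof -
  note hom = ideal.rcos_ring_hom[OF I_ideal, folded Sym_def]
  show "f \<in> carrier P \<Longrightarrow> g \<in> carrier P \<Longrightarrow> coset f \<oplus>\<^bsub>Sym W\<^esub> coset g = coset (f + g)"
    using ring_hom_add[OF hom, of f g] by simp
  show "f \<in> carrier P \<Longrightarrow> g \<in> carrier P \<Longrightarrow> coset f \<otimes>\<^bsub>Sym W\<^esub> coset g = coset (f * g)"
    using ring_hom_mult[OF hom, of f g] by simp
  show "\<one>\<^bsub>Sym W\<^esub> = coset 1" using ring_hom_one[OF hom] by simp
  show "\<zero>\<^bsub>Sym W\<^esub> = coset 0" by (simp add: Sym_def FactRing_def coset_eq)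
qed

lemma Sym_minus: "f \<in> carrier P \<Longrightarrow> \<ominus>\<^bsub>Sym W\<^esub> coset f = coset (- f)"
proof -
  assume f: "f \<in> carrier P"
  interpret Sym: cring "Sym W" by (rule Sym_cring)
  show ?thesis
    using f poly_ring_uminus[OF f] by (intro Sym.minus_equality) (auto simp: Sym_ops Sym_carrier)
qed

definition linear_bijection :: "('w \<Rightarrow> 'w) \<Rightarrow> bool" where
  "linear_bijection h \<longleftrightarrow> bij_betw h (carrier W) (carrier W) \<and>
     (\<forall>u\<in>carrier W. \<forall>w\<in>carrier W. h (u \<oplus>\<^bsub>W\<^esub> w) = h u \<oplus>\<^bsub>W\<^esub> h w) \<and>
     (\<forall>c. \<forall>w\<in>carrier W. h (c \<odot>\<^bsub>W\<^esub> w) = c \<odot>\<^bsub>W\<^esub> h w)"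

lemma linear_bijection_inv:
  assumes "linear_bijection h"
  shows "linear_bijection (inv_into (carrier W) h)"
proof -
  have b: "bij_betw h (carrier W) (carrier W)" using assms by (simp add: linear_bijection_def)
  note inj = bij_betw_imp_inj_on[OF b]
  have cl: "inv_into (carrier W) h w \<in> carrier W" "h (inv_into (carrier W) h w) = w" if "w \<in> carrier W" for w
    using bij_betw_imp_surj_on[OF b] that by (auto intro: inv_into_into f_inv_into_f)
  have "inv_into (carrier W) h (u \<oplus>\<^bsub>W\<^esub> w) = inv_into (carrier W) h u \<oplus>\<^bsub>W\<^esub> inv_into (carrier W) h w"
    if "u \<in> carrier W" "w \<in> carrier W" for u w
    by (rule inj_onD[OF inj]) (use that assms cl W_add in \<open>auto simp: linear_bijection_def\<close>)
  moreover have "inv_into (carrier W) h (c \<odot>\<^bsub>W\<^esub> w) = c \<odot>\<^bsub>W\<^esub> inv_into (carrier W) h w"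
    if "w \<in> carrier W" for c w
    by (rule inj_onD[OF inj]) (use that assms cl W_smult in \<open>auto simp: linear_bijection_def\<close>)
  ultimately show ?thesis
    using bij_betw_inv_into[OF b] by (simp add: linear_bijection_def)
qed

lemma mrename_I:
  assumes h: "linear_bijection h" and f: "f \<in> I" shows "mrename h f \<in> I"
  using f
proof (induction rule: I_induct)
  case (relation r)
  have hW: "h w \<in> carrier W" if "w \<in> carrier W" for w
    using h that by (auto simp: linear_bijection_def bij_betw_def)
  from relation consider
      u w where "u \<in> carrier W" "w \<in> carrier W" "r = mvar (u \<oplus>\<^bsub>W\<^esub> w) - mvar u - mvar w"
    | c w where "w \<in> carrier W" "r = mvar (c \<odot>\<^bsub>W\<^esub> w) - mconst c * mvar w"
    unfolding relations_def by blast
  then have "mrename h r \<in> relations"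
  proof cases
    case 1
    then have "mrename h r = mvar (h u \<oplus>\<^bsub>W\<^esub> h w) - mvar (h u) - mvar (h w)"
      using h by (simp add: mrename_minus linear_bijection_def)
    then show ?thesis unfolding relations_def using hW 1(1,2) by blast
  next
    case 2
    then have "mrename h r = mvar (c \<odot>\<^bsub>W\<^esub> h w) - mconst c * mvar (h w)"
      using h by (simp add: mrename_minus mrename_mult linear_bijection_def)
    then show ?thesis unfolding relations_def using hW 2(1) by blast
  qed
  then show ?case using relations_I by auto
next
  case (mult f g)
  have "h ` carrier W \<subseteq> carrier W" using h by (auto simp: linear_bijection_def bij_betw_def)
  then show ?case using mult by (auto simp: mrename_mult intro!: I_mult poly_ring_mrename)
qed (auto simp: I_zero mrename_add I_add)

text \<open>
  Linearity of \<open>h\<close> means that the substitution maps relations to relations; applied to the inverse of \<open>h\<close>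
  this shows that every element of the ideal is reached.
\<close>

lemma mrename_image_I:
  assumes h: "linear_bijection h" shows "mrename h ` I = I"
proof
  show "mrename h ` I \<subseteq> I" using mrename_I[OF h] by auto
  show "I \<subseteq> mrename h ` I"
  proof
    fix f assume f: "f \<in> I"
    let ?h = "inv_into (carrier W) h"
    have "mrename h (mrename ?h f) = f"
      by (rule mrename_inverse[OF I_P[OF f]])
        (use h in \<open>auto simp: linear_bijection_def intro: bij_betw_inv_into_right\<close>)
    moreover have "mrename ?h f \<in> I" by (rule mrename_I[OF linear_bijection_inv[OF h] f])
    ultimately show "f \<in> mrename h ` I" by (metis imageI)
  qed
qed

lemma sym_map_coset:
  assumes "linear_bijection h"
  shows "sym_map h (coset f) = coset (mrename h f)"
proof -
  have "sym_map h (coset f) = (\<lambda>i. i + mrename h f) ` (mrename h ` I)"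
    unfolding sym_map_def coset_eq by (simp add: image_image mrename_add)
  then show ?thesis unfolding mrename_image_I[OF assms] coset_eq .
qed

text \<open>
  The choice of the representative is immaterial because the ideal of relations is homogeneous.
\<close>

definition component :: "nat \<Rightarrow> ('k, 'w) symel \<Rightarrow> ('k, 'w) symel" where
  "component n C = coset (homog_component n (SOME f. f \<in> carrier P \<and> C = coset f))"

lemma component_coset:
  assumes f: "f \<in> carrier P" shows "component n (coset f) = coset (homog_component n f)"
proof -
  define g where "g = (SOME g. g \<in> carrier P \<and> coset f = coset g)"
  have "g \<in> carrier P \<and> coset f = coset g"
    unfolding g_def by (rule someI[where x = f]) (simp add: f)
  then have "g - f \<in> I" using coset_eq_iff[of g f] by simp
  then have "homog_component n g - homog_component n f \<in> I"
    using homog_component_I[of "g - f" n] by (simp add: homog_component_minus)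
  then show ?thesis unfolding component_def g_def[symmetric] by (simp add: coset_eq_iff)
qed

definition fixed_ring :: "('w \<Rightarrow> 'w) set \<Rightarrow> ('k, 'w) symel ring" where
  "fixed_ring H = (Sym W)\<lparr>carrier := {C \<in> carrier (Sym W). \<forall>h\<in>H. sym_map h C = C}\<rparr>"

text \<open>
  Substitutions by linear bijections are ring homomorphisms that preserve degrees. Hence the fixed elements
  form a subring, and the homogeneous components of a fixed element are fixed.
\<close>

lemma fixed_ring_graded:
  assumes H: "\<And>h. h \<in> H \<Longrightarrow> linear_bijection h"
  shows "graded_cring (fixed_ring H) (\<lambda>n. carrier (fixed_ring H) \<inter> sym_grade W n) component"
proof -
  interpret Sym: cring "Sym W" by (rule Sym_cring)
  let ?S = "fixed_ring H"
  have hP: "mrename h f \<in> carrier P" if "h \<in> H" "f \<in> carrier P" for h f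
    using H[OF that(1)] that(2) by (intro poly_ring_mrename) (auto simp: linear_bijection_def bij_betw_def)
  have mem: "coset f \<in> carrier ?S \<longleftrightarrow> (\<forall>h\<in>H. mrename h f - f \<in> I)" if "f \<in> carrier P" for f
    using that by (auto simp: fixed_ring_def Sym_carrier sym_map_coset[OF H] coset_eq_iff)
  have cases: "\<exists>f\<in>carrier P. C = coset f" if "C \<in> carrier ?S" for C
    using that by (auto simp: fixed_ring_def Sym_carrier)
  have ops: "\<one>\<^bsub>?S\<^esub> = \<one>\<^bsub>Sym W\<^esub>" "\<zero>\<^bsub>?S\<^esub> = \<zero>\<^bsub>Sym W\<^esub>" "C \<oplus>\<^bsub>?S\<^esub> D = C \<oplus>\<^bsub>Sym W\<^esub> D" "C \<otimes>\<^bsub>?S\<^esub> D = C \<otimes>\<^bsub>Sym W\<^esub> D" for C D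
    by (simp_all add: fixed_ring_def)
  have "subring (carrier ?S) (Sym W)"
  proof (rule Sym.subringI)
    show "carrier ?S \<subseteq> carrier (Sym W)" by (auto simp: fixed_ring_def)
    show "\<one>\<^bsub>Sym W\<^esub> \<in> carrier ?S" unfolding Sym_ops using I_zero by (simp add: mem poly_ring_one)
  next
    fix C assume C: "C \<in> carrier ?S"
    then obtain f where f: "f \<in> carrier P" "C = coset f" using cases by blast
    have "mrename h (- f) - (- f) \<in> I" if "h \<in> H" for h
    proof -
      have "- (mrename h f - f) \<in> I" using C mem[OF f(1)] f(2) that by (intro I_uminus) auto
      then show ?thesis by (simp add: mrename_uminus)
    qed
    then show "\<ominus>\<^bsub>Sym W\<^esub> C \<in> carrier ?S"
      unfolding f(2) Sym_minus[OF f(1)] using mem[OF poly_ring_uminus[OF f(1)]] by blast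
    fix D assume D: "D \<in> carrier ?S"
    then obtain g where g: "g \<in> carrier P" "D = coset g" using cases by blast
    have fI: "mrename h f - f \<in> I" and gI: "mrename h g - g \<in> I" if "h \<in> H" for h
      using C D mem[OF f(1)] mem[OF g(1)] f(2) g(2) that by auto
    have "mrename h (f + g) - (f + g) \<in> I" if "h \<in> H" for h
    proof -
      have "mrename h (f + g) - (f + g) = (mrename h f - f) + (mrename h g - g)"
        by (simp add: mrename_add)
      then show ?thesis using I_add[OF fI[OF that] gI[OF that]] by (simp only:)
    qed
    then show "C \<oplus>\<^bsub>Sym W\<^esub> D \<in> carrier ?S"
      unfolding f(2) g(2) Sym_ops(1)[OF f(1) g(1)] using mem[OF poly_ring_add[OF f(1) g(1)]] by blast
    have "mrename h (f * g) - (f * g) \<in> I" if "h \<in> H" for h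
    proof -
      have "mrename h (f * g) - (f * g) = mrename h f * (mrename h g - g) + g * (mrename h f - f)"
        by (simp add: mrename_mult algebra_simps)
      moreover have "mrename h f * (mrename h g - g) \<in> I" "g * (mrename h f - f) \<in> I"
        using that fI gI hP f g by (auto intro: I_mult)
      ultimately show ?thesis using I_add by (simp only:)
    qed
    then show "C \<otimes>\<^bsub>Sym W\<^esub> D \<in> carrier ?S"
      unfolding f(2) g(2) Sym_ops(2)[OF f(1) g(1)] using mem[OF poly_ring_mult[OF f(1) g(1)]] by blast
  qed
  then have "subcring (carrier ?S) (Sym W)" by (rule Sym.subcringI')
  moreover have "(Sym W)\<lparr>carrier := carrier ?S\<rparr> = ?S" by (simp add: fixed_ring_def)
  ultimately have "cring ?S"
    using Sym.subcring_iff[of "carrier ?S"] by (auto simp: fixed_ring_def)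
  then interpret S: cring ?S .
  have comp: "coset (homog_component n f) \<in> carrier ?S" if "f \<in> carrier P" "coset f \<in> carrier ?S" for f n
  proof -
    have "mrename h (homog_component n f) - homog_component n f \<in> I" if "h \<in> H" for h
      using homog_component_I[of "mrename h f - f" n] mem[OF \<open>f \<in> carrier P\<close>] \<open>coset f \<in> carrier ?S\<close> that
      by (simp add: homog_component_minus homog_component_mrename)
    then show ?thesis using mem[OF poly_ring_homog_component[OF that(1)]] by blast
  qed
  show ?thesis
  proof
    fix n C assume "C \<in> carrier ?S"
    then show "component n C \<in> carrier ?S" using cases comp component_coset by metis
  next
    fix n C D assume "C \<in> carrier ?S" "D \<in> carrier ?S"
    then obtain f g where "f \<in> carrier P" "C = coset f" "g \<in> carrier P" "D = coset g" using cases by metis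
    then show "component n (C \<oplus>\<^bsub>?S\<^esub> D) = component n C \<oplus>\<^bsub>?S\<^esub> component n D"
      by (simp add: ops Sym_ops component_coset poly_ring_add homog_component_add poly_ring_homog_component)
  next
    fix n m C X assume "C \<in> carrier ?S" "X \<in> carrier ?S \<inter> sym_grade W m"
    then obtain f g where "f \<in> carrier P" "C = coset f" "g \<in> carrier P" "X = coset g"
      "\<forall>m'\<in>Poly_Mapping.keys g. mon_degree m' = m"
      using cases[of C] by (auto simp: sym_grade_def)
    then show "component n (C \<otimes>\<^bsub>?S\<^esub> X) = (if m \<le> n then component (n - m) C \<otimes>\<^bsub>?S\<^esub> X else \<zero>\<^bsub>?S\<^esub>)"
      using homog_component_mult[of g m n f]
      by (simp add: ops Sym_ops component_coset poly_ring_mult poly_ring_homog_component)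
  next
    fix C assume C: "C \<in> carrier ?S"
    then obtain f where f: "f \<in> carrier P" "C = coset f" using cases by blast
    have "(\<Oplus>\<^bsub>?S\<^esub>n\<in>{..<N}. component n C) = coset (\<Sum>n<N. homog_component n f)" for N
    proof (induction N)
      case 0
      then show ?case by (simp add: ops Sym_ops)
    next
      case (Suc N)
      have "component n C \<in> carrier ?S" for n
        using comp[OF f(1)] C f(2) component_coset[OF f(1)] by simp
      then show ?case
        using Suc f by (simp add: lessThan_Suc ops component_coset Sym_ops poly_ring_sum
            poly_ring_homog_component add.commute)
    qed
    then show "\<exists>N. C = (\<Oplus>\<^bsub>?S\<^esub>n\<in>{..<N}. component n C)"
      using sum_homog_components[of f] f(2) by metis
  qed auto
qed

end

section \<open>Rings of invariants\<close>

lemma dual_symmetric_algebra: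
  fixes scale :: "'k::field \<Rightarrow> 'v::ab_group_add \<Rightarrow> 'v"
  assumes "vector_space scale"
  shows "symmetric_algebra (dual scale)"
proof
  fix u w :: "'v \<Rightarrow> 'k" and c :: 'k
  assume "w \<in> carrier (dual scale)"
  then show "c \<odot>\<^bsub>dual scale\<^esub> w \<in> carrier (dual scale)"
    by (auto simp: dual_def Vector_Spaces.linear_iff algebra_simps)
  assume "u \<in> carrier (dual scale)"
  with \<open>w \<in> carrier (dual scale)\<close> show "u \<oplus>\<^bsub>dual scale\<^esub> w \<in> carrier (dual scale)"
    by (auto simp: dual_def Vector_Spaces.linear_iff algebra_simps)
qed

lemma linear_comp_field:
  assumes "Vector_Spaces.linear scale scale g" "Vector_Spaces.linear scale (*) \<phi>"
  shows "Vector_Spaces.linear scale (*) (\<phi> \<circ> g)"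
  using assms by (simp add: Vector_Spaces.linear_iff)

lemma linear_inv_of_bij:
  assumes g: "Vector_Spaces.linear scale scale g" "bij g"
  shows "Vector_Spaces.linear scale scale (inv_into UNIV g)"
proof -
  have *: "g (inv_into UNIV g v) = v" for v using g(2) by (simp add: bij_is_surj surj_f_inv_f)
  have "inv_into UNIV g (u + v) = inv_into UNIV g u + inv_into UNIV g v" for u v
    by (rule injD[OF bij_is_inj[OF g(2)]]) (use g * in \<open>simp add: Vector_Spaces.linear_iff\<close>)
  moreover have "inv_into UNIV g (scale c v) = scale c (inv_into UNIV g v)" for c v
    by (rule injD[OF bij_is_inj[OF g(2)]]) (use g * in \<open>simp add: Vector_Spaces.linear_iff\<close>)
  ultimately show ?thesis using g(1) by (simp add: Vector_Spaces.linear_iff)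
qed

text \<open>
  The inverse of \<open>\<phi> \<mapsto> \<phi> \<circ> g\<^sup>-\<^sup>1\<close> is \<open>\<phi> \<mapsto> \<phi> \<circ> g\<close>.
\<close>

lemma dual_act_linear_bijection:
  assumes "vector_space scale" and g: "g \<in> carrier (GL scale)"
  shows "symmetric_algebra.linear_bijection (dual scale) (dual_act g)"
proof -
  have lin: "Vector_Spaces.linear scale scale g" and b: "bij g" using g by (auto simp: GL_def)
  have gi: "g \<circ> inv_into UNIV g = id" "inv_into UNIV g \<circ> g = id" using b by (auto simp: bij_is_surj bij_is_inj surj_iff[symmetric])
  have "bij_betw (dual_act g) (carrier (dual scale)) (carrier (dual scale))"
  proof (rule bij_betwI[of _ _ _ "\<lambda>\<phi>. \<phi> \<circ> g"])
    show "dual_act g \<in> carrier (dual scale) \<rightarrow> carrier (dual scale)"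
      using linear_comp_field[OF linear_inv_of_bij[OF lin b]] by (auto simp: dual_def dual_act_def)
    show "(\<lambda>\<phi>. \<phi> \<circ> g) \<in> carrier (dual scale) \<rightarrow> carrier (dual scale)"
      using linear_comp_field[OF lin] by (auto simp: dual_def)
  qed (auto simp: dual_act_def comp_assoc gi)
  then show ?thesis
    unfolding symmetric_algebra.linear_bijection_def[OF dual_symmetric_algebra[OF assms(1)]]
    by (auto simp: dual_def dual_act_def)
qed

lemma invariant_ring_graded:
  assumes "vector_space scale" "G \<subseteq> carrier (GL scale)"
  shows "graded_cring (invariant_ring scale G) (invariant_grade scale G)
    (symmetric_algebra.component (dual scale))"
proof -
  interpret symmetric_algebra "dual scale" by (rule dual_symmetric_algebra[OF assms(1)])
  have S: "invariant_ring scale G = fixed_ring (dual_act ` G)"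
    by (auto simp: invariant_ring_def fixed_ring_def)
  have "invariant_grade scale G = (\<lambda>n. carrier (fixed_ring (dual_act ` G)) \<inter> sym_grade (dual scale) n)"
    by (auto simp: invariant_grade_def S)
  then show ?thesis
    using fixed_ring_graded[of "dual_act ` G"] dual_act_linear_bijection[OF assms(1)] assms(2)
    unfolding S by auto
qed

theorem corollary1p5:
  fixes p q d :: nat
    and scale :: "'k::{finite,field} \<Rightarrow> 'v::ab_group_add \<Rightarrow> 'v"
    and G :: "('v \<Rightarrow> 'v) set"
    and S :: "('k, 'v \<Rightarrow> 'k) symel ring"
    and Spos :: "('k, 'v \<Rightarrow> 'k) symel set"
    and \<dd> :: "('k, 'v \<Rightarrow> 'k) symel"
    and a :: "nat \<Rightarrow> nat"
    and \<qq> :: "nat \<Rightarrow> ('k, 'v \<Rightarrow> 'k) symel"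
    and x :: "nat \<Rightarrow> ('k, 'v \<Rightarrow> 'k) symel"
  assumes "prime p" and "\<exists>e\<ge>1. q = p ^ e" and "card (UNIV :: 'k set) = q"
    and "\<exists>B. finite_dimensional_vector_space scale B"
    and "d = vector_space.dim scale (UNIV :: 'v set)"
    and "subgroup G (GL scale)"
    and "S = invariant_ring scale G"
    and "Spos = irrelevant S (invariant_grade scale G)"
    and "\<dd> = top_dickson scale"
    and "\<And>j. j < d \<Longrightarrow>
           a j \<ge> 1 \<and>
           \<dd> [^]\<^bsub>S\<^esub> a j \<in> ann S (local_cohomology S Spos (self_module S) j) \<and>
           (\<forall>b\<ge>1. \<dd> [^]\<^bsub>S\<^esub> b \<in> ann S (local_cohomology S Spos (self_module S) j) \<longrightarrow> a j \<le> b)"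
    and "\<And>i. i < d \<Longrightarrow> \<qq> i = (\<Otimes>\<^bsub>S\<^esub>j\<in>{0..i}. \<dd> [^]\<^bsub>S\<^esub> a j)"
    and "homogeneous_sop S (invariant_grade scale G) d x"
  shows "\<forall>t\<in>{1..d}. \<qq> (d - 1) \<in> ann S (colon_quot S (genideal S (x ` {1..<t})) (x t))"
proof
  fix t assume t: "t \<in> {1..d}"
  have "vector_space scale"
    using assms(4) by (auto simp: finite_dimensional_vector_space_def)
  moreover have "G \<subseteq> carrier (GL scale)" using assms(6) by (rule subgroup.subset)
  ultimately interpret graded_cring S "invariant_grade scale G" "symmetric_algebra.component (dual scale)"
    unfolding assms(7) by (rule invariant_ring_graded)
  have "(\<Otimes>\<^bsub>S\<^esub>j\<in>{0..d - 1}. \<dd> [^]\<^bsub>S\<^esub> a j) \<in> ann S (colon_quot S (genideal S (x ` {1..<t})) (x t))"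
  proof (rule annihilator_of_colon_quotients)
    show "\<exists>n\<ge>1. x i \<in> invariant_grade scale G n" if "i \<in> {1..d}" for i
      using assms(12) that by (auto simp: homogeneous_sop_def)
    show "radical S (genideal S (x ` {1..d})) = Spos"
      using assms(8,12) by (simp add: homogeneous_sop_def)
    show "\<dd> [^]\<^bsub>S\<^esub> a j \<in> ann S (local_cohomology S Spos (self_module S) j)" if "j < d" for j
      using assms(10)[OF that] by blast
  qed (rule t)
  then show "\<qq> (d - 1) \<in> ann S (colon_quot S (genideal S (x ` {1..<t})) (x t))"
    using assms(11)[of "d - 1"] t by simp
qed

end
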